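(* Let $K$ be a field, $P=K[x_1,\dots,x_n]$, $I\subset P$ a 0-dimensional ideal, and $R=P/I$. Then the following conditions are equivalent. (a) The ring $R$ is a strict Gorenstein ring. (b) The ring $R$ has the Cayley-Bacharach property and a symmetric affine Hilbert function. If these conditions are satisfied, then $R$ is locally Gorenstein.
   Context: Setting: $I$ is a proper ideal of $P=K[x_1,\dots,x_n]$ such that $\dim_K(P/I)<\infty$; $R=P/I$ is always considered with this fixed presentation. Degree filtration: $F_iP=\{f\in P\mid \deg f\le i\}\cup\{0\}$, $F_iI=F_iP\cap I$, and $F_iR=F_iP/F_iI$ is the image of $F_iP$ in $R$ ($i\in\mathbb Z$). $\mathrm{HF}^a_R(i)=\dim_K F_iR$ is the affine Hilbert function, and $\Delta\mathrm{HF}^a_R(i)=\mathrm{HF}^a_R(i)-\mathrm{HF}^a_R(i-1)$. The regularity index is $\mathrm{ri}(R)=\min\{i\in\mathbb Z\mid \mathrm{HF}^a_R(j)=\dim_K R \text{ for all } j\ge i\}$. For $f\in R\setminus\{0\}$, $\mathrm{ord}_{\mathcal F}(f)=\min\{i\mid f\in F_iR\}$. $\mathrm{HF}^a_R$ is symmetric if $\Delta\mathrm{HF}^a_R(\mathrm{ri}(R)-i)=\Delta\mathrm{HF}^a_R(i)$ for all $i\in\mathbb Z$. Cayley-Bacharach property (CBP): let $I=\mathfrak Q_1\cap\dots\cap\mathfrak Q_s$ be the primary decomposition, $\mathfrak M_i=\mathrm{Rad}(\mathfrak Q_i)$ (maximal ideals), $\ell_i=\dim_K(P/\mathfrak M_i)$.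 A $\mathfrak Q_i$-divisor of $I$ is an ideal $J=\mathfrak Q_1\cap\dots\cap\mathfrak Q_i'\cap\dots\cap\mathfrak Q_s$ ($\mathfrak Q_i$ replaced by $\mathfrak Q_i'$), where $\mathfrak Q_i'$ is an ideal of $P$ with $\mathfrak Q_i\subsetneq\mathfrak Q_i'$ (so $\mathfrak Q_i'\subseteq\mathfrak M_i$ or $\mathfrak Q_i'=P$). It is minimal if $\dim_K(J/I)=\ell_i$. For a minimal $\mathfrak Q_i$-divisor $J$ with image $\bar J=J/I$ in $R$, put $\mathrm{ri}(\bar J)=\max\{\mathrm{ord}_{\mathcal F}(f)\mid f\in\bar J\setminus\{0\}\}$. $R$ has the CBP if for every $i\in\{1,\dots,s\}$ and every minimal $\mathfrak Q_i$-divisor $J$ of $I$ we have $\mathrm{ri}(\bar J)=\mathrm{ri}(R)$. Gorenstein notions: a 0-dimensional local ring $(A,\mathfrak m)$ is Gorenstein if $\dim_{A/\mathfrak m}\mathrm{Soc}(A)=1$, where $\mathrm{Soc}(A)=\mathrm{Ann}_A(\mathfrak m)$. With $\mathfrak q_i$ the image of $\mathfrak Q_i$ in $R$, $R$ is locally Gorenstein if every local ring $R/\mathfrak q_i$ is Gorenstein. The associated graded ring is $\mathrm{gr}_{\mathcal F}(R)=\bigoplus_{i\in\mathbb Z}F_iR/F_{i-1}R\cong P/\mathrm{DF}(I)$, where $\mathrm{DF}(I)$ is the ideal generated by the degree forms (top-degree homogeneous components) of the non-zero elements of $I$. $R$ is a strict Gorenstein ring if $\mathrm{gr}_{\mathcal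 F}(R)$ is a local Gorenstein ring. *)

theory Defs
  imports
    "HOL-Library.Poly_Mapping"
    "HOL-Algebra.Algebra"
    "HOL-Algebra.Algebraic_Closure_Type"
    "Jordan_Normal_Form.Missing_VectorSpace"
begin

section \<open>Local Gorenstein rings\<close>

definition local_ring_with :: "('a, 'b) ring_scheme \<Rightarrow> 'a set \<Rightarrow> bool" where
  "local_ring_with A m \<longleftrightarrow> cring A \<and> (\<forall>m'. maximalideal m' A \<longleftrightarrow> m' = m)"

definition krull_dim_zero :: "('a, 'b) ring_scheme \<Rightarrow> bool" where
  "krull_dim_zero A \<longleftrightarrow> (\<exists>p. primeideal p A) \<and> (\<forall>p. primeideal p A \<longrightarrow> maximalideal p A)"

definition annihilator :: "('a, 'b) ring_scheme \<Rightarrow> 'a set \<Rightarrow> 'a set" where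
  "annihilator A S = {a \<in> carrier A. \<forall>x\<in>S. a \<otimes>\<^bsub>A\<^esub> x = \<zero>\<^bsub>A\<^esub>}"

text \<open>The residue class of \<open>x\<close> modulo \<open>m\<close> acts on \<open>Soc(A) = Ann(m)\<close> by multiplication by \<open>x\<close>.
  The result does not depend on the representative, so the image below is a singleton.\<close>

definition socle_space :: "('a, 'b) ring_scheme \<Rightarrow> 'a set \<Rightarrow> ('a set, 'a) module" where
  "socle_space A m =
     \<lparr>carrier = annihilator A m, monoid.mult = monoid.mult A, one = \<one>\<^bsub>A\<^esub>,
      ring.zero = \<zero>\<^bsub>A\<^esub>, add = add A,
      module.smult = (\<lambda>C s. the_elem ((\<lambda>x. x \<otimes>\<^bsub>A\<^esub> s) ` C))\<rparr>"

text \<open>\<^const>\<open>vectorspace.dim\<close> is only meaningful for spaces with a finite generating set, hence the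
  explicit \<^const>\<open>vectorspace.fin_dim\<close>.\<close>

definition gorenstein_local_ring :: "('a, 'b) ring_scheme \<Rightarrow> bool" where
  "gorenstein_local_ring A \<longleftrightarrow>
     krull_dim_zero A \<and>
     (\<exists>m. local_ring_with A m \<and>
          vectorspace.fin_dim (A Quot m) (socle_space A m) \<and>
          vectorspace.dim (A Quot m) (socle_space A m) = 1)"


section \<open>The associated graded ring of a filtered ring\<close>

definition gr_component :: "('a, 'b) ring_scheme \<Rightarrow> (int \<Rightarrow> 'a set) \<Rightarrow> int \<Rightarrow> 'a set monoid" where
  "gr_component R F i = (add_monoid R)\<lparr>carrier := F i\<rparr> Mod F (i - 1)"

text \<open>Additively, the direct sum of the groups \<open>F\<^sub>i / F\<^sub>i\<^sub>-\<^sub>1\<close>. The product of homogeneous classes is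
  \<open>(a + F\<^sub>i\<^sub>-\<^sub>1) (b + F\<^sub>j\<^sub>-\<^sub>1) = a b + F\<^sub>i\<^sub>+\<^sub>j\<^sub>-\<^sub>1\<close>; the component of degree \<open>k\<close> of a product is the sum (written
  \<^const>\<open>finprod\<close>, as \<^const>\<open>gr_component\<close> is a multiplicative record) over all \<open>i + j = k\<close> for
  which both factors are non-zero.\<close>

definition gr_ring :: "('a, 'b) ring_scheme \<Rightarrow> (int \<Rightarrow> 'a set) \<Rightarrow> (int \<Rightarrow> 'a set) ring" where
  "gr_ring R F =
     \<lparr>carrier = carrier (sum_group UNIV (gr_component R F)),
      monoid.mult = (\<lambda>a b k.
        finprod (gr_component R F k) (\<lambda>i. rcoset_mult R (F (k - 1)) (a i) (b (k - i)))
          {i. a i \<noteq> \<one>\<^bsub>gr_component R F i\<^esub> \<and> b (k - i) \<noteq> \<one>\<^bsub>gr_component R F (k - i)\<^esub>}),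
      one = (\<lambda>i. if i = 0 then F (- 1) +>\<^bsub>R\<^esub> \<one>\<^bsub>R\<^esub> else \<one>\<^bsub>gr_component R F i\<^esub>),
      ring.zero = \<one>\<^bsub>sum_group UNIV (gr_component R F)\<^esub>,
      add = monoid.mult (sum_group UNIV (gr_component R F))\<rparr>"


section \<open>Affine algebras with a fixed presentation and their degree filtration\<close>

text \<open>The indeterminates are indexed by a finite type, so \<open>n\<close> is its cardinality.\<close>

type_synonym ('n, 'k) mvpoly = "('n \<Rightarrow>\<^sub>0 nat) \<Rightarrow>\<^sub>0 'k"

abbreviation field_ring :: "'k::field ring" ("\<K>") where
  "\<K> \<equiv> ring_of_type_algebra"

abbreviation poly_ring :: "('n::finite, 'k::field) mvpoly ring" ("\<P>") where
  "\<P> \<equiv> ring_of_type_algebra"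

definition const_poly :: "'k::field \<Rightarrow> ('n::finite, 'k) mvpoly" where
  "const_poly c = Poly_Mapping.single 0 c"

definition monom_deg :: "('n::finite \<Rightarrow>\<^sub>0 nat) \<Rightarrow> nat" where
  "monom_deg t = (\<Sum>x\<in>UNIV. Poly_Mapping.lookup t x)"

text \<open>Only used for \<open>f \<noteq> 0\<close>.\<close>

definition poly_deg :: "('n::finite, 'k::field) mvpoly \<Rightarrow> nat" where
  "poly_deg f = Max (monom_deg ` Poly_Mapping.keys f)"

definition filt_P :: "int \<Rightarrow> ('n::finite, 'k::field) mvpoly set" where
  "filt_P i = {f. f \<noteq> 0 \<and> int (poly_deg f) \<le> i} \<union> {0}"

definition img_quot :: "('n::finite, 'k::field) mvpoly set \<Rightarrow> ('n, 'k) mvpoly set \<Rightarrow>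
    ('n, 'k) mvpoly set set" where
  "img_quot I S = (\<lambda>f. I +>\<^bsub>\<P>\<^esub> f) ` S"

text \<open>A \<open>K\<close>-subspace \<open>V\<close> of \<open>P/I\<close>, as a module record; constants act through \<open>K \<rightarrow> P \<rightarrow> P/I\<close>.\<close>

definition K_space :: "('n::finite, 'k::field) mvpoly set \<Rightarrow> ('n, 'k) mvpoly set set \<Rightarrow>
    ('k, ('n, 'k) mvpoly set) module" where
  "K_space I V =
     \<lparr>carrier = V, monoid.mult = monoid.mult (\<P> Quot I), one = \<one>\<^bsub>\<P> Quot I\<^esub>,
      ring.zero = \<zero>\<^bsub>\<P> Quot I\<^esub>, add = add (\<P> Quot I),
      module.smult = (\<lambda>c v. (I +>\<^bsub>\<P>\<^esub> const_poly c) \<otimes>\<^bsub>\<P> Quot I\<^esub> v)\<rparr>"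

definition dim_K :: "('n::finite, 'k::field) mvpoly set \<Rightarrow> ('n, 'k) mvpoly set set \<Rightarrow> nat" where
  "dim_K I V = vectorspace.dim \<K> (K_space I V)"

definition zero_dim_ideal :: "('n::finite, 'k::field) mvpoly set \<Rightarrow> bool" where
  "zero_dim_ideal I \<longleftrightarrow> ideal I \<P> \<and> I \<noteq> carrier \<P> \<and>
     vectorspace.fin_dim \<K> (K_space I (carrier (\<P> Quot I)))"

definition filt_R :: "('n::finite, 'k::field) mvpoly set \<Rightarrow> int \<Rightarrow> ('n, 'k) mvpoly set set" where
  "filt_R I i = img_quot I (filt_P i)"

definition HFa :: "('n::finite, 'k::field) mvpoly set \<Rightarrow> int \<Rightarrow> nat" where
  "HFa I i = dim_K I (filt_R I i)"

definition Delta_HFa :: "('n::finite, 'k::field) mvpoly set \<Rightarrow> int \<Rightarrow> int" where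
  "Delta_HFa I i = int (HFa I i) - int (HFa I (i - 1))"

text \<open>The minimum exists for a zero-dimensional ideal: \<open>HF\<^sup>a\<close> vanishes at negative
  arguments, and \<open>dim\<^sub>K (P/I) > 0\<close>. The same remark applies to \<open>ord_F\<close> below.\<close>

definition reg_index :: "('n::finite, 'k::field) mvpoly set \<Rightarrow> int" where
  "reg_index I = (LEAST i. \<forall>j\<ge>i. HFa I j = dim_K I (carrier (\<P> Quot I)))"

definition symmetric_HFa :: "('n::finite, 'k::field) mvpoly set \<Rightarrow> bool" where
  "symmetric_HFa I \<longleftrightarrow> (\<forall>i. Delta_HFa I (reg_index I - i) = Delta_HFa I i)"

definition ord_F :: "('n::finite, 'k::field) mvpoly set \<Rightarrow> ('n, 'k) mvpoly set \<Rightarrow> int" where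
  "ord_F I f = (LEAST i. f \<in> filt_R I i)"


section \<open>Primary decomposition and the Cayley-Bacharach property\<close>

definition primary_ideal :: "'a set \<Rightarrow> ('a, 'b) ring_scheme \<Rightarrow> bool" where
  "primary_ideal Q A \<longleftrightarrow> cring A \<and> ideal Q A \<and> Q \<noteq> carrier A \<and>
     (\<forall>a\<in>carrier A. \<forall>b\<in>carrier A. a \<otimes>\<^bsub>A\<^esub> b \<in> Q \<longrightarrow> a \<in> Q \<or> (\<exists>n::nat. b [^]\<^bsub>A\<^esub> n \<in> Q))"

definition ideal_radical :: "('a, 'b) ring_scheme \<Rightarrow> 'a set \<Rightarrow> 'a set" where
  "ideal_radical A Q = {a \<in> carrier A. \<exists>n::nat. a [^]\<^bsub>A\<^esub> n \<in> Q}"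

definition is_primary_decomposition ::
    "('n::finite, 'k::field) mvpoly set \<Rightarrow> ('n, 'k) mvpoly set set \<Rightarrow> bool" where
  "is_primary_decomposition I \<Q> \<longleftrightarrow>
     finite \<Q> \<and> (\<forall>Q\<in>\<Q>. primary_ideal Q \<P>) \<and> I = \<Inter>\<Q> \<and>
     inj_on (ideal_radical \<P>) \<Q> \<and> (\<forall>Q\<in>\<Q>. \<not> \<Inter>(\<Q> - {Q}) \<subseteq> Q)"

text \<open>The set \<open>{Q\<^sub>1, \<dots>, Q\<^sub>s}\<close>. A zero-dimensional ideal has exactly one irredundant primary
  decomposition with distinct radicals, since all its associated primes are maximal.\<close>

definition primary_components ::
    "('n::finite, 'k::field) mvpoly set \<Rightarrow> ('n, 'k) mvpoly set set" where
  "primary_components I = (THE \<Q>. is_primary_decomposition I \<Q>)"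

text \<open>\<open>Q\<close> ranges over \<^const>\<open>primary_components\<close>. If \<open>Q\<close> is the only component, the
  intersection of the others is \<open>UNIV\<close>, i.e. the polynomial ring.\<close>

definition Q_divisor :: "('n::finite, 'k::field) mvpoly set \<Rightarrow> ('n, 'k) mvpoly set \<Rightarrow>
    ('n, 'k) mvpoly set \<Rightarrow> bool" where
  "Q_divisor I Q J \<longleftrightarrow>
     (\<exists>Q'. ideal Q' \<P> \<and> Q \<subset> Q' \<and> J = Q' \<inter> \<Inter>(primary_components I - {Q}))"

definition minimal_Q_divisor :: "('n::finite, 'k::field) mvpoly set \<Rightarrow> ('n, 'k) mvpoly set \<Rightarrow>
    ('n, 'k) mvpoly set \<Rightarrow> bool" where
  "minimal_Q_divisor I Q J \<longleftrightarrow> Q_divisor I Q J \<and>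
     dim_K I (img_quot I J) =
       dim_K (ideal_radical \<P> Q) (carrier (\<P> Quot ideal_radical \<P> Q))"

definition reg_index_ideal :: "('n::finite, 'k::field) mvpoly set \<Rightarrow> ('n, 'k) mvpoly set \<Rightarrow> int" where
  "reg_index_ideal I J = Max (ord_F I ` (img_quot I J - {\<zero>\<^bsub>\<P> Quot I\<^esub>}))"

definition cayley_bacharach :: "('n::finite, 'k::field) mvpoly set \<Rightarrow> bool" where
  "cayley_bacharach I \<longleftrightarrow>
     (\<forall>Q\<in>primary_components I. \<forall>J. minimal_Q_divisor I Q J \<longrightarrow> reg_index_ideal I J = reg_index I)"


section \<open>Gorenstein properties of \<open>P/I\<close>\<close>

definition locally_gorenstein :: "('n::finite, 'k::field) mvpoly set \<Rightarrow> bool" where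
  "locally_gorenstein I \<longleftrightarrow>
     (\<forall>Q\<in>primary_components I. gorenstein_local_ring ((\<P> Quot I) Quot (img_quot I Q)))"

definition strict_gorenstein :: "('n::finite, 'k::field) mvpoly set \<Rightarrow> bool" where
  "strict_gorenstein I \<longleftrightarrow> gorenstein_local_ring (gr_ring (\<P> Quot I) (filt_R I))"

end

theory Submission
  imports Defs
begin

text \<open>Put \<open>r = ri(R)\<close> and let \<open>G\<close> be the associated graded ring of \<open>R\<close>, a local ring whose largest non-zero
  degree is \<open>r\<close>. Since \<open>G\<^sub>r\<close> lies in the socle of \<open>G\<close>, the ring \<open>G\<close> is Gorenstein iff \<open>G\<^sub>r\<close> is
  one-dimensional and all pairings \<open>G\<^sub>i \<times> G\<^sub>r\<^sub>-\<^sub>i \<rightarrow> G\<^sub>r\<close> are perfect. On the other hand, minimal divisors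
  correspond to minimal ideals of \<open>R\<close>, so the Cayley-Bacharach property says that no non-zero ideal of \<open>R\<close>
  is contained in \<open>F\<^sub>r\<^sub>-\<^sub>1 R\<close>. If \<open>G\<^sub>r\<close> is one-dimensional, i.e. \<open>F\<^sub>r\<^sub>-\<^sub>1 R\<close> is the kernel of a linear form \<open>\<phi>\<close>,
  this is the non-degeneracy of \<open>(x, y) \<mapsto> \<phi>(x y)\<close> on \<open>R\<close>. The orthogonal space of \<open>F\<^sub>i R\<close> always contains
  \<open>F\<^sub>r\<^sub>-\<^sub>1\<^sub>-\<^sub>i R\<close>, and symmetry of the Hilbert function is the equality of the two dimensions, which
  turns non-degeneracy on \<open>R\<close> into perfectness of the graded pairings. Finally, an algebra with a non-degenerate
  form \<open>\<phi>(x y)\<close> is locally Gorenstein: every functional is of the form \<open>\<phi>(s \<cdot>)\<close>, and a functional vanishing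
  on the maximal ideal \<open>M\<close> yields a generator of the socle at \<open>M\<close>.\<close>

text \<open>Subspaces of R are replaced throughout by subspaces of P that contain I, and their
  dimensions by \<open>rel_dim I\<close>. The argument thus stays in the type of polynomials, and
  record structures enter only through surjections from P. Likewise gr(R) becomes P modulo
  \<open>lead_ideal\<close>, where the grading of P is at hand. Two facts of the overview deserve
  their reason. If G is Gorenstein, the pairings are perfect: given a non-zero homogeneous f0 of
  degree i, choose a homogeneous g of largest degree with f0 g non-zero in G; then f0 g lies in the
  socle, which is the line G_r, so g has degree r - i. If the Hilbert function is symmetric, G_r is
  a line: its dimension equals that of F_0 R, which is K because I is proper. The bounds relating
  orthogonal spaces, both for symmetry of the Hilbert function and for double orthogonals, come from
  the single inequality \<open>rel_dim_pairing\<close>. For these two uses, equality results from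
  applying it twice with the roles of the spaces exchanged.\<close>

section \<open>Dimensions relative to a subspace\<close>

text \<open>A copy of \<^locale>\<open>vector_space\<close>: definitions made there would be shadowed by their instance for
  real vector spaces, which is interpreted with an optional qualifier.\<close>

locale relative_dimension = vector_space scale
  for scale :: "'a::field \<Rightarrow> 'b::ab_group_add \<Rightarrow> 'b"
begin

text \<open>For infinite B the sum is 0 by convention, so with 0 in U the condition can hold for
  finite B only.\<close>

definition rel_indep :: "'b set \<Rightarrow> 'b set \<Rightarrow> bool" where
  "rel_indep U B \<longleftrightarrow> (\<forall>c. (\<Sum>b\<in>B. scale (c b) b) \<in> U \<longrightarrow> (\<forall>b\<in>B. c b = 0))"

definition fin_codim :: "'b set \<Rightarrow> bool" where
  "fin_codim U \<longleftrightarrow> subspace U \<and> (\<exists>S. finite S \<and> span (S \<union> U) = UNIV)"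

definition proj_mod :: "'b set \<Rightarrow> ('b \<Rightarrow> 'b) \<Rightarrow> bool" where
  "proj_mod U p \<longleftrightarrow> Vector_Spaces.linear scale scale p \<and> (\<forall>x. p x = 0 \<longleftrightarrow> x \<in> U) \<and> (\<forall>x. p x - x \<in> U)"

text \<open>The dimension of V/U. The projection is an arbitrary choice;
  \<open>rel_dim_unique\<close> shows that any finite basis of V modulo U gives the value.\<close>

definition rel_dim :: "'b set \<Rightarrow> 'b set \<Rightarrow> nat" where
  "rel_dim U V = dim ((SOME p. proj_mod U p) ` V)"

lemma proj_mod_exists:
  assumes U: "subspace U"
  shows "\<exists>p. proj_mod U p"
proof -
  interpret P: vector_space_pair scale scale by unfold_locales
  obtain B where B: "B \<subseteq> U" "independent B" "U \<subseteq> span B"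
    using maximal_independent_subset by blast
  obtain C where C: "B \<subseteq> C" "independent C" "UNIV \<subseteq> span C"
    using maximal_independent_subset_extend[of B UNIV] B by auto
  \<comment> \<open>Kill a basis of U and fix the other members of a basis of the whole
    space.\<close>
  obtain p where p: "Vector_Spaces.linear scale scale p" "\<forall>x\<in>C. p x = (if x \<in> B then 0 else x)"
    using P.linear_independent_extend[OF C(2), of "\<lambda>x. if x \<in> B then 0 else x"] by blast
  interpret p: Vector_Spaces.linear scale scale p by fact
  have 0: "p x = 0" if "x \<in> U" for x
  proof (rule p.eq_0_on_span)
    show "x \<in> span B" using B(3) that by blast
    show "p b = 0" if "b \<in> B" for b using p(2) C(1) that by auto
  qed
  have "subspace {x. p x - x \<in> U}"
    using U unfolding subspace_def
    by (auto simp: p.add p.scale p.zero algebra_simps) 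
      (metis (no_types, opaque_lifting) add_diff_eq diff_diff_eq2 diff_add_eq scale_right_diff_distrib)+
  moreover have "C \<subseteq> {x. p x - x \<in> U}"
    using p(2) B(1) U by (auto simp: subspace_0 subspace_neg)
  ultimately have 1: "p x - x \<in> U" for x
    using C(3) span_minimal[of C "{x. p x - x \<in> U}"] by auto
  have "x \<in> U" if "p x = 0" for x
    using 1[of x] that subspace_neg[OF U, of "- x"] by simp
  with 0 1 p(1) show ?thesis unfolding proj_mod_def by blast
qed

lemma rel_indep_proj_mod:
  assumes p: "proj_mod U p" and B: "finite B" "rel_indep U B"
  shows "inj_on p B" "independent (p ` B)"
proof -
  interpret p: Vector_Spaces.linear scale scale p using p unfolding proj_mod_def by simp
  have p0: "p x = 0 \<longleftrightarrow> x \<in> U" for x using p unfolding proj_mod_def by simp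
  show inj: "inj_on p B"
  proof (rule inj_onI, rule ccontr)
    fix x y assume xy: "x \<in> B" "y \<in> B" "p x = p y" "x \<noteq> y"
    let ?c = "\<lambda>b. if b = x then 1 :: 'a else if b = y then - 1 else 0"
    have "(\<Sum>b\<in>B. scale (?c b) b) = (\<Sum>b\<in>{x,y}. scale (?c b) b)"
      using B(1) xy by (intro sum.mono_neutral_right) auto
    also have "\<dots> = x - y" using xy by simp
    also have "\<dots> \<in> U" using p0[of "x - y"] xy by (simp add: p.diff)
    finally have "\<forall>b\<in>B. ?c b = 0" using B(2) unfolding rel_indep_def by (elim allE[of _ ?c]) blast
    with xy show False by (auto split: if_splits)
  qed
  show "independent (p ` B)"
  proof (rule independent_if_scalars_zero)
    fix f x assume h: "(\<Sum>x\<in>p ` B. scale (f x) x) = 0" "x \<in> p ` B"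
    have "p (\<Sum>b\<in>B. scale (f (p b)) b) = (\<Sum>b\<in>B. scale (f (p b)) (p b))"
      by (simp add: p.sum p.scale)
    also have "\<dots> = 0" using h(1) by (simp add: sum.reindex[OF inj])
    finally have "\<forall>b\<in>B. f (p b) = 0" using B(2) p0 unfolding rel_indep_def by meson
    with h(2) show "f x = 0" by auto
  qed (use B in simp)
qed

lemma rel_dim_unique:
  assumes U: "subspace U" and B: "finite B" "B \<subseteq> V" "V \<subseteq> span (B \<union> U)" "rel_indep U B"
  shows "rel_dim U V = card B"
proof -
  define p where "p = (SOME p. proj_mod U p)"
  have p: "proj_mod U p" unfolding p_def by (rule someI_ex[OF proj_mod_exists[OF U]])
  then interpret p: Vector_Spaces.linear scale scale p unfolding proj_mod_def by simp
  have p0: "p x = 0 \<longleftrightarrow> x \<in> U" for x using p unfolding proj_mod_def by simp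
  note inj = rel_indep_proj_mod(1)[OF p B(1,4)] and ind = rel_indep_proj_mod(2)[OF p B(1,4)]
  have "p ` V \<subseteq> span (p ` B)"
  proof -
    have "p ` V \<subseteq> p ` span (B \<union> U)" using B by auto
    also have "\<dots> = span (p ` (B \<union> U))" by (simp add: p.span_image)
    also have "\<dots> \<subseteq> span (insert 0 (p ` B))" by (rule span_mono) (auto simp: p0)
    finally show ?thesis by simp
  qed
  then have "dim (p ` V) = card (p ` B)"
    using ind B by (intro dim_unique) auto
  then show ?thesis unfolding rel_dim_def p_def[symmetric] by (simp add: card_image[OF inj])
qed

text \<open>Nested bases of the images of W and V under a projection along U are bases modulo U.
  They lie in W and V because p x differs from x by an element of U, which both spaces
  contain.\<close>

lemma rel_basis_extend:
  assumes U: "fin_codim U" and W: "subspace W" "U \<subseteq> W" and V: "subspace V" "W \<subseteq> V"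
  shows "\<exists>C B. finite B \<and> C \<subseteq> B \<and> C \<subseteq> W \<and> W \<subseteq> span (C \<union> U) \<and> rel_indep U C
    \<and> B \<subseteq> V \<and> V \<subseteq> span (B \<union> U) \<and> rel_indep U B"
proof -
  have sU: "subspace U" using U fin_codim_def by blast
  obtain p where p: "proj_mod U p" using proj_mod_exists[OF sU] by blast
  then interpret p: Vector_Spaces.linear scale scale p unfolding proj_mod_def by simp
  have p0: "p x = 0 \<longleftrightarrow> x \<in> U" and px: "p x - x \<in> U" for x using p unfolding proj_mod_def by simp_all
  have pp: "p (p x) = p x" for x using px[of x] p0[of "p x - x"] by (simp add: p.diff)
  obtain C where C: "C \<subseteq> p ` W" "independent C" "p ` W \<subseteq> span C"
    using maximal_independent_subset by blast
  obtain B where B: "C \<subseteq> B" "B \<subseteq> p ` V" "independent B" "p ` V \<subseteq> span B"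
    using maximal_independent_subset_extend[of C "p ` V"] C V by (metis image_mono subset_trans)
  obtain S where S: "finite S" "span (S \<union> U) = UNIV" using U fin_codim_def by blast
  have "range p = span (p ` (S \<union> U))" using S(2) by (simp add: p.span_image)
  also have "\<dots> \<subseteq> span (insert 0 (p ` S))" by (rule span_mono) (auto simp: p0)
  finally have rp: "range p \<subseteq> span (p ` S)" by simp
  then have "B \<subseteq> span (p ` S)" using B(2) by blast
  then have fB: "finite B" using independent_span_bound[of "p ` S" B] S B by auto
  have sub: "p ` T \<subseteq> T" if "local.subspace T" "U \<subseteq> T" for T
  proof clarify
    fix x assume "x \<in> T"
    then show "p x \<in> T" using subspace_add[OF that(1), of "p x - x" x] px[of x] that by auto
  qed
  have ri: "rel_indep U D" if D: "D \<subseteq> range p" "independent D" for D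
    unfolding rel_indep_def
  proof (intro allI impI ballI)
    fix c b assume h: "(\<Sum>b\<in>D. scale (c b) b) \<in> U" "b \<in> D"
    have fix_D: "p d = d" if "d \<in> D" for d using D(1) that pp by auto
    show "c b = 0"
    \<comment> \<open>An infinite sum would be 0 and carry no information; the finite codimension of
      U excludes this case.\<close>
    proof (cases "finite D")
      case True
      have "(\<Sum>b\<in>D. scale (c b) b) = p (\<Sum>b\<in>D. scale (c b) b)"
        by (simp add: p.sum p.scale fix_D)
      also have "\<dots> = 0" using h p0 by simp
      finally show ?thesis using independentD[OF D(2) True] h by auto
    next
      case False
      have "D \<subseteq> span (p ` S)" using D(1) rp by auto
      then show ?thesis using independent_span_bound[of "p ` S" D] S D False by auto
    qed
  qed
  have sp: "T \<subseteq> span (D \<union> U)" if "p ` T \<subseteq> span D" for T D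
  proof
    fix x assume "x \<in> T"
    then have "p x \<in> span (D \<union> U)" using that span_mono[of D "D \<union> U"] by auto
    moreover have "p x - x \<in> span (D \<union> U)" using px by (auto intro: span_base)
    ultimately have "p x - (p x - x) \<in> span (D \<union> U)" by (rule span_diff)
    then show "x \<in> span (D \<union> U)" by simp
  qed
  have "C \<subseteq> range p" "B \<subseteq> range p" using C(1) B(2) by blast+
  then have "rel_indep U C" "rel_indep U B" using ri C(2) B(3) by blast+
  moreover have "p ` W \<subseteq> W" "p ` V \<subseteq> V" using sub[OF W] sub[OF V(1)] W V by auto
  then have "C \<subseteq> W" "B \<subseteq> V" using C(1) B(2) by simp_all
  ultimately show ?thesis using fB B(1) sp[OF C(3)] sp[OF B(4)]
    by (intro exI[of _ C] exI[of _ B] conjI)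
qed

lemma rel_basis_exists:
  assumes U: "fin_codim U" and V: "subspace V" "U \<subseteq> V"
  shows "\<exists>B. finite B \<and> B \<subseteq> V \<and> V \<subseteq> span (B \<union> U) \<and> rel_indep U B \<and> card B = rel_dim U V"
proof -
  have "subspace U" using U fin_codim_def by blast
  with rel_basis_extend[OF U V V(1) subset_refl] show ?thesis
    by (metis rel_dim_unique)
qed

text \<open>E consists of the vectors that extend a basis of W modulo U to one of V.\<close>

lemma rel_dim_supplement:
  assumes U: "fin_codim U" and W: "subspace W" "U \<subseteq> W" and V: "subspace V" "W \<subseteq> V"
  shows "\<exists>E. finite E \<and> E \<subseteq> V \<and> V \<subseteq> span (E \<union> W) \<and> card E + rel_dim U W = rel_dim U V"
proof -
  have sU: "subspace U" using U fin_codim_def by blast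
  obtain C B where CB: "finite B" "C \<subseteq> B" "C \<subseteq> W" "W \<subseteq> span (C \<union> U)" "rel_indep U C"
    "B \<subseteq> V" "V \<subseteq> span (B \<union> U)" "rel_indep U B"
    using rel_basis_extend[OF assms] by blast
  have "card C = rel_dim U W" "card B = rel_dim U V"
    using CB finite_subset by (auto intro!: rel_dim_unique[symmetric] sU)
  moreover have "card (B - C) + card C = card B"
    using CB(1,2) finite_subset[OF CB(2,1)] by (simp add: card_Diff_subset card_mono)
  moreover have "V \<subseteq> span ((B - C) \<union> W)"
    using CB(7,3) W span_mono[of "B \<union> U" "(B - C) \<union> W"] by auto
  ultimately show ?thesis using CB by (intro exI[of _ "B - C"]) auto
qed

lemma rel_dim_mono:
  assumes U: "fin_codim U" and W: "subspace W" "U \<subseteq> W" and V: "subspace V" "W \<subseteq> V"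
  shows "rel_dim U W \<le> rel_dim U V"
  using rel_dim_supplement[OF assms] by auto

lemma rel_dim_eq_imp_eq:
  assumes U: "fin_codim U" and W: "subspace W" "U \<subseteq> W" and V: "subspace V" "W \<subseteq> V"
    and le: "rel_dim U V \<le> rel_dim U W"
  shows "W = V"
proof -
  obtain E where E: "finite E" "V \<subseteq> span (E \<union> W)" "card E + rel_dim U W = rel_dim U V"
    using rel_dim_supplement[OF U W V] by blast
  with le have "card E = 0" by linarith
  with E have "V \<subseteq> span W" by simp
  then show ?thesis using V(2) span_eq_iff W(1) by blast
qed

text \<open>Modulo U, the space V is spanned by E and a basis of W, and an independent set is no
  larger than a spanning one.\<close>

lemma rel_dim_le_card_add:
  assumes U: "fin_codim U" and W: "subspace W" "U \<subseteq> W" and V: "subspace V" "W \<subseteq> V"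
    and E: "finite E" "V \<subseteq> span (E \<union> W)"
  shows "rel_dim U V \<le> card E + rel_dim U W"
proof -
  have sU: "subspace U" using U fin_codim_def by blast
  obtain p where p: "proj_mod U p" using proj_mod_exists[OF sU] by blast
  then interpret p: Vector_Spaces.linear scale scale p unfolding proj_mod_def by simp
  have p0: "p x = 0 \<longleftrightarrow> x \<in> U" for x using p unfolding proj_mod_def by simp
  obtain C where C: "finite C" "C \<subseteq> W" "W \<subseteq> span (C \<union> U)" "card C = rel_dim U W"
    using rel_basis_exists[OF U W] by blast
  obtain B where B: "finite B" "B \<subseteq> V" "rel_indep U B" "card B = rel_dim U V"
    using rel_basis_exists[OF U V(1)] W V by blast
  have WE: "W \<subseteq> span (E \<union> C \<union> U)" using C(3) span_mono[of "C \<union> U" "E \<union> C \<union> U"] by auto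
  have "B \<subseteq> span (E \<union> C \<union> U)"
  proof -
    have "span (E \<union> W) \<subseteq> span (E \<union> C \<union> U)"
      by (rule span_minimal) (use WE in \<open>auto intro: span_base\<close>)
    then show ?thesis using B E by blast
  qed
  then have "p ` B \<subseteq> span (p ` (E \<union> C \<union> U))" using p.span_image[of "E \<union> C \<union> U"] by blast
  also have "\<dots> \<subseteq> span (insert 0 (p ` (E \<union> C)))" by (rule span_mono) (auto simp: p0)
  finally have sp: "p ` B \<subseteq> span (p ` (E \<union> C))" by simp
  note inj = rel_indep_proj_mod(1)[OF p B(1,3)]
  have "independent (p ` B)" by (rule rel_indep_proj_mod(2)[OF p B(1,3)])
  then have "card (p ` B) \<le> card (p ` (E \<union> C))"
    using independent_span_bound[OF _ _ sp] E C by auto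
  also have "\<dots> \<le> card (E \<union> C)" using E C by (intro card_image_le) auto
  also have "\<dots> \<le> card E + card C" by (rule card_Un_le)
  finally show ?thesis using B C by (simp add: card_image[OF inj])
qed

text \<open>If f h is non-zero for some h in V, then h together with the kernel spans V: subtracting
  a multiple of h moves any vector into the kernel.\<close>

lemma rel_dim_inter_kernel:
  assumes U: "fin_codim U" and V: "subspace V" "U \<subseteq> V"
    and f: "Vector_Spaces.linear scale (*) f" "\<forall>x\<in>U. f x = 0"
  shows "rel_dim U V \<le> Suc (rel_dim U {x \<in> V. f x = 0})"
proof -
  interpret f: Vector_Spaces.linear scale "(*)" f by fact
  let ?W = "{x \<in> V. f x = 0}"
  have W: "subspace ?W" "U \<subseteq> ?W" "?W \<subseteq> V"
    using V f(2) by (auto simp: subspace_def f.add f.scale f.zero)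
  show ?thesis
  proof (cases "?W = V")
    case True then show ?thesis by simp
  next
    case False
    then obtain h where h: "h \<in> V" "f h \<noteq> 0" by auto
    have "V \<subseteq> span ({h} \<union> ?W)"
    proof
      fix x assume x: "x \<in> V"
      have "x - scale (f x / f h) h \<in> ?W"
        using x h V by (auto simp: f.diff f.scale intro: subspace_diff subspace_scale)
      then have "(x - scale (f x / f h) h) + scale (f x / f h) h \<in> span ({h} \<union> ?W)"
        by (intro span_add span_scale) (auto intro: span_base)
      then show "x \<in> span ({h} \<union> ?W)" by simp
    qed
    from rel_dim_le_card_add[OF U W(1,2) V(1) W(3) _ this] show ?thesis by simp
  qed
qed

text \<open>If the right radical contains \<open>C\<close> and the left radical is contained in \<open>A\<close>, the pairing
  embeds \<open>B/A\<close> into the dual of \<open>D/C\<close>.\<close>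

lemma rel_dim_pairing:
  assumes U: "fin_codim U"
    and A: "subspace A" "U \<subseteq> A" and B: "subspace B" "A \<subseteq> B"
    and C: "subspace C" "U \<subseteq> C" and D: "subspace D" "C \<subseteq> D"
    and lin1: "\<And>y. Vector_Spaces.linear scale (*) (\<lambda>x. \<beta> x y)"
    and lin2: "\<And>x. Vector_Spaces.linear scale (*) (\<beta> x)"
    and van: "\<And>x y. x \<in> U \<Longrightarrow> \<beta> x y = 0"
    and right: "\<And>x y. x \<in> B \<Longrightarrow> y \<in> C \<Longrightarrow> \<beta> x y = 0"
    and left: "\<And>x. x \<in> B \<Longrightarrow> (\<And>y. y \<in> D \<Longrightarrow> \<beta> x y = 0) \<Longrightarrow> x \<in> A"
  shows "rel_dim U B + rel_dim U C \<le> rel_dim U A + rel_dim U D"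
proof -
  \<comment> \<open>A finite complement of C in D. Its members give the linear conditions on x; each
    costs at most one dimension of B.\<close>
  obtain E where E: "finite E" "E \<subseteq> D" "D \<subseteq> span (E \<union> C)" "card E + rel_dim U C = rel_dim U D"
    using rel_dim_supplement[OF U C D] by blast
  have B0: "subspace {x \<in> B. \<forall>y\<in>F. \<beta> x y = 0}" for F
    using B module_hom.zero[OF module_hom_iff_linear[THEN iffD2, OF lin1]]
      module_hom.add[OF module_hom_iff_linear[THEN iffD2, OF lin1]]
      module_hom.scale[OF module_hom_iff_linear[THEN iffD2, OF lin1]]
    by (simp add: subspace_def)
  have le: "rel_dim U B \<le> rel_dim U {x \<in> B. \<forall>y\<in>F. \<beta> x y = 0} + card F" if "finite F" for F
    using that
  proof induction
    case empty
    then show ?case by simp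
  next
    case (insert e F)
    let ?W = "{x \<in> B. \<forall>y\<in>F. \<beta> x y = 0}"
    have "rel_dim U ?W \<le> Suc (rel_dim U {x \<in> ?W. \<beta> x e = 0})"
      by (rule rel_dim_inter_kernel[OF U B0 _ lin1]) (use A B van in auto)
    moreover have "{x \<in> ?W. \<beta> x e = 0} = {x \<in> B. \<forall>y\<in>insert e F. \<beta> x y = 0}" by auto
    ultimately show ?case using insert by simp
  qed
  \<comment> \<open>Since C is orthogonal to B and E with C spans D, vanishing against E is
    vanishing against D.\<close>
  have sub: "{x \<in> B. \<forall>y\<in>E. \<beta> x y = 0} \<subseteq> A"
  proof clarify
    fix x assume x: "x \<in> B" "\<forall>y\<in>E. \<beta> x y = 0"
    interpret bx: Vector_Spaces.linear scale "(*)" "\<beta> x" by (rule lin2)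
    show "x \<in> A"
    proof (rule left[OF x(1)])
      fix y assume "y \<in> D"
      then have "y \<in> span (E \<union> C)" using E by auto
      then show "\<beta> x y = 0" by (rule bx.eq_0_on_span[rotated]) (use x right in auto)
    qed
  qed
  have "rel_dim U {x \<in> B. \<forall>y\<in>E. \<beta> x y = 0} \<le> rel_dim U A"
    by (rule rel_dim_mono[OF U B0 _ A(1) sub]) (use A B van in auto)
  with le[OF E(1)] E(4) show ?thesis by simp
qed

end

section \<open>Gorenstein local rings as images of surjective ring homomorphisms\<close>

text \<open>A form of one-dimensionality that mentions scalars only through multiples of one vector,
  so that scalars which are residue classes can be replaced by representatives.\<close>

lemma (in vectorspace) fin_dim_dim_eq_1_iff:
  "fin_dim \<and> dim = 1 \<longleftrightarrow>
    (\<exists>s\<in>carrier V. s \<noteq> \<zero>\<^bsub>V\<^esub> \<and> (\<forall>t\<in>carrier V. \<exists>c\<in>carrier K. t = c \<odot>\<^bsub>V\<^esub> s))"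
proof -
  have span_single: "span {s} = {c \<odot>\<^bsub>V\<^esub> s | c. c \<in> carrier K}" if "s \<in> carrier V" for s
  proof -
    have "span {s} = {lincomb a {s} |a. a \<in> {s} \<rightarrow> carrier K}"
      using that by (intro finite_span) auto
    also have "\<dots> = {c \<odot>\<^bsub>V\<^esub> s | c. c \<in> carrier K}"
    proof -
      have lc: "lincomb a {s} = a s \<odot>\<^bsub>V\<^esub> s" if "a s \<in> carrier K" for a
        using that \<open>s \<in> carrier V\<close> by (simp add: lincomb_def)
      have "\<exists>a. c \<odot>\<^bsub>V\<^esub> s = lincomb a {s} \<and> a \<in> {s} \<rightarrow> carrier K" if "c \<in> carrier K" for c
        using lc[of "\<lambda>_. c"] that by (intro exI[of _ "\<lambda>_. c"]) simp
      then show ?thesis using lc by (auto simp: Pi_iff)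
    qed
    finally show ?thesis .
  qed
  show ?thesis
  proof
    assume h: "fin_dim \<and> dim = 1"
    then obtain B where B: "finite B" "basis B" using finite_basis_exists by blast
    then have "card B = 1" using h dim_basis by simp
    then obtain s where s: "B = {s}" using card_1_singletonE by blast
    have s': "s \<in> carrier V" "gen_set {s}" "lin_indpt {s}" using B s by (auto simp: basis_def)
    then have "s \<noteq> \<zero>\<^bsub>V\<^esub>" using vs_zero_lin_dep by blast
    moreover have "\<forall>t\<in>carrier V. \<exists>c\<in>carrier K. t = c \<odot>\<^bsub>V\<^esub> s"
      using s'(2) span_single[OF s'(1)] by blast
    ultimately show "\<exists>s\<in>carrier V. s \<noteq> \<zero>\<^bsub>V\<^esub> \<and> (\<forall>t\<in>carrier V. \<exists>c\<in>carrier K. t = c \<odot>\<^bsub>V\<^esub> s)"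
      using s'(1) by blast
  next
    assume "\<exists>s\<in>carrier V. s \<noteq> \<zero>\<^bsub>V\<^esub> \<and> (\<forall>t\<in>carrier V. \<exists>c\<in>carrier K. t = c \<odot>\<^bsub>V\<^esub> s)"
    then obtain s where s: "s \<in> carrier V" "s \<noteq> \<zero>\<^bsub>V\<^esub>"
      "\<forall>t\<in>carrier V. \<exists>c\<in>carrier K. t = c \<odot>\<^bsub>V\<^esub> s" by blast
    have "gen_set {s}" using span_single[OF s(1)] s by auto
    then show "fin_dim \<and> dim = 1"
      using dim1I s(1,2) unfolding fin_dim_def by (metis empty_subsetI finite.emptyI finite.insertI insert_subset)
  qed
qed

text \<open>As m annihilates s, all representatives of a residue class act alike on s, and
  \<open>the_elem\<close> is applied to a singleton.\<close>

lemma socle_space_smult: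
  assumes "cring A" "ideal m A" "x \<in> carrier A" "s \<in> annihilator A m"
  shows "(m +>\<^bsub>A\<^esub> x) \<odot>\<^bsub>socle_space A m\<^esub> s = x \<otimes>\<^bsub>A\<^esub> s"
proof -
  interpret cring A by fact
  interpret m: ideal m A by fact
  have s: "s \<in> carrier A" using assms(4) by (simp add: annihilator_def)
  have "(a \<oplus>\<^bsub>A\<^esub> x) \<otimes>\<^bsub>A\<^esub> s = x \<otimes>\<^bsub>A\<^esub> s" if "a \<in> m" for a
  proof -
    have a: "a \<in> carrier A" using that m.a_subset by blast
    have "s \<otimes>\<^bsub>A\<^esub> a = \<zero>\<^bsub>A\<^esub>" using assms(4) that by (auto simp: annihilator_def)
    then have "a \<otimes>\<^bsub>A\<^esub> s = \<zero>\<^bsub>A\<^esub>" using a s by (simp add: m_comm)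
    then show ?thesis using a s assms(3) by (simp add: l_distr)
  qed
  moreover have "m +>\<^bsub>A\<^esub> x = (\<lambda>a. a \<oplus>\<^bsub>A\<^esub> x) ` m" by (auto simp: a_r_coset_def')
  moreover have "m \<noteq> {}" using m.zero_closed by blast
  ultimately have "(\<lambda>y. y \<otimes>\<^bsub>A\<^esub> s) ` (m +>\<^bsub>A\<^esub> x) = {x \<otimes>\<^bsub>A\<^esub> s}"
    by (simp add: image_image image_constant_conv)
  then show ?thesis by (simp add: socle_space_def)
qed

lemma vectorspace_socle_space:
  assumes "cring A" "maximalideal m A"
  shows "vectorspace (A Quot m) (socle_space A m)"
proof -
  interpret cring A by fact
  interpret m: maximalideal m A by fact
  interpret Q: field "A Quot m" by (rule m.quotient_is_field) (rule assms(1))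
  let ?S = "socle_space A m"
  have S: "carrier ?S = annihilator A m" "\<zero>\<^bsub>?S\<^esub> = \<zero>\<^bsub>A\<^esub>" "\<And>x y. x \<oplus>\<^bsub>?S\<^esub> y = x \<oplus>\<^bsub>A\<^esub> y"
    by (simp_all add: socle_space_def)
  have carrQ: "carrier (A Quot m) = (\<lambda>x. m +>\<^bsub>A\<^esub> x) ` carrier A"
    by (auto simp: FactRing_def A_RCOSETS_def')
  have ann: "s \<in> annihilator A m \<longleftrightarrow> s \<in> carrier A \<and> (\<forall>a\<in>m. s \<otimes>\<^bsub>A\<^esub> a = \<zero>\<^bsub>A\<^esub>)" for s
    by (simp add: annihilator_def)
  have mc: "a \<in> m \<Longrightarrow> a \<in> carrier A" for a using m.a_subset by blast
  have sm: "(m +>\<^bsub>A\<^esub> x) \<odot>\<^bsub>?S\<^esub> s = x \<otimes>\<^bsub>A\<^esub> s" if "x \<in> carrier A" "s \<in> annihilator A m" for x s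
    using socle_space_smult[OF assms(1) m.is_ideal that] .
  have cl: "x \<otimes>\<^bsub>A\<^esub> s \<in> annihilator A m" if "x \<in> carrier A" "s \<in> annihilator A m" for x s
    using that by (auto simp: ann m_assoc mc)
  have cl2: "s \<oplus>\<^bsub>A\<^esub> t \<in> annihilator A m" if "s \<in> annihilator A m" "t \<in> annihilator A m" for s t
    using that by (auto simp: ann l_distr mc)
  have "module (A Quot m) ?S"
  proof (rule module_criteria)
    show "cring (A Quot m)" by (rule Q.is_cring)
    show "\<zero>\<^bsub>?S\<^esub> \<in> carrier ?S" by (auto simp: S ann mc)
    show "\<forall>v w. v \<in> carrier ?S \<and> w \<in> carrier ?S \<longrightarrow> v \<oplus>\<^bsub>?S\<^esub> w \<in> carrier ?S"
      by (simp add: S cl2)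
    show "\<forall>v\<in>carrier ?S. \<exists>neg_v\<in>carrier ?S. v \<oplus>\<^bsub>?S\<^esub> neg_v = \<zero>\<^bsub>?S\<^esub>"
    proof
      fix v assume v: "v \<in> carrier ?S"
      then have "\<ominus>\<^bsub>A\<^esub> v \<in> carrier ?S" by (auto simp: S ann l_minus mc)
      moreover have "v \<oplus>\<^bsub>?S\<^esub> (\<ominus>\<^bsub>A\<^esub> v) = \<zero>\<^bsub>?S\<^esub>" using v by (simp add: S ann r_neg)
      ultimately show "\<exists>neg_v\<in>carrier ?S. v \<oplus>\<^bsub>?S\<^esub> neg_v = \<zero>\<^bsub>?S\<^esub>" by blast
    qed
    show "\<forall>c v. c \<in> carrier (A Quot m) \<and> v \<in> carrier ?S \<longrightarrow> c \<odot>\<^bsub>?S\<^esub> v \<in> carrier ?S"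
      by (auto simp: carrQ S sm cl)
    show "\<forall>v w. v \<in> carrier ?S \<and> w \<in> carrier ?S \<longrightarrow> v \<oplus>\<^bsub>?S\<^esub> w = w \<oplus>\<^bsub>?S\<^esub> v"
      by (auto simp: S ann a_comm)
    show "\<forall>v w x. v \<in> carrier ?S \<and> w \<in> carrier ?S \<and> x \<in> carrier ?S \<longrightarrow>
        v \<oplus>\<^bsub>?S\<^esub> w \<oplus>\<^bsub>?S\<^esub> x = v \<oplus>\<^bsub>?S\<^esub> (w \<oplus>\<^bsub>?S\<^esub> x)"
      by (auto simp: S ann a_assoc)
    show "\<forall>v\<in>carrier ?S. v \<oplus>\<^bsub>?S\<^esub> \<zero>\<^bsub>?S\<^esub> = v" by (auto simp: S ann)
    show "\<forall>a b v. a \<in> carrier (A Quot m) \<and> b \<in> carrier (A Quot m) \<and> v \<in> carrier ?S \<longrightarrow>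
        (a \<otimes>\<^bsub>A Quot m\<^esub> b) \<odot>\<^bsub>?S\<^esub> v = a \<odot>\<^bsub>?S\<^esub> (b \<odot>\<^bsub>?S\<^esub> v)"
    proof (intro allI impI, elim conjE)
      fix a b v assume "a \<in> carrier (A Quot m)" "b \<in> carrier (A Quot m)" and v: "v \<in> carrier ?S"
      then obtain x y where xy: "x \<in> carrier A" "y \<in> carrier A" "a = m +>\<^bsub>A\<^esub> x" "b = m +>\<^bsub>A\<^esub> y"
        by (auto simp: carrQ)
      have "a \<otimes>\<^bsub>A Quot m\<^esub> b = m +>\<^bsub>A\<^esub> (x \<otimes>\<^bsub>A\<^esub> y)"
        using xy by (simp add: FactRing_def m.rcoset_mult_add)
      then show "(a \<otimes>\<^bsub>A Quot m\<^esub> b) \<odot>\<^bsub>?S\<^esub> v = a \<odot>\<^bsub>?S\<^esub> (b \<odot>\<^bsub>?S\<^esub> v)"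
        using xy v by (simp add: S sm cl) (simp add: ann m_assoc)
    qed
    show "\<forall>v\<in>carrier ?S. \<one>\<^bsub>A Quot m\<^esub> \<odot>\<^bsub>?S\<^esub> v = v"
      by (auto simp: S FactRing_def sm ann)
    show "\<forall>a b v. a \<in> carrier (A Quot m) \<and> b \<in> carrier (A Quot m) \<and> v \<in> carrier ?S \<longrightarrow>
        (a \<oplus>\<^bsub>A Quot m\<^esub> b) \<odot>\<^bsub>?S\<^esub> v = a \<odot>\<^bsub>?S\<^esub> v \<oplus>\<^bsub>?S\<^esub> b \<odot>\<^bsub>?S\<^esub> v"
    proof (intro allI impI, elim conjE)
      fix a b v assume "a \<in> carrier (A Quot m)" "b \<in> carrier (A Quot m)" and v: "v \<in> carrier ?S"
      then obtain x y where xy: "x \<in> carrier A" "y \<in> carrier A" "a = m +>\<^bsub>A\<^esub> x" "b = m +>\<^bsub>A\<^esub> y"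
        by (auto simp: carrQ)
      have "a \<oplus>\<^bsub>A Quot m\<^esub> b = m +>\<^bsub>A\<^esub> (x \<oplus>\<^bsub>A\<^esub> y)"
        using xy by (simp add: FactRing_def m.a_rcos_sum)
      then show "(a \<oplus>\<^bsub>A Quot m\<^esub> b) \<odot>\<^bsub>?S\<^esub> v = a \<odot>\<^bsub>?S\<^esub> v \<oplus>\<^bsub>?S\<^esub> b \<odot>\<^bsub>?S\<^esub> v"
        using xy v by (simp add: S sm cl) (simp add: ann l_distr)
    qed
    show "\<forall>a v w. a \<in> carrier (A Quot m) \<and> v \<in> carrier ?S \<and> w \<in> carrier ?S \<longrightarrow>
        a \<odot>\<^bsub>?S\<^esub> (v \<oplus>\<^bsub>?S\<^esub> w) = a \<odot>\<^bsub>?S\<^esub> v \<oplus>\<^bsub>?S\<^esub> a \<odot>\<^bsub>?S\<^esub> w"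
      by (auto simp: carrQ S sm cl cl2) (simp add: ann r_distr)
  qed
  then show ?thesis by (intro vectorspace.intro Q.field_axioms)
qed

text \<open>Scalars of the residue field are classes of elements of A, so the residue field can be
  eliminated: the socle is a non-zero cyclic A-module.\<close>

lemma socle_space_dim_eq_1_iff:
  assumes A: "cring A" and m: "maximalideal m A"
  shows "vectorspace.fin_dim (A Quot m) (socle_space A m) \<and>
      vectorspace.dim (A Quot m) (socle_space A m) = 1 \<longleftrightarrow>
    (\<exists>s\<in>annihilator A m. s \<noteq> \<zero>\<^bsub>A\<^esub> \<and> (\<forall>t\<in>annihilator A m. \<exists>x\<in>carrier A. t = x \<otimes>\<^bsub>A\<^esub> s))"
proof -
  interpret m: maximalideal m A by fact
  have carrQ: "carrier (A Quot m) = (\<lambda>x. m +>\<^bsub>A\<^esub> x) ` carrier A"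
    by (auto simp: FactRing_def A_RCOSETS_def')
  have S: "carrier (socle_space A m) = annihilator A m" "\<zero>\<^bsub>socle_space A m\<^esub> = \<zero>\<^bsub>A\<^esub>"
    by (simp_all add: socle_space_def)
  show ?thesis
    unfolding vectorspace.fin_dim_dim_eq_1_iff[OF vectorspace_socle_space[OF assms]] carrQ S
    by (intro bex_cong conj_cong ball_cong refl)
      (simp add: socle_space_smult[OF A m.is_ideal])
qed

section \<open>Ideals of a commutative ring given as a type\<close>

definition is_ideal :: "'a::comm_ring_1 set \<Rightarrow> bool" where
  "is_ideal J \<longleftrightarrow> 0 \<in> J \<and> (\<forall>a\<in>J. \<forall>b\<in>J. a + b \<in> J) \<and> (\<forall>a\<in>J. \<forall>r. r * a \<in> J)"

definition is_prime_ideal :: "'a::comm_ring_1 set \<Rightarrow> bool" where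
  "is_prime_ideal p \<longleftrightarrow> is_ideal p \<and> 1 \<notin> p \<and> (\<forall>a b. a * b \<in> p \<longrightarrow> a \<in> p \<or> b \<in> p)"

text \<open>Says that the residue ring is a field. Maximality among the proper ideals is derived in
  \<open>is_max_ideal_unique\<close>.\<close>

definition is_max_ideal :: "'a::comm_ring_1 set \<Rightarrow> bool" where
  "is_max_ideal M \<longleftrightarrow> is_ideal M \<and> 1 \<notin> M \<and> (\<forall>a. a \<notin> M \<longrightarrow> (\<exists>y. 1 - y * a \<in> M))"

context
  fixes J :: "'a::comm_ring_1 set"
  assumes J: "is_ideal J"
begin

lemma is_ideal_0: "0 \<in> J"
  and is_ideal_add: "a \<in> J \<Longrightarrow> b \<in> J \<Longrightarrow> a + b \<in> J"
  and is_ideal_mult_left: "a \<in> J \<Longrightarrow> r * a \<in> J"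
  using J by (auto simp: is_ideal_def)

lemma is_ideal_mult_right: "a \<in> J \<Longrightarrow> a * r \<in> J"
  using is_ideal_mult_left[of a r] by (simp add: mult.commute)

lemma is_ideal_uminus: "a \<in> J \<Longrightarrow> - a \<in> J"
  using is_ideal_mult_left[of a "- 1"] by simp

lemma is_ideal_diff: "a \<in> J \<Longrightarrow> b \<in> J \<Longrightarrow> a - b \<in> J"
  using is_ideal_add[of a "- b"] is_ideal_uminus[of b] by simp

lemma is_ideal_eq_UNIV: "1 \<in> J \<Longrightarrow> J = UNIV"
  using is_ideal_mult_left[of 1] by auto

lemma is_ideal_cong: "a - b \<in> J \<Longrightarrow> a \<in> J \<longleftrightarrow> b \<in> J"
  using is_ideal_add[of "a - b" b] is_ideal_diff[of a "a - b"] by auto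

lemma is_ideal_sum: "(\<And>x. x \<in> S \<Longrightarrow> f x \<in> J) \<Longrightarrow> sum f S \<in> J"
  by (induction S rule: infinite_finite_induct) (auto simp: is_ideal_0 is_ideal_add)

end

lemma is_max_ideal_imp_prime:
  assumes "is_max_ideal M" shows "is_prime_ideal M"
proof -
  have M: "is_ideal M" and max: "\<And>a. a \<notin> M \<Longrightarrow> \<exists>y. 1 - y * a \<in> M" and 1: "1 \<notin> M"
    using assms by (auto simp: is_max_ideal_def)
  have "b \<in> M" if ab: "a * b \<in> M" and a: "a \<notin> M" for a b
  proof -
    obtain y where y: "1 - y * a \<in> M" using max[OF a] by blast
    have "(1 - y * a) * b + y * (a * b) \<in> M"
      using is_ideal_add[OF M] is_ideal_mult_right[OF M y] is_ideal_mult_left[OF M ab] by blast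
    then show "b \<in> M" by (simp add: algebra_simps)
  qed
  then show ?thesis unfolding is_prime_ideal_def using M 1 by blast
qed

lemma is_max_ideal_unique:
  assumes "is_max_ideal M" "is_ideal J" "1 \<notin> J" "M \<subseteq> J"
  shows "J = M"
proof (rule ccontr)
  assume "J \<noteq> M"
  then obtain a where a: "a \<in> J" "a \<notin> M" using assms by blast
  then obtain y where "1 - y * a \<in> M" using assms by (auto simp: is_max_ideal_def)
  then have "(1 - y * a) + y * a \<in> J"
    using is_ideal_add[OF assms(2)] is_ideal_mult_left[OF assms(2) a(1)] assms(4) by blast
  then show False using assms by simp
qed

lemma is_prime_ideal_power:
  assumes "is_prime_ideal p" "a ^ n \<in> p" shows "a \<in> p"
  using assms(2) by (induction n) (use assms(1) in \<open>auto simp: is_prime_ideal_def\<close>)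

lemma is_prime_ideal_prod:
  assumes "is_prime_ideal p" "finite S" "(\<Prod>x\<in>S. f x) \<in> p" shows "\<exists>x\<in>S. f x \<in> p"
  using assms(2,3) by (induction S rule: finite_induct) (use assms(1) in \<open>auto simp: is_prime_ideal_def\<close>)

text \<open>The source is a ring given as a type, the target a record. The ring
  \<open>\<P> Quot I\<close>, its local quotients and the associated graded ring are all targets of
  the polynomial ring, so their ideals can be studied as polynomial ideals containing the
  kernel.\<close>

locale surjective_ring_hom =
  fixes h :: "'a::comm_ring_1 \<Rightarrow> 'b" and A :: "('b, 'c) ring_scheme"
  assumes carrier_eq: "carrier A = range h"
    and hom_add: "h (x + y) = h x \<oplus>\<^bsub>A\<^esub> h y"
    and hom_mult: "h (x * y) = h x \<otimes>\<^bsub>A\<^esub> h y"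
    and hom_zero: "h 0 = \<zero>\<^bsub>A\<^esub>"
    and hom_one: "h 1 = \<one>\<^bsub>A\<^esub>"
begin

lemma cring_target: "cring A"
proof (rule cringI)
  show "abelian_group A"
  proof (rule abelian_groupI)
    show "\<exists>y\<in>carrier A. y \<oplus>\<^bsub>A\<^esub> x = \<zero>\<^bsub>A\<^esub>" if x: "x \<in> carrier A" for x
    proof -
      obtain a where "x = h a" using x by (auto simp: carrier_eq)
      then have "h (- a) \<oplus>\<^bsub>A\<^esub> x = \<zero>\<^bsub>A\<^esub>" by (simp add: hom_add[symmetric] hom_zero)
      then show ?thesis by (auto simp: carrier_eq)
    qed
  qed (auto simp: carrier_eq hom_add[symmetric] hom_zero[symmetric] ac_simps)
  show "Group.comm_monoid A"
    by (rule comm_monoidI) 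
      (auto simp: carrier_eq hom_mult[symmetric] hom_one[symmetric] ac_simps)
qed (auto simp: carrier_eq hom_mult[symmetric] hom_add[symmetric] algebra_simps)

definition ker :: "'a set" where "ker = {x. h x = \<zero>\<^bsub>A\<^esub>}"

lemma hom_uminus: "h (- x) = \<ominus>\<^bsub>A\<^esub> h x"
proof -
  interpret cring A by (rule cring_target)
  show ?thesis
    by (rule minus_equality[symmetric]) (auto simp: carrier_eq hom_add[symmetric] hom_zero)
qed

lemma hom_eq_iff: "h x = h y \<longleftrightarrow> x - y \<in> ker"
proof -
  interpret cring A by (rule cring_target)
  have "h (x - y) = h x \<ominus>\<^bsub>A\<^esub> h y"
    using hom_add[of x "- y"] by (simp add: hom_uminus a_minus_def)
  then show ?thesis by (auto simp: ker_def carrier_eq r_right_minus_eq)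
qed

lemma is_ideal_ker: "is_ideal ker"
proof -
  interpret cring A by (rule cring_target)
  show ?thesis
    by (auto simp: is_ideal_def ker_def hom_add hom_mult hom_zero carrier_eq intro: r_null l_zero)
qed

lemma is_ideal_vimage:
  assumes "ideal m A"
  shows "is_ideal (h -` m)" "ker \<subseteq> h -` m" "h ` (h -` m) = m"
proof -
  interpret ideal m A by fact
  show "is_ideal (h -` m)"
    by (auto simp: is_ideal_def hom_add hom_mult hom_zero carrier_eq I_l_closed)
  show "ker \<subseteq> h -` m" by (auto simp: ker_def)
  show "h ` (h -` m) = m" using a_subset by (auto simp: carrier_eq)
qed

lemma image_mem_iff:
  assumes "is_ideal J" "ker \<subseteq> J"
  shows "h x \<in> h ` J \<longleftrightarrow> x \<in> J"
proof
  assume "h x \<in> h ` J"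
  then show "x \<in> J" using assms is_ideal_cong[OF assms(1), of x] by (auto simp: hom_eq_iff)
qed simp

lemma ideal_image:
  assumes J: "is_ideal J"
  shows "ideal (h ` J) A"
proof (rule idealI)
  show "ring A" using cring_target by (rule cring.axioms)
  interpret cring A by (rule cring_target)
  show "subgroup (h ` J) (add_monoid A)"
  proof (rule add.subgroupI)
    show "h ` J \<subseteq> carrier A" by (auto simp: carrier_eq)
    show "h ` J \<noteq> {}" using is_ideal_0[OF J] by auto
  qed (auto simp: hom_add[symmetric] hom_uminus[symmetric] a_inv_def[symmetric] is_ideal_add[OF J] is_ideal_uminus[OF J])
qed (auto simp: carrier_eq hom_mult[symmetric] is_ideal_mult_left[OF J] is_ideal_mult_right[OF J])

lemma is_prime_ideal_vimage:
  assumes "primeideal p A"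
  shows "is_prime_ideal (h -` p)"
proof -
  interpret primeideal p A by fact
  have "h 1 \<notin> p" using I_notcarr one_imp_carrier by (auto simp: hom_one)
  then show ?thesis
    using is_ideal_vimage(1)[OF is_ideal] I_prime
    by (auto simp: is_prime_ideal_def hom_mult carrier_eq)
qed

lemma maximalideal_image:
  assumes M: "is_max_ideal M" "ker \<subseteq> M"
  shows "maximalideal (h ` M) A"
proof (rule maximalidealI)
  have iM: "is_ideal M" using M by (simp add: is_max_ideal_def)
  show "ideal (h ` M) A" by (rule ideal_image[OF iM])
  show "carrier A \<noteq> h ` M"
    using image_mem_iff[OF iM M(2), of 1] M(1) by (auto simp: carrier_eq is_max_ideal_def)
  fix J assume J: "ideal J A" "h ` M \<subseteq> J" "J \<subseteq> carrier A"
  note v = is_ideal_vimage[OF J(1)]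
  have sub: "M \<subseteq> h -` J" using J by auto
  show "J = h ` M \<or> J = carrier A"
  proof (cases "1 \<in> h -` J")
    case True
    then show ?thesis using is_ideal_eq_UNIV[OF v(1)] v(3) by (auto simp: carrier_eq)
  next
    case False
    then show ?thesis using is_max_ideal_unique[OF M(1) v(1) _ sub] v(3) by auto
  qed
qed

lemma gorenstein_local_ring_iff:
  assumes M: "is_max_ideal M" "ker \<subseteq> M"
    and uniq: "\<And>p. is_prime_ideal p \<Longrightarrow> ker \<subseteq> p \<Longrightarrow> p = M"
  shows "gorenstein_local_ring A \<longleftrightarrow>
    (\<exists>s. s \<notin> ker \<and> (\<forall>m\<in>M. s * m \<in> ker) \<and>
      (\<forall>t. (\<forall>m\<in>M. t * m \<in> ker) \<longrightarrow> (\<exists>x. t - x * s \<in> ker)))"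
proof -
  interpret cring A by (rule cring_target)
  have max: "maximalideal (h ` M) A" by (rule maximalideal_image[OF M])
  have prime: "p = h ` M" if "primeideal p A" for p
  proof -
    have "ideal p A" using that by (rule primeideal.axioms)
    then show ?thesis using uniq[OF is_prime_ideal_vimage[OF that]] is_ideal_vimage(2,3) by metis
  qed
  have maxp: "primeideal p A" if "maximalideal p A" for p
    using that by (rule maximalideal_prime)
  have "krull_dim_zero A" unfolding krull_dim_zero_def using prime maxp max by blast
  moreover have "local_ring_with A m \<longleftrightarrow> m = h ` M" for m
    unfolding local_ring_with_def using cring_target prime maxp max by blast
  moreover have ann: "h s \<in> annihilator A (h ` M) \<longleftrightarrow> (\<forall>m\<in>M. s * m \<in> ker)" for s
    by (auto simp: annihilator_def carrier_eq hom_mult[symmetric] ker_def)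
  let ?S = "annihilator A (h ` M)"
  have S: "?S \<subseteq> range h" by (auto simp: annihilator_def carrier_eq)
  have ex: "(\<exists>s\<in>?S. P s) \<longleftrightarrow> (\<exists>s. h s \<in> ?S \<and> P (h s))" for P using S by blast
  have all: "(\<forall>t\<in>?S. P t) \<longleftrightarrow> (\<forall>t. h t \<in> ?S \<longrightarrow> P (h t))" for P using S by blast
  have exc: "(\<exists>x\<in>carrier A. P x) \<longleftrightarrow> (\<exists>x. P (h x))" for P by (auto simp: carrier_eq)
  have "(\<exists>s\<in>?S. s \<noteq> \<zero>\<^bsub>A\<^esub> \<and> (\<forall>t\<in>?S. \<exists>x\<in>carrier A. t = x \<otimes>\<^bsub>A\<^esub> s)) \<longleftrightarrow>
    (\<exists>s. s \<notin> ker \<and> (\<forall>m\<in>M. s * m \<in> ker) \<and>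
      (\<forall>t. (\<forall>m\<in>M. t * m \<in> ker) \<longrightarrow> (\<exists>x. t - x * s \<in> ker)))"
    unfolding ex all exc ann hom_mult[symmetric] hom_eq_iff by (auto simp: ker_def)
  ultimately show ?thesis
    unfolding gorenstein_local_ring_def
    by (simp add: socle_space_dim_eq_1_iff[OF cring_target max, unfolded One_nat_def])
qed

end

section \<open>Rings given as types, viewed as records, and their quotients\<close>

lemma type_algebra_simps [simp]:
  "carrier ring_of_type_algebra = UNIV"
  "x \<otimes>\<^bsub>ring_of_type_algebra\<^esub> y = x * y"
  "x \<oplus>\<^bsub>ring_of_type_algebra\<^esub> y = x + y"
  "\<one>\<^bsub>ring_of_type_algebra\<^esub> = 1"
  "\<zero>\<^bsub>ring_of_type_algebra\<^esub> = 0"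
  by (simp_all add: ring_of_type_algebra_def)

lemma type_algebra_nat_pow [simp]:
  "x [^]\<^bsub>ring_of_type_algebra\<^esub> (n::nat) = (x :: 'a::comm_ring_1) ^ n"
proof -
  interpret cring "ring_of_type_algebra :: 'a ring" by (rule cring_from_type_algebra)
  show ?thesis by (induction n) (simp_all add: mult.commute)
qed

lemma surjective_ring_hom_id: "surjective_ring_hom (\<lambda>x::'a::comm_ring_1. x) ring_of_type_algebra"
  by unfold_locales simp_all

text \<open>The identity is a surjection onto the record, so both directions are instances of the
  transfer of ideals.\<close>

lemma ideal_type_algebra_iff:
  "ideal J (ring_of_type_algebra :: 'a::comm_ring_1 ring) \<longleftrightarrow> is_ideal J"
proof -
  interpret surjective_ring_hom "\<lambda>x::'a. x" "ring_of_type_algebra :: 'a ring"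
    by (rule surjective_ring_hom_id)
  show ?thesis using is_ideal_vimage(1)[of J] ideal_image[of J] by (auto simp: vimage_def)
qed

lemma surjective_ring_hom_coset:
  fixes J :: "'a::comm_ring_1 set"
  assumes "is_ideal J"
  shows "surjective_ring_hom (\<lambda>x. J +>\<^bsub>ring_of_type_algebra\<^esub> x) (ring_of_type_algebra Quot J)"
    and "surjective_ring_hom.ker (\<lambda>x. J +>\<^bsub>ring_of_type_algebra\<^esub> x) (ring_of_type_algebra Quot J) = J"
proof -
  let ?R = "ring_of_type_algebra :: 'a ring"
  interpret ideal J ?R using assms by (simp add: ideal_type_algebra_iff)
  show s: "surjective_ring_hom (\<lambda>x. J +>\<^bsub>?R\<^esub> x) (?R Quot J)"
  proof
    show "carrier (?R Quot J) = range (\<lambda>x. J +>\<^bsub>?R\<^esub> x)"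
      by (auto simp: FactRing_def A_RCOSETS_def')
    show "J +>\<^bsub>?R\<^esub> (x + y) = (J +>\<^bsub>?R\<^esub> x) \<oplus>\<^bsub>?R Quot J\<^esub> (J +>\<^bsub>?R\<^esub> y)" for x y
      using ring_hom_add[OF rcos_ring_hom, of x y] by simp
    show "J +>\<^bsub>?R\<^esub> (x * y) = (J +>\<^bsub>?R\<^esub> x) \<otimes>\<^bsub>?R Quot J\<^esub> (J +>\<^bsub>?R\<^esub> y)" for x y
      using ring_hom_mult[OF rcos_ring_hom, of x y] by simp
    show "J +>\<^bsub>?R\<^esub> 0 = \<zero>\<^bsub>?R Quot J\<^esub>"
      by (simp add: FactRing_def a_r_coset_def')
    show "J +>\<^bsub>?R\<^esub> 1 = \<one>\<^bsub>?R Quot J\<^esub>"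
      using ring_hom_one[OF rcos_ring_hom] by simp
  qed
  have "J +>\<^bsub>?R\<^esub> x = J \<longleftrightarrow> x \<in> J" for x
    using a_coset_join1[of J x] a_coset_join2[of x J] a_subgroup by auto
  then show "surjective_ring_hom.ker (\<lambda>x. J +>\<^bsub>?R\<^esub> x) (?R Quot J) = J"
    unfolding surjective_ring_hom.ker_def[OF s] by (simp add: FactRing_def)
qed

text \<open>A quotient of the target is again a target of the same source; this presents the local
  rings of R directly as quotients of P.\<close>

lemma (in surjective_ring_hom) surjective_ring_hom_quotient:
  assumes J: "is_ideal J" "ker \<subseteq> J"
  shows "surjective_ring_hom (\<lambda>x. (h ` J) +>\<^bsub>A\<^esub> h x) (A Quot (h ` J))"
    and "surjective_ring_hom.ker (\<lambda>x. (h ` J) +>\<^bsub>A\<^esub> h x) (A Quot (h ` J)) = J"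
proof -
  interpret A: cring A by (rule cring_target)
  interpret I: ideal "h ` J" A by (rule ideal_image[OF J(1)])
  show s: "surjective_ring_hom (\<lambda>x. (h ` J) +>\<^bsub>A\<^esub> h x) (A Quot (h ` J))"
  proof
    show "carrier (A Quot (h ` J)) = range (\<lambda>x. (h ` J) +>\<^bsub>A\<^esub> h x)"
      by (auto simp: FactRing_def A_RCOSETS_def' carrier_eq)
    show "(h ` J) +>\<^bsub>A\<^esub> h (x + y) = ((h ` J) +>\<^bsub>A\<^esub> h x) \<oplus>\<^bsub>A Quot (h ` J)\<^esub> ((h ` J) +>\<^bsub>A\<^esub> h y)" for x y
      using ring_hom_add[OF I.rcos_ring_hom, of "h x" "h y"] by (simp add: carrier_eq hom_add)
    show "(h ` J) +>\<^bsub>A\<^esub> h (x * y) = ((h ` J) +>\<^bsub>A\<^esub> h x) \<otimes>\<^bsub>A Quot (h ` J)\<^esub> ((h ` J) +>\<^bsub>A\<^esub> h y)" for x y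
      using ring_hom_mult[OF I.rcos_ring_hom, of "h x" "h y"] by (simp add: carrier_eq hom_mult)
    show "(h ` J) +>\<^bsub>A\<^esub> h 0 = \<zero>\<^bsub>A Quot (h ` J)\<^esub>"
      using I.a_subset by (simp add: FactRing_def hom_zero A.a_coset_add_zero)
    show "(h ` J) +>\<^bsub>A\<^esub> h 1 = \<one>\<^bsub>A Quot (h ` J)\<^esub>"
      using ring_hom_one[OF I.rcos_ring_hom] by (simp add: hom_one)
  qed
  have "(h ` J) +>\<^bsub>A\<^esub> h x = h ` J \<longleftrightarrow> x \<in> J" for x
    using A.a_coset_join1[of "h ` J" "h x"] A.a_coset_join2[of "h x" "h ` J"] I.a_subgroup
      image_mem_iff[OF J, of x] by (auto simp: carrier_eq)
  then show "surjective_ring_hom.ker (\<lambda>x. (h ` J) +>\<^bsub>A\<^esub> h x) (A Quot (h ` J)) = J"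
    unfolding surjective_ring_hom.ker_def[OF s] by (simp add: FactRing_def)
qed

text \<open>A bridge between dimensions in the record world and \<open>rel_dim\<close>: the record W
  is V/U, with q as the residue class map.\<close>

locale quotient_space = relative_dimension scale
  for scale :: "'a::field \<Rightarrow> 'b::ab_group_add \<Rightarrow> 'b" +
  fixes q :: "'b \<Rightarrow> 'c" and W :: "('a, 'c, 'd) module_scheme" and U V :: "'b set"
  assumes subspace_U: "subspace U" and subspace_V: "subspace V" and U_subset_V: "U \<subseteq> V"
    and carrier_eq: "carrier W = q ` V"
    and q_add: "q (x + y) = q x \<oplus>\<^bsub>W\<^esub> q y"
    and q_scale: "q (scale c x) = c \<odot>\<^bsub>W\<^esub> q x"
    and q_zero: "q 0 = \<zero>\<^bsub>W\<^esub>"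
    and q_eq_iff: "q x = q y \<longleftrightarrow> x - y \<in> U"
begin

lemma vectorspace_W: "vectorspace ring_of_type_algebra W"
proof -
  interpret K: field "ring_of_type_algebra :: 'a ring" by (rule field_from_type_algebra)
  note V = subspace_add[OF subspace_V] subspace_0[OF subspace_V] subspace_scale[OF subspace_V]
    subspace_neg[OF subspace_V]
  have "module ring_of_type_algebra W"
  proof (rule module_criteria)
    show "cring (ring_of_type_algebra :: 'a ring)" by (rule cring_from_type_algebra)
    show "\<forall>v\<in>carrier W. \<exists>neg_v\<in>carrier W. v \<oplus>\<^bsub>W\<^esub> neg_v = \<zero>\<^bsub>W\<^esub>"
    proof
      fix v assume "v \<in> carrier W"
      then obtain x where x: "x \<in> V" "v = q x" by (auto simp: carrier_eq)
      then have "v \<oplus>\<^bsub>W\<^esub> q (- x) = \<zero>\<^bsub>W\<^esub>" by (simp add: q_add[symmetric] q_zero)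
      then show "\<exists>neg_v\<in>carrier W. v \<oplus>\<^bsub>W\<^esub> neg_v = \<zero>\<^bsub>W\<^esub>" using x V by (auto simp: carrier_eq)
    qed
  qed (auto simp: carrier_eq q_add[symmetric] q_scale[symmetric] q_zero[symmetric] V ac_simps
        scale_left_distrib scale_right_distrib)
  then show ?thesis by (intro vectorspace.intro K.field_axioms)
qed

sublocale W: vectorspace "ring_of_type_algebra" W by (rule vectorspace_W)

lemma lincomb_image:
  assumes "finite B" "B \<subseteq> V" "inj_on q B"
  shows "W.lincomb a (q ` B) = q (\<Sum>b\<in>B. scale (a (q b)) b)"
  using assms
proof (induction B rule: finite_induct)
  case empty
  then show ?case by (simp add: W.lincomb_def q_zero)
next
  case (insert b B)
  have sub: "q ` B \<subseteq> carrier W" "q b \<in> carrier W" using insert by (auto simp: carrier_eq)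
  have "W.lincomb a (insert (q b) (q ` B)) = a (q b) \<odot>\<^bsub>W\<^esub> q b \<oplus>\<^bsub>W\<^esub> W.lincomb a (q ` B)"
    unfolding W.lincomb_def using insert sub by (intro W.finsum_insert) auto
  then show ?case using insert by (simp add: q_add q_scale)
qed

lemma dim_eq_rel_dim:
  assumes "fin_codim U"
  shows "W.dim = rel_dim U V"
proof -
  obtain B where B: "finite B" "B \<subseteq> V" "V \<subseteq> span (B \<union> U)" "rel_indep U B" "card B = rel_dim U V"
    using rel_basis_exists[OF assms subspace_V U_subset_V] by blast
  obtain p where p: "proj_mod U p" using proj_mod_exists[OF subspace_U] by blast
  then interpret p: Vector_Spaces.linear scale scale p unfolding proj_mod_def by simp
  have p0: "p x = 0 \<longleftrightarrow> x \<in> U" for x using p unfolding proj_mod_def by simp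
  have inj: "inj_on q B"
    using rel_indep_proj_mod(1)[OF p B(1,4)] p0 by (auto simp: inj_on_def q_eq_iff p.diff simp flip: p0)
  have sub: "q ` B \<subseteq> carrier W" using B by (auto simp: carrier_eq)
  have "W.lin_indpt (q ` B)"
  proof (rule W.finite_lin_indpt2)
    fix a assume "W.lincomb a (q ` B) = \<zero>\<^bsub>W\<^esub>"
    then have "(\<Sum>b\<in>B. scale (a (q b)) b) \<in> U"
      using lincomb_image[OF B(1,2) inj] q_eq_iff[of _ 0] by (simp add: q_zero)
    then have "\<forall>b\<in>B. a (q b) = 0"
      using B(4) unfolding rel_indep_def by (elim allE[of _ "\<lambda>b. a (q b)"]) blast
    then show "\<forall>v\<in>q ` B. a v = \<zero>\<^bsub>ring_of_type_algebra\<^esub>" by simp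
  qed (use B sub in auto)
  moreover have "W.gen_set (q ` B)"
  proof
    show "W.span (q ` B) \<subseteq> carrier W" using sub by (rule W.span_is_subset2)
    show "carrier W \<subseteq> W.span (q ` B)"
    proof
      fix w assume "w \<in> carrier W"
      then obtain x where x: "x \<in> V" "w = q x" by (auto simp: carrier_eq)
      then obtain y u where yu: "x = y + u" "y \<in> span B" "u \<in> span U"
        using B(3) unfolding span_Un by blast
      have u: "u \<in> U" using yu(3) span_eq_iff subspace_U by blast
      obtain c where c: "y = (\<Sum>b\<in>B. scale (c b) b)"
        using yu(2) B(1) by (auto simp: span_finite)
      have "w = q y" using u yu x by (simp add: q_eq_iff)
      also have "\<dots> = W.lincomb (\<lambda>v. c (the_inv_into B q v)) (q ` B)"
        unfolding c by (subst lincomb_image[OF B(1,2) inj]) (simp add: the_inv_into_f_f[OF inj])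
      also have "\<dots> \<in> W.span (q ` B)" using B(1) sub by (auto simp: W.finite_span)
      finally show "w \<in> W.span (q ` B)" .
    qed
  qed
  ultimately have "W.basis (q ` B)" using sub by (simp add: W.basis_def)
  then show ?thesis using W.dim_basis[of "q ` B"] B inj by (simp add: card_image)
qed

lemma fin_dim_imp_fin_codim:
  assumes "W.fin_dim" "V = UNIV"
  shows "fin_codim U"
proof -
  obtain A where A: "finite A" "A \<subseteq> carrier W" "W.gen_set A"
    using assms(1) unfolding W.fin_dim_def by blast
  \<comment> \<open>One representative for each generator, so that q is injective on S and
    \<open>lincomb_image\<close> applies.\<close>
  then obtain S where S: "S \<subseteq> V" "A = q ` S" "inj_on q S" using carrier_eq subset_image_inj by metis
  have fS: "finite S" using A(1) S finite_image_iff by blast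
  have "x \<in> span (S \<union> U)" for x
  proof -
    have "q x \<in> W.span A" using A(3) carrier_eq assms(2) by auto
    then obtain a where "q x = W.lincomb a A" using W.finite_span[OF A(1,2)] by auto
    then have "q x = q (\<Sum>b\<in>S. scale (a (q b)) b)" using lincomb_image[OF fS S(1,3)] S(2) by simp
    then have "x - (\<Sum>b\<in>S. scale (a (q b)) b) \<in> span (S \<union> U)" by (auto simp: q_eq_iff intro: span_base)
    moreover have "(\<Sum>b\<in>S. scale (a (q b)) b) \<in> span (S \<union> U)"
      by (intro span_sum span_scale span_base) auto
    ultimately have "(x - (\<Sum>b\<in>S. scale (a (q b)) b)) + (\<Sum>b\<in>S. scale (a (q b)) b) \<in> span (S \<union> U)"
      by (rule span_add)
    then show "x \<in> span (S \<union> U)" by simp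
  qed
  then have "span (S \<union> U) = UNIV" by blast
  then show ?thesis unfolding fin_codim_def using subspace_U fS by blast
qed

end

section \<open>Polynomials and their homogeneous components\<close>

lemma const_poly_simps:
  "const_poly 0 = 0" "const_poly 1 = 1"
  "const_poly (a + b) = const_poly a + const_poly b"
  "const_poly (a * b) = const_poly a * const_poly b"
  by (simp_all add: const_poly_def single_add mult_single)

lemma lookup_const_poly_mult [simp]:
  "Poly_Mapping.lookup (const_poly c * f) t = c * Poly_Mapping.lookup f t"
proof -
  have "Poly_Mapping.map ((*) c) f = const_poly c * f"
    unfolding const_poly_def by (rule mult_map_scale_conv_mult)
  then have "Poly_Mapping.lookup (const_poly c * f) t = Poly_Mapping.lookup (Poly_Mapping.map ((*) c) f) t" by simp
  also have "\<dots> = c * Poly_Mapping.lookup f t" by (simp add: map.rep_eq when_def)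
  finally show ?thesis .
qed

interpretation mvp: relative_dimension
  "\<lambda>(c::'k::field) (f::('n::finite, 'k) mvpoly). const_poly c * f"
  by unfold_locales (simp_all add: const_poly_simps algebra_simps)

lemma is_ideal_imp_subspace: "is_ideal J \<Longrightarrow> mvp.subspace J"
  by (auto simp: mvp.subspace_def is_ideal_def)

lemma quotient_space_K_space:
  fixes I V :: "('n::finite, 'k::field) mvpoly set"
  assumes I: "is_ideal I" and V: "mvp.subspace V" "I \<subseteq> V"
  shows "quotient_space (\<lambda>c f. const_poly c * f) (\<lambda>f. I +>\<^bsub>\<P>\<^esub> f) (K_space I (img_quot I V)) I V"
proof -
  interpret h: surjective_ring_hom "\<lambda>f. I +>\<^bsub>\<P>\<^esub> f" "\<P> Quot I"
    by (rule surjective_ring_hom_coset(1)[OF I])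
  note k = surjective_ring_hom_coset(2)[OF I]
  show ?thesis
  proof
    show "(I +>\<^bsub>\<P>\<^esub> x = I +>\<^bsub>\<P>\<^esub> y) = (x - y \<in> I)" for x y
      using h.hom_eq_iff[of x y] k by simp
  qed (use is_ideal_imp_subspace[OF I] V in
      \<open>auto simp: K_space_def img_quot_def h.hom_add h.hom_mult h.hom_zero[simplified]\<close>)
qed

lemma dim_K_img_quot:
  assumes "is_ideal I" "mvp.fin_codim I" "mvp.subspace V" "I \<subseteq> V"
  shows "dim_K I (img_quot I V) = mvp.rel_dim I V"
  unfolding dim_K_def
  using quotient_space.dim_eq_rel_dim[OF quotient_space_K_space[OF assms(1,3,4)] assms(2)] .

lemma carrier_Quot_eq: 
  fixes I :: "('n::finite, 'k::field) mvpoly set"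
  assumes "is_ideal I" shows "carrier (\<P> Quot I) = img_quot I UNIV"
  using surjective_ring_hom.carrier_eq[OF surjective_ring_hom_coset(1)[OF assms]]
  by (simp add: img_quot_def)

lemma zero_dim_ideal_iff:
  fixes I :: "('n::finite, 'k::field) mvpoly set"
  assumes "zero_dim_ideal I"
  shows "is_ideal I" "I \<noteq> UNIV" "mvp.fin_codim I"
proof -
  show I: "is_ideal I" and "I \<noteq> UNIV"
    using assms by (auto simp: zero_dim_ideal_def ideal_type_algebra_iff)
  have "vectorspace.fin_dim \<K> (K_space I (img_quot I UNIV))"
    using assms carrier_Quot_eq[OF I] by (simp add: zero_dim_ideal_def)
  then show "mvp.fin_codim I"
    using quotient_space.fin_dim_imp_fin_codim[OF quotient_space_K_space[OF I mvp.subspace_UNIV]] by simp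
qed

section \<open>Monomial degrees, the degree filtration and homogeneous components\<close>

lemma monom_deg_0 [simp]: "monom_deg 0 = 0"
  by (simp add: monom_deg_def)

lemma monom_deg_add: "monom_deg (s + t) = monom_deg s + monom_deg t"
  by (simp add: monom_deg_def lookup_add sum.distrib)

lemma monom_deg_eq_0_iff [simp]: "monom_deg t = 0 \<longleftrightarrow> t = 0"
  by (auto simp: monom_deg_def intro!: poly_mapping_eqI)

lemma mem_filt_P_iff: "f \<in> filt_P i \<longleftrightarrow> (\<forall>t\<in>Poly_Mapping.keys f. int (monom_deg t) \<le> i)"
proof (cases "f = 0")
  case False
  then have *: "finite (monom_deg ` Poly_Mapping.keys f)" "monom_deg ` Poly_Mapping.keys f \<noteq> {}" by simp_all
  have "monom_deg t \<le> poly_deg f" if "t \<in> Poly_Mapping.keys f" for t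
    unfolding poly_deg_def using Max_ge[OF *(1)] that by simp
  moreover obtain t where "t \<in> Poly_Mapping.keys f" "monom_deg t = poly_deg f"
    using Max_in[OF *] unfolding poly_deg_def by (metis imageE)
  ultimately have "int (poly_deg f) \<le> i \<longleftrightarrow> (\<forall>t\<in>Poly_Mapping.keys f. int (monom_deg t) \<le> i)"
    by (metis of_nat_le_iff order_trans)
  with False show ?thesis by (simp add: filt_P_def)
qed (simp add: filt_P_def)

lemma filt_P_lookup: "f \<in> filt_P i \<longleftrightarrow> (\<forall>t. i < int (monom_deg t) \<longrightarrow> Poly_Mapping.lookup f t = 0)"
  by (auto simp: mem_filt_P_iff in_keys_iff not_le[symmetric])

lemma filt_P_mono: "i \<le> j \<Longrightarrow> filt_P i \<subseteq> filt_P j"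
  by (auto simp: filt_P_lookup)

lemma filt_P_neg: "i < 0 \<Longrightarrow> filt_P i = {0}"
  by (auto simp: filt_P_lookup intro!: poly_mapping_eqI)

lemma filt_P_subspace: "mvp.subspace (filt_P i)"
  by (auto simp: mvp.subspace_def filt_P_lookup lookup_add)

lemma filt_P_mult:
  assumes "f \<in> filt_P i" "g \<in> filt_P j" shows "f * g \<in> filt_P (i + j)"
proof -
  have "int (monom_deg t) \<le> i + j" if t: "t \<in> Poly_Mapping.keys (f * g)" for t
  proof -
    obtain a b where "t = a + b" "a \<in> Poly_Mapping.keys f" "b \<in> Poly_Mapping.keys g"
      using t keys_mult[of f g] by blast
    then show ?thesis using assms by (force simp: mem_filt_P_iff monom_deg_add)
  qed
  then show ?thesis by (simp add: mem_filt_P_iff)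
qed

lemma filt_P_exhaust:
  assumes "finite S" shows "\<exists>i. S \<subseteq> filt_P i"
proof -
  let ?T = "\<Union>(Poly_Mapping.keys ` S)"
  have fin: "finite ((\<lambda>t. int (monom_deg t)) ` ?T)" using assms by simp
  have "S \<subseteq> filt_P (Max ((\<lambda>t. int (monom_deg t)) ` ?T))"
    unfolding mem_filt_P_iff subset_iff by (intro allI impI ballI Max_ge[OF fin] imageI) blast
  then show ?thesis ..
qed

text \<open>Degrees are integers to match the index of the filtration; components of negative degree
  are 0.\<close>

definition hcomp :: "int \<Rightarrow> ('n::finite, 'k::field) mvpoly \<Rightarrow> ('n, 'k) mvpoly" where
  "hcomp i f = (\<Sum>t\<in>{t \<in> Poly_Mapping.keys f. int (monom_deg t) = i}.
     Poly_Mapping.single t (Poly_Mapping.lookup f t))"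

lemma lookup_hcomp:
  "Poly_Mapping.lookup (hcomp i f) t = (if int (monom_deg t) = i then Poly_Mapping.lookup f t else 0)"
proof -
  let ?S = "{t \<in> Poly_Mapping.keys f. int (monom_deg t) = i}"
  have "Poly_Mapping.lookup (hcomp i f) t = (\<Sum>s\<in>?S. if s = t then Poly_Mapping.lookup f s else 0)"
    by (simp add: hcomp_def lookup_sum lookup_single when_def)
  also have "\<dots> = (if t \<in> ?S then Poly_Mapping.lookup f t else 0)"
    by (subst sum.delta) simp_all
  finally show ?thesis by (auto simp: in_keys_iff)
qed

lemma hcomp_simps [simp]:
  "hcomp i 0 = 0" "hcomp i (f + g) = hcomp i f + hcomp i g" "hcomp i (f - g) = hcomp i f - hcomp i g"
  "hcomp i (const_poly c * f) = const_poly c * hcomp i f"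
  "hcomp i (hcomp j f) = (if i = j then hcomp i f else 0)"
  by (auto intro!: poly_mapping_eqI simp: lookup_hcomp lookup_add lookup_minus)

lemma hcomp_sum: "hcomp i (sum f S) = (\<Sum>x\<in>S. hcomp i (f x))"
  by (induction S rule: infinite_finite_induct) auto

lemma hcomp_in_filt_P: "hcomp i f \<in> filt_P i"
  by (simp add: filt_P_lookup lookup_hcomp)

lemma hcomp_neg: "i < 0 \<Longrightarrow> hcomp i f = 0"
  by (auto intro!: poly_mapping_eqI simp: lookup_hcomp)

lemma diff_hcomp_in_filt_P: "f \<in> filt_P i \<Longrightarrow> f - hcomp i f \<in> filt_P (i - 1)"
  by (auto simp: filt_P_lookup lookup_hcomp lookup_minus)

lemma finite_hcomp: "finite {i. hcomp i f \<noteq> 0}"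
proof (rule finite_subset)
  show "{i. hcomp i f \<noteq> 0} \<subseteq> (\<lambda>t. int (monom_deg t)) ` Poly_Mapping.keys f"
  proof
    fix i assume "i \<in> {i. hcomp i f \<noteq> 0}"
    then obtain t where "Poly_Mapping.lookup (hcomp i f) t \<noteq> 0"
      by (auto simp: poly_mapping_eq_iff fun_eq_iff)
    then show "i \<in> (\<lambda>t. int (monom_deg t)) ` Poly_Mapping.keys f"
      by (auto simp: lookup_hcomp in_keys_iff split: if_splits)
  qed
qed simp

lemma sum_hcomp:
  assumes "finite S" "\<And>i. i \<notin> S \<Longrightarrow> hcomp i f = 0"
  shows "(\<Sum>i\<in>S. hcomp i f) = f"
proof (rule poly_mapping_eqI)
  fix t
  have "Poly_Mapping.lookup (\<Sum>i\<in>S. hcomp i f) t =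
      (\<Sum>i\<in>S. if i = int (monom_deg t) then Poly_Mapping.lookup f t else 0)"
    by (auto simp: lookup_sum lookup_hcomp intro!: sum.cong)
  also have "\<dots> = (if int (monom_deg t) \<in> S then Poly_Mapping.lookup f t else 0)"
    using assms(1) by simp
  also have "\<dots> = Poly_Mapping.lookup f t"
    using assms(2)[of "int (monom_deg t)"] lookup_hcomp[of "int (monom_deg t)" f t] by auto
  finally show "Poly_Mapping.lookup (\<Sum>i\<in>S. hcomp i f) t = Poly_Mapping.lookup f t" .
qed

text \<open>The equation \<open>hcomp i f = f\<close> expresses that f is homogeneous of degree i,
  with 0 included. Every monomial of a multiple f r has degree i plus the degree of a monomial of r,
  so only the part of g in degree k - i matters.\<close>

lemma hcomp_mult_homogeneous:
  assumes f: "hcomp i f = f"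
  shows "hcomp k (f * g) = f * hcomp (k - i) g"
proof -
  have key: "int (monom_deg t) \<in> (\<lambda>j. i + j) ` (\<lambda>b. int (monom_deg b)) ` Poly_Mapping.keys r"
    if t: "t \<in> Poly_Mapping.keys (f * r)" for t r
  proof -
    obtain a b where ab: "t = a + b" "a \<in> Poly_Mapping.keys f" "b \<in> Poly_Mapping.keys r"
      using t keys_mult[of f r] by blast
    have "int (monom_deg a) = i"
      using ab(2) lookup_hcomp[of i f a] f by (auto simp: in_keys_iff split: if_splits)
    then show ?thesis using ab by (auto simp: monom_deg_add)
  qed
  have 0: "hcomp k (f * r) = 0" if "hcomp (k - i) r = 0" for r
  proof (rule poly_mapping_eqI)
    fix t
    have "Poly_Mapping.lookup (f * r) t = 0" if t: "int (monom_deg t) = k"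
    proof (rule ccontr)
      assume "Poly_Mapping.lookup (f * r) t \<noteq> 0"
      then obtain b where b: "b \<in> Poly_Mapping.keys r" "int (monom_deg b) = k - i"
        using key[of t r] t by (auto simp: in_keys_iff)
      have "Poly_Mapping.lookup (hcomp (k - i) r) b \<noteq> 0"
        using b unfolding lookup_hcomp by (simp add: in_keys_iff)
      with \<open>hcomp (k - i) r = 0\<close> show False by simp
    qed
    then show "Poly_Mapping.lookup (hcomp k (f * r)) t = Poly_Mapping.lookup 0 t"
      by (simp add: lookup_hcomp)
  qed
  have 1: "hcomp k (f * hcomp (k - i) g) = f * hcomp (k - i) g"
  proof (rule poly_mapping_eqI)
    fix t
    have "int (monom_deg t) = k" if "Poly_Mapping.lookup (f * hcomp (k - i) g) t \<noteq> 0"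
    proof -
      obtain b where b: "b \<in> Poly_Mapping.keys (hcomp (k - i) g)" "int (monom_deg t) = i + int (monom_deg b)"
        using key[of t "hcomp (k - i) g"] \<open>_ \<noteq> 0\<close> by (auto simp: in_keys_iff)
      then show ?thesis by (auto simp: in_keys_iff lookup_hcomp split: if_splits)
    qed
    then show "Poly_Mapping.lookup (hcomp k (f * hcomp (k - i) g)) t =
        Poly_Mapping.lookup (f * hcomp (k - i) g) t"
      by (auto simp: lookup_hcomp)
  qed
  have "f * g = f * hcomp (k - i) g + f * (g - hcomp (k - i) g)" by (simp add: algebra_simps)
  then have "hcomp k (f * g) = hcomp k (f * hcomp (k - i) g) + hcomp k (f * (g - hcomp (k - i) g))"
    by (metis hcomp_simps(2))
  then show ?thesis using 1 0[of "g - hcomp (k - i) g"] by simp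
qed

lemma hcomp_mult:
  assumes "finite S" "\<And>i. i \<notin> S \<Longrightarrow> hcomp i f = 0"
  shows "hcomp k (f * g) = (\<Sum>i\<in>S. hcomp i f * hcomp (k - i) g)"
proof -
  have "hcomp k (f * g) = hcomp k (\<Sum>i\<in>S. hcomp i f * g)"
    using sum_hcomp[OF assms] by (simp add: sum_distrib_right[symmetric])
  also have "\<dots> = (\<Sum>i\<in>S. hcomp i f * hcomp (k - i) g)"
    unfolding hcomp_sum by (intro sum.cong refl hcomp_mult_homogeneous) simp
  finally show ?thesis .
qed

section \<open>Primary decomposition of zero-dimensional ideals\<close>

lemma is_ideal_prod_mem:
  assumes "is_ideal J" "finite T" "x \<in> T" "f x \<in> J"
  shows "(\<Prod>x\<in>T. f x) \<in> J"
  using prod.remove[OF assms(2,3), of f] is_ideal_mult_right[OF assms(1,4)] by simp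

text \<open>Take the product of one element outside M from each ideal. In other words, a prime that
  contains a finite intersection of ideals contains one of them.\<close>

lemma prime_avoidance:
  assumes M: "is_prime_ideal M" and T: "finite T" "\<And>S. S \<in> T \<Longrightarrow> is_ideal S" "\<And>S. S \<in> T \<Longrightarrow> \<not> S \<subseteq> M"
  shows "\<exists>h. h \<notin> M \<and> (\<forall>S\<in>T. h \<in> S)"
proof -
  have "\<forall>S\<in>T. \<exists>x. x \<in> S \<and> x \<notin> M" using T(3) by blast
  then obtain x where x: "\<forall>S\<in>T. x S \<in> S \<and> x S \<notin> M" by metis
  have "(\<Prod>S\<in>T. x S) \<notin> M" using is_prime_ideal_prod[OF M T(1)] x by blast
  moreover have "(\<Prod>S\<in>T. x S) \<in> S" if "S \<in> T" for S
    using is_ideal_prod_mem[OF T(2)[OF that] T(1) that] x that by blast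
  ultimately show ?thesis by blast
qed

lemma is_ideal_colon: "is_ideal J \<Longrightarrow> is_ideal {h. h * f \<in> J}"
  by (auto simp: is_ideal_def algebra_simps)

text \<open>The set is J + (f); all extensions of an ideal by one element are written in this
  form.\<close>

lemma is_ideal_plus_multiples:
  assumes "is_ideal J"
  shows "is_ideal {y. \<exists>r. y - r * f \<in> J}"
  unfolding is_ideal_def
proof (intro conjI ballI allI)
  show "0 \<in> {y. \<exists>r. y - r * f \<in> J}" using is_ideal_0[OF assms] by (auto intro!: exI[of _ 0])
  fix a assume "a \<in> {y. \<exists>r. y - r * f \<in> J}"
  then obtain r where r: "a - r * f \<in> J" by blast
  show "s * a \<in> {y. \<exists>r. y - r * f \<in> J}" for s
    using is_ideal_mult_left[OF assms r, of s] by (auto simp: algebra_simps intro!: exI[of _ "s * r"])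
  fix b assume "b \<in> {y. \<exists>r. y - r * f \<in> J}"
  then obtain s where "b - s * f \<in> J" by blast
  then show "a + b \<in> {y. \<exists>r. y - r * f \<in> J}"
    using is_ideal_add[OF assms r, of "b - s * f"] by (auto simp: algebra_simps intro!: exI[of _ "r + s"])
qed

lemma ideal_radical_type_algebra:
  "ideal_radical ring_of_type_algebra Q = {a::'a::comm_ring_1. \<exists>n. a ^ n \<in> Q}"
  by (simp add: ideal_radical_def)

lemma primary_ideal_type_algebra_iff:
  "primary_ideal Q (ring_of_type_algebra :: 'a::comm_ring_1 ring) \<longleftrightarrow>
    is_ideal Q \<and> 1 \<notin> Q \<and> (\<forall>a b. a * b \<in> Q \<longrightarrow> a \<in> Q \<or> (\<exists>n. b ^ n \<in> Q))"
  using cring_from_type_algebra[where 'a='a] is_ideal_eq_UNIV[of Q]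
  by (auto simp: primary_ideal_def ideal_type_algebra_iff)

locale zero_dim_algebra =
  fixes I :: "('n::finite, 'k::field) mvpoly set"
  assumes ideal_I: "is_ideal I" and one_notin_I: "1 \<notin> I" and fin_codim_I: "mvp.fin_codim I"
begin

lemma rel_dim_ideal_mono:
  "is_ideal J \<Longrightarrow> is_ideal J' \<Longrightarrow> I \<subseteq> J \<Longrightarrow> J \<subseteq> J' \<Longrightarrow> mvp.rel_dim I J \<le> mvp.rel_dim I J'"
  by (intro mvp.rel_dim_mono fin_codim_I is_ideal_imp_subspace)

lemma rel_dim_ideal_strict:
  assumes "is_ideal J" "is_ideal J'" "I \<subseteq> J" "J \<subset> J'"
  shows "mvp.rel_dim I J < mvp.rel_dim I J'"
proof (rule ccontr)
  assume "\<not> ?thesis"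
  then have "J = J'"
    using assms(4) by (intro mvp.rel_dim_eq_imp_eq[OF fin_codim_I is_ideal_imp_subspace[OF assms(1)] assms(3)
      is_ideal_imp_subspace[OF assms(2)]]) auto
  then show False using assms(4) by blast
qed

text \<open>The Artinian property, in the form needed for primary decomposition: the chain of the ideals
  \<open>(x\<^sup>n) + I\<close> becomes stationary.\<close>

lemma power_stationary: "\<exists>n y. x ^ n * (1 - y * x) \<in> I"
proof -
  define J where "J n = {y. \<exists>r. y - r * x ^ n \<in> I}" for n
  have J: "is_ideal (J n)" for n unfolding J_def by (rule is_ideal_plus_multiples[OF ideal_I])
  have IJ: "I \<subseteq> J n" for n unfolding J_def by (auto intro!: exI[of _ 0])
  have dec: "J (Suc n) \<subseteq> J n" for n
  proof
    fix y assume "y \<in> J (Suc n)"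
    then obtain r where "y - r * x ^ Suc n \<in> I" unfolding J_def by blast
    then show "y \<in> J n" unfolding J_def by (auto simp: mult.assoc intro!: exI[of _ "r * x"])
  qed
  \<comment> \<open>A minimal dimension replaces the stationary index of the chain:
    \<open>J (Suc n)\<close> is contained in \<open>J n\<close> and no smaller, so it still contains
    x^n.\<close>
  obtain n where n: "\<forall>m. mvp.rel_dim I (J n) \<le> mvp.rel_dim I (J m)"
    using ex_has_least_nat[of "\<lambda>_. True" 0 "\<lambda>n. mvp.rel_dim I (J n)"] by auto
  have "J (Suc n) = J n"
    using mvp.rel_dim_eq_imp_eq[OF fin_codim_I is_ideal_imp_subspace[OF J] IJ
        is_ideal_imp_subspace[OF J] dec] n by blast
  moreover have "x ^ n \<in> J n" unfolding J_def using is_ideal_0[OF ideal_I] by (auto intro!: exI[of _ 1])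
  ultimately obtain r where "x ^ n - r * x ^ Suc n \<in> I" unfolding J_def by blast
  then show ?thesis by (auto simp: algebra_simps intro!: exI[of _ n] exI[of _ r])
qed

text \<open>Finite codimension replaces Zorn's lemma: among the proper ideals above J take N of
  largest dimension modulo I. For a outside N the ideal N + (a) is larger, hence contains 1.\<close>

lemma max_ideal_exists:
  assumes J: "is_ideal J" "I \<subseteq> J" "1 \<notin> J"
  shows "\<exists>M. is_max_ideal M \<and> J \<subseteq> M"
proof -
  let ?P = "\<lambda>N. is_ideal N \<and> J \<subseteq> N \<and> 1 \<notin> N"
  have bound: "\<forall>N. ?P N \<longrightarrow> mvp.rel_dim I N < Suc (mvp.rel_dim I UNIV)"
  proof (intro allI impI)
    fix N assume "?P N"
    then have "mvp.rel_dim I N \<le> mvp.rel_dim I UNIV"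
      using J(2) by (intro rel_dim_ideal_mono) (auto simp: is_ideal_def)
    then show "mvp.rel_dim I N < Suc (mvp.rel_dim I UNIV)" by simp
  qed
  have "?P J" using J by simp
  from ex_has_greatest_nat[of ?P, OF this bound]
  obtain N where N: "?P N" "\<forall>N'. ?P N' \<longrightarrow> mvp.rel_dim I N' \<le> mvp.rel_dim I N"
    by (elim exE conjE) simp
  have "\<exists>y. 1 - y * a \<in> N" if a: "a \<notin> N" for a
  proof (rule ccontr)
    assume none: "\<nexists>y. 1 - y * a \<in> N"
    let ?N = "{y. \<exists>r. y - r * a \<in> N}"
    have sub: "N \<subseteq> ?N" by (auto intro!: exI[of _ 0])
    have id: "is_ideal ?N" using is_ideal_plus_multiples N(1) by blast
    have "a \<in> ?N" using is_ideal_0 N(1) by (auto intro!: exI[of _ 1])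
    then have "mvp.rel_dim I N < mvp.rel_dim I ?N"
      using N(1) J(2) id sub a by (intro rel_dim_ideal_strict) auto
    moreover have "?P ?N" using id sub N(1) none by auto
    ultimately show False using N(2) by (meson not_le)
  qed
  then show ?thesis using N(1) by (auto simp: is_max_ideal_def)
qed

definition max_ideals :: "('n, 'k) mvpoly set set" where
  "max_ideals = {M. is_max_ideal M \<and> I \<subseteq> M}"

lemma max_ideal_facts:
  assumes "M \<in> max_ideals"
  shows "is_ideal M" "is_prime_ideal M" "1 \<notin> M" "I \<subseteq> M" "is_max_ideal M"
  using assms is_max_ideal_imp_prime by (auto simp: max_ideals_def is_max_ideal_def)

lemma max_ideals_not_subset:
  assumes "M \<in> max_ideals" "M' \<in> max_ideals" "M \<noteq> M'"
  shows "\<not> M \<subseteq> M'"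
  using is_max_ideal_unique[OF max_ideal_facts(5)[OF assms(1)] max_ideal_facts(1,3)[OF assms(2)]] assms(3) by blast

text \<open>Intersecting with a further maximal ideal strictly lowers the dimension, so their number
  is at most the dimension of P/I.\<close>

lemma finite_max_ideals: "finite max_ideals"
proof -
  have "mvp.rel_dim I (\<Inter>T) + card T \<le> mvp.rel_dim I UNIV" if "finite T" "T \<subseteq> max_ideals" for T
    using that
  proof (induction T rule: finite_induct)
    case empty
    then show ?case by simp
  next
    case (insert M T)
    have M: "M \<in> max_ideals" using insert by blast
    have ids: "is_ideal (\<Inter>S)" if "S \<subseteq> max_ideals" for S
      using that max_ideal_facts(1) unfolding is_ideal_def by blast
    have "\<exists>h. h \<notin> M \<and> (\<forall>S\<in>T. h \<in> S)"
      using insert max_ideals_not_subset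
      by (intro prime_avoidance max_ideal_facts(2)[OF M] insert) (auto dest: max_ideal_facts)
    then have "\<Inter>(insert M T) \<subset> \<Inter>T" by auto
    moreover have "I \<subseteq> \<Inter>(insert M T)" using insert(4) max_ideal_facts(4) by blast
    ultimately have "mvp.rel_dim I (\<Inter>(insert M T)) < mvp.rel_dim I (\<Inter>T)"
      using insert(4) by (intro rel_dim_ideal_strict ids) auto
    then show ?case using insert by simp
  qed
  then have "card T \<le> mvp.rel_dim I UNIV" if "finite T" "T \<subseteq> max_ideals" for T
    using that by (meson add_leD2)
  note bound = this
  show ?thesis
  proof (rule ccontr)
    assume "infinite max_ideals"
    then obtain T where "finite T" "card T = Suc (mvp.rel_dim I UNIV)" "T \<subseteq> max_ideals"
      using infinite_arbitrarily_large by blast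
    then show False using bound[of T] by simp
  qed
qed

text \<open>The kernel of the map from P to the localisation of P/I at M, which is the M-primary
  component of I.\<close>

definition component :: "('n, 'k) mvpoly set \<Rightarrow> ('n, 'k) mvpoly set" where
  "component M = {f. \<exists>h. h \<notin> M \<and> h * f \<in> I}"

text \<open>For x in M, \<open>power_stationary\<close> puts x^n (1 - y x) into I. No power of 1 - y
  x lies in Q, since 1 - y x is outside M; primarity then forces x^n into Q.\<close>

lemma radical_primary:
  assumes Q: "primary_ideal Q \<P>" and M: "M \<in> max_ideals" and sub: "I \<subseteq> Q" "Q \<subseteq> M"
  shows "ideal_radical \<P> Q = M"
proof
  note Q = Q[unfolded primary_ideal_type_algebra_iff]
  show "ideal_radical \<P> Q \<subseteq> M"
    using is_prime_ideal_power[OF max_ideal_facts(2)[OF M]] sub by (auto simp: ideal_radical_type_algebra)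
  show "M \<subseteq> ideal_radical \<P> Q"
  proof
    fix x assume x: "x \<in> M"
    obtain n y where y: "x ^ n * (1 - y * x) \<in> Q" using power_stationary sub by blast
    have "1 - y * x \<notin> M"
      using is_ideal_add[OF max_ideal_facts(1)[OF M], of "1 - y * x" "y * x"]
        is_ideal_mult_left[OF max_ideal_facts(1)[OF M] x] max_ideal_facts(3)[OF M] by auto
    then have "(1 - y * x) ^ k \<notin> Q" for k
      using is_prime_ideal_power[OF max_ideal_facts(2)[OF M]] sub by blast
    moreover have "x ^ n \<in> Q \<or> (\<exists>k. (1 - y * x) ^ k \<in> Q)"
      using y Q by blast
    ultimately show "x \<in> ideal_radical \<P> Q" by (auto simp: ideal_radical_type_algebra)
  qed
qed

text \<open>For primarity, let a b be in the component. If b is outside M, it can be absorbed into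
  the multiplier of a. If b is in M, then 1 - y b is a multiplier that puts b^n into the
  component.\<close>

lemma component_facts:
  assumes M: "M \<in> max_ideals"
  shows "is_ideal (component M)" "I \<subseteq> component M" "component M \<subseteq> M"
    "primary_ideal (component M) \<P>" "ideal_radical \<P> (component M) = M"
proof -
  note prime = max_ideal_facts(2)[OF M, unfolded is_prime_ideal_def]
  show id: "is_ideal (component M)"
    unfolding is_ideal_def
  proof (intro conjI ballI allI)
    show "0 \<in> component M" using max_ideal_facts(3)[OF M] is_ideal_0[OF ideal_I]
      by (auto simp: component_def intro!: exI[of _ 1])
    fix a assume "a \<in> component M"
    then obtain h where h: "h \<notin> M" "h * a \<in> I" by (auto simp: component_def)
    show "r * a \<in> component M" for r
      using h is_ideal_mult_left[OF ideal_I h(2), of r] unfolding component_def by (auto simp: ac_simps)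
    fix b assume "b \<in> component M"
    then obtain h' where h': "h' \<notin> M" "h' * b \<in> I" by (auto simp: component_def)
    have "h' * (h * a) + h * (h' * b) \<in> I"
      by (rule is_ideal_add[OF ideal_I is_ideal_mult_left[OF ideal_I h(2)] is_ideal_mult_left[OF ideal_I h'(2)]])
    then have "(h * h') * (a + b) \<in> I" by (simp add: algebra_simps)
    then show "a + b \<in> component M" using h h' prime unfolding component_def by blast
  qed
  show sub: "I \<subseteq> component M" 
    using max_ideal_facts(3)[OF M] by (auto simp: component_def intro!: exI[of _ 1])
  show cM: "component M \<subseteq> M"
    using prime max_ideal_facts(4)[OF M] by (auto simp: component_def)
  show pr: "primary_ideal (component M) \<P>"
    unfolding primary_ideal_type_algebra_iff
  proof (intro conjI id allI impI)
    show "1 \<notin> component M" using cM max_ideal_facts(3)[OF M] by blast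
    fix a b assume "a * b \<in> component M"
    then obtain h where h: "h \<notin> M" "h * (a * b) \<in> I" by (auto simp: component_def)
    show "a \<in> component M \<or> (\<exists>n. b ^ n \<in> component M)"
    proof (cases "b \<in> M")
      case True
      obtain n y where y: "b ^ n * (1 - y * b) \<in> I" using power_stationary by blast
      have "1 - y * b \<notin> M"
        using is_ideal_add[OF max_ideal_facts(1)[OF M], of "1 - y * b" "y * b"]
          is_ideal_mult_left[OF max_ideal_facts(1)[OF M] True] max_ideal_facts(3)[OF M] by auto
      then have "b ^ n \<in> component M" using y unfolding component_def by (auto simp: mult.commute)
      then show ?thesis by blast
    next
      case False
      then have "h * b \<notin> M" using h prime by blast
      moreover have "(h * b) * a \<in> I" using h by (simp add: ac_simps)
      ultimately show ?thesis unfolding component_def by blast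
    qed
  qed
  show "ideal_radical \<P> (component M) = M" by (rule radical_primary[OF pr M sub cM])
qed

text \<open>A substitute for the idempotent belonging to M: e is invertible modulo M and vanishes in
  all other components. It exists because a component contained in M must have radical M.\<close>

lemma component_others:
  assumes M: "M \<in> max_ideals"
  shows "\<exists>e. e \<notin> M \<and> (\<forall>M'\<in>max_ideals - {M}. e \<in> component M')"
proof -
  have "\<not> component M' \<subseteq> M" if M': "M' \<in> max_ideals - {M}" for M'
  proof
    assume "component M' \<subseteq> M"
    then have "M' = M"
      using radical_primary[OF component_facts(4) M component_facts(2), of M'] component_facts(5)[of M'] M' by auto
    then show False using M' by blast
  qed
  then have "\<exists>h. h \<notin> M \<and> (\<forall>S\<in>component ` (max_ideals - {M}). h \<in> S)"
    using finite_max_ideals component_facts(1)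
    by (intro prime_avoidance max_ideal_facts(2)[OF M]) auto
  then show ?thesis by auto
qed

text \<open>If f lies in every component, the colon ideal I : f is contained in no maximal ideal
  above I, so it contains 1.\<close>

lemma Inter_components: "\<Inter>(component ` max_ideals) = I"
proof
  show "I \<subseteq> \<Inter>(component ` max_ideals)" using component_facts(2) by blast
  show "\<Inter>(component ` max_ideals) \<subseteq> I"
  proof
    fix f assume f: "f \<in> \<Inter>(component ` max_ideals)"
    have "1 \<in> {h. h * f \<in> I}"
    proof (rule ccontr)
      assume "1 \<notin> {h. h * f \<in> I}"
      moreover have "I \<subseteq> {h. h * f \<in> I}" using is_ideal_mult_right[OF ideal_I] by blast
      ultimately obtain M where M: "is_max_ideal M" "{h. h * f \<in> I} \<subseteq> M" "I \<subseteq> M"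
        using max_ideal_exists[OF is_ideal_colon[OF ideal_I, of f]] by blast
      then have "f \<in> component M" using f by (auto simp: max_ideals_def)
      then show False using M by (auto simp: component_def)
    qed
    then show "f \<in> I" by simp
  qed
qed

lemma is_primary_decomposition_components: "is_primary_decomposition I (component ` max_ideals)"
  unfolding is_primary_decomposition_def
proof (intro conjI ballI)
  show "finite (component ` max_ideals)" using finite_max_ideals by simp
  show "primary_ideal Q \<P>" if "Q \<in> component ` max_ideals" for Q using that component_facts(4) by blast
  show "I = \<Inter>(component ` max_ideals)" by (rule Inter_components[symmetric])
  show "inj_on (ideal_radical \<P>) (component ` max_ideals)"
    by (auto simp: inj_on_def component_facts(5))
  show "\<not> \<Inter>(component ` max_ideals - {Q}) \<subseteq> Q" if "Q \<in> component ` max_ideals" for Q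
  proof -
    obtain M where M: "M \<in> max_ideals" "Q = component M" using \<open>Q \<in> component ` max_ideals\<close> by blast
    then obtain e where "e \<notin> M" "\<forall>M'\<in>max_ideals - {M}. e \<in> component M'" using component_others by blast
    then have "e \<in> \<Inter>(component ` max_ideals - {Q})" "e \<notin> Q" using M component_facts(3) by auto
    then show ?thesis by blast
  qed
qed

text \<open>All radicals are maximal, so no component is embedded and each is recovered from I and
  its radical by the formula of \<open>component\<close>.\<close>

lemma is_primary_decomposition_unique:
  assumes D: "is_primary_decomposition I D"
  shows "D = component ` max_ideals"
proof -
  have fin: "finite D" and prim: "\<And>Q. Q \<in> D \<Longrightarrow> primary_ideal Q \<P>" and I: "I = \<Inter>D"
    and inj: "inj_on (ideal_radical \<P>) D"
    using D by (auto simp: is_primary_decomposition_def)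
  have id: "is_ideal Q" if "Q \<in> D" for Q using prim[OF that] by (simp add: primary_ideal_type_algebra_iff)
  have rad: "ideal_radical \<P> Q \<in> max_ideals \<and> Q \<subseteq> ideal_radical \<P> Q" if Q: "Q \<in> D" for Q
  proof -
    have IQ: "I \<subseteq> Q" using I Q by blast
    have "1 \<notin> Q" using prim[OF Q] by (simp add: primary_ideal_type_algebra_iff)
    then obtain M where M: "is_max_ideal M" "Q \<subseteq> M" using max_ideal_exists[OF id[OF Q] IQ] by blast
    then have "M \<in> max_ideals" using IQ by (auto simp: max_ideals_def)
    then show ?thesis using radical_primary[OF prim[OF Q] _ IQ M(2)] M(2) by simp
  qed
  have eq: "Q = component (ideal_radical \<P> Q)" if Q: "Q \<in> D" for Q
  proof
    let ?M = "ideal_radical \<P> Q"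
    note M = conjunct1[OF rad[OF Q]]
    show "component ?M \<subseteq> Q"
    proof
      fix f assume "f \<in> component ?M"
      then obtain h where "h \<notin> ?M" "h * f \<in> I" unfolding component_def by blast
      then have "h \<notin> ?M" "f * h \<in> Q" using I Q by (auto simp: mult.commute)
      then show "f \<in> Q"
        using prim[OF Q] by (auto simp: primary_ideal_type_algebra_iff ideal_radical_type_algebra)
    qed
    show "Q \<subseteq> component ?M"
    proof
      fix f assume f: "f \<in> Q"
      have "\<not> Q' \<subseteq> ?M" if Q': "Q' \<in> D - {Q}" for Q'
      proof
        assume "Q' \<subseteq> ?M"
        then have "ideal_radical \<P> Q' = ?M"
          using radical_primary[OF prim M, of Q'] I Q' by blast
        then show False using inj Q Q' by (auto simp: inj_on_def)
      qed
      \<comment> \<open>Distinct radicals keep the other members out of the radical of Q; this h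
        carries Q into all members of D, hence into I.\<close>
      then obtain h where h: "h \<notin> ?M" "\<forall>S\<in>D - {Q}. h \<in> S"
        using prime_avoidance[OF max_ideal_facts(2)[OF M], of "D - {Q}"] fin id by blast
      have "h * f \<in> S" if S: "S \<in> D" for S
        using h f is_ideal_mult_left[OF id[OF S]] is_ideal_mult_right[OF id[OF S]] S by (cases "S = Q") auto
      then have "h * f \<in> I" using I by blast
      then show "f \<in> component ?M" using h by (auto simp: component_def)
    qed
  qed
  have ex: "\<exists>Q\<in>D. ideal_radical \<P> Q = M" if M: "M \<in> max_ideals" for M
  proof (rule ccontr)
    assume none: "\<not> ?thesis"
    have "\<not> Q \<subseteq> M" if Q: "Q \<in> D" for Q
      using radical_primary[OF prim[OF Q] M] none I Q by blast
    then obtain h where "h \<notin> M" "\<forall>S\<in>D. h \<in> S"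
      using prime_avoidance[OF max_ideal_facts(2)[OF M], of D] fin id by blast
    then show False using I max_ideal_facts(4)[OF M] by blast
  qed
  show ?thesis
  proof
    show "D \<subseteq> component ` max_ideals" using eq rad by blast
    show "component ` max_ideals \<subseteq> D"
    proof clarify
      fix M assume "M \<in> max_ideals"
      then obtain Q where "Q \<in> D" "ideal_radical \<P> Q = M" using ex by blast
      then show "component M \<in> D" using eq[of Q] by simp
    qed
  qed
qed

lemma primary_components_eq: "primary_components I = component ` max_ideals"
  unfolding primary_components_def
  by (rule the_equality) (rule is_primary_decomposition_components, erule is_primary_decomposition_unique)

end

section \<open>The degree filtration and the Cayley-Bacharach property\<close>

lemma is_ideal_Inter: "(\<And>S. S \<in> T \<Longrightarrow> is_ideal S) \<Longrightarrow> is_ideal (\<Inter>T)"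
  by (simp add: is_ideal_def)

context zero_dim_algebra
begin

text \<open>The subspace F_i P + I, the preimage of F_i R in P. Below degree 0 it is I.\<close>

definition filt_mod :: "int \<Rightarrow> ('n, 'k) mvpoly set" where
  "filt_mod i = {f. \<exists>g\<in>filt_P i. f - g \<in> I}"

lemma filt_P_subset_filt_mod: "filt_P i \<subseteq> filt_mod i"
  using is_ideal_0[OF ideal_I] by (auto simp: filt_mod_def intro!: bexI)

lemma I_subset_filt_mod: "I \<subseteq> filt_mod i"
  by (auto simp: filt_mod_def filt_P_def intro!: bexI[of _ 0])

lemma filt_mod_mono: "i \<le> j \<Longrightarrow> filt_mod i \<subseteq> filt_mod j"
  using filt_P_mono by (fastforce simp: filt_mod_def)

lemma filt_mod_neg: "i < 0 \<Longrightarrow> filt_mod i = I"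
  by (simp add: filt_mod_def filt_P_neg)

lemma filt_mod_subspace: "mvp.subspace (filt_mod i)"
  unfolding mvp.subspace_def
proof (intro conjI ballI allI)
  show "0 \<in> filt_mod i" using I_subset_filt_mod is_ideal_0[OF ideal_I] by blast
  fix f assume "f \<in> filt_mod i"
  then obtain f' where f: "f' \<in> filt_P i" "f - f' \<in> I" by (auto simp: filt_mod_def)
  show "const_poly c * f \<in> filt_mod i" for c
    using is_ideal_mult_left[OF ideal_I f(2), of "const_poly c"] mvp.subspace_scale[OF filt_P_subspace f(1), of c]
    unfolding filt_mod_def by (auto simp: algebra_simps intro!: bexI[of _ "const_poly c * f'"])
  fix g assume "g \<in> filt_mod i"
  then obtain g' where g: "g' \<in> filt_P i" "g - g' \<in> I" by (auto simp: filt_mod_def)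
  show "f + g \<in> filt_mod i"
    using is_ideal_add[OF ideal_I f(2) g(2)] mvp.subspace_add[OF filt_P_subspace f(1) g(1)]
    unfolding filt_mod_def by (auto simp: algebra_simps intro!: bexI[of _ "f' + g'"])
qed

lemmas filt_mod_add = mvp.subspace_add[OF filt_mod_subspace]
  and filt_mod_diff = mvp.subspace_diff[OF filt_mod_subspace]
  and filt_mod_scale = mvp.subspace_scale[OF filt_mod_subspace]

lemma filt_mod_cong: "f - g \<in> filt_mod i \<Longrightarrow> f \<in> filt_mod i \<longleftrightarrow> g \<in> filt_mod i"
  using filt_mod_add[of "f - g" i g] filt_mod_diff[of f i "f - g"] by auto

lemma filt_mod_mult:
  assumes "f \<in> filt_mod i" "g \<in> filt_mod j" shows "f * g \<in> filt_mod (i + j)"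
proof -
  obtain f' g' where f: "f' \<in> filt_P i" "f - f' \<in> I" and g: "g' \<in> filt_P j" "g - g' \<in> I"
    using assms by (auto simp: filt_mod_def)
  have "f' * (g - g') + (f - f') * g \<in> I"
    by (rule is_ideal_add[OF ideal_I is_ideal_mult_left[OF ideal_I g(2)] is_ideal_mult_right[OF ideal_I f(2)]])
  then have "f * g - f' * g' \<in> I" by (simp add: algebra_simps)
  then show ?thesis using filt_P_mult[OF f(1) g(1)] unfolding filt_mod_def by blast
qed

lemma coset_eq_iff: "I +>\<^bsub>\<P>\<^esub> f = I +>\<^bsub>\<P>\<^esub> g \<longleftrightarrow> f - g \<in> I"
  using surjective_ring_hom.hom_eq_iff[OF surjective_ring_hom_coset(1)[OF ideal_I], of f g]
    surjective_ring_hom_coset(2)[OF ideal_I] by simp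

lemma coset_mem_filt_R_iff: "I +>\<^bsub>\<P>\<^esub> f \<in> filt_R I i \<longleftrightarrow> f \<in> filt_mod i"
  by (auto simp: filt_R_def img_quot_def filt_mod_def coset_eq_iff image_iff)

lemma filt_R_eq: "filt_R I i = img_quot I (filt_mod i)"
proof
  show "filt_R I i \<subseteq> img_quot I (filt_mod i)"
    using filt_P_subset_filt_mod by (auto simp: filt_R_def img_quot_def)
  show "img_quot I (filt_mod i) \<subseteq> filt_R I i"
    using coset_mem_filt_R_iff by (auto simp: img_quot_def)
qed

lemma HFa_eq: "HFa I i = mvp.rel_dim I (filt_mod i)"
  unfolding HFa_def filt_R_eq
  by (rule dim_K_img_quot[OF ideal_I fin_codim_I filt_mod_subspace I_subset_filt_mod])

lemma dim_K_carrier: "dim_K I (carrier (\<P> Quot I)) = mvp.rel_dim I UNIV"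
  unfolding carrier_Quot_eq[OF ideal_I]
  by (rule dim_K_img_quot[OF ideal_I fin_codim_I mvp.subspace_UNIV subset_UNIV])

lemma filt_mod_exhaust: "\<exists>i. filt_mod i = UNIV"
proof -
  obtain S where S: "finite S" "mvp.span (S \<union> I) = UNIV"
    using fin_codim_I by (auto simp: mvp.fin_codim_def)
  obtain i where "S \<subseteq> filt_P i" using filt_P_exhaust[OF S(1)] by blast
  then have "mvp.span (S \<union> I) \<subseteq> filt_mod i"
    using filt_P_subset_filt_mod I_subset_filt_mod
    by (intro mvp.span_minimal filt_mod_subspace) blast
  then show ?thesis using S(2) top.extremum_uniqueI by metis
qed

text \<open>A least element over the naturals exists without a separate lower bound. Negative
  indices may be ignored, since there the filtration is the proper ideal I;
  \<open>reg_index_eq\<close> identifies the value with \<open>reg_index\<close>.\<close>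

definition ri :: int where "ri = int (LEAST n. filt_mod (int n) = UNIV)"

lemma filt_mod_eq_UNIV_iff: "filt_mod i = UNIV \<longleftrightarrow> ri \<le> i"
proof -
  have neg: "filt_mod i \<noteq> UNIV" if "i < 0" for i using filt_mod_neg[OF that] one_notin_I by auto
  have ex: "\<exists>n. filt_mod (int n) = UNIV"
    using filt_mod_exhaust neg by (metis nat_0_le not_less)
  have ri: "filt_mod ri = UNIV" unfolding ri_def using LeastI_ex[OF ex] .
  have "ri \<le> i" if "filt_mod i = UNIV"
  proof -
    have "i = int (nat i)" using neg[of i] that by (cases "i < 0") auto
    then show ?thesis unfolding ri_def using Least_le[of "\<lambda>n. filt_mod (int n) = UNIV" "nat i"] that
      by (metis of_nat_le_iff)
  qed
  then show ?thesis using ri filt_mod_mono[of ri i] by auto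
qed

lemma ri_nonneg: "0 \<le> ri" by (simp add: ri_def)

lemma HFa_eq_dim_iff: "HFa I i = dim_K I (carrier (\<P> Quot I)) \<longleftrightarrow> ri \<le> i"
  unfolding HFa_eq dim_K_carrier filt_mod_eq_UNIV_iff[symmetric]
proof
  assume "mvp.rel_dim I (filt_mod i) = mvp.rel_dim I UNIV"
  then show "filt_mod i = UNIV"
    by (intro mvp.rel_dim_eq_imp_eq[OF fin_codim_I filt_mod_subspace I_subset_filt_mod mvp.subspace_UNIV subset_UNIV])
      simp
qed simp

lemma reg_index_eq: "reg_index I = ri"
  unfolding reg_index_def HFa_eq_dim_iff
  by (rule Least_equality) auto

lemma ord_F_coset:
  assumes "f \<notin> I"
  shows "ord_F I (I +>\<^bsub>\<P>\<^esub> f) \<le> i \<longleftrightarrow> f \<in> filt_mod i"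
proof -
  let ?P = "\<lambda>n. f \<in> filt_mod (int n)"
  have neg: "f \<notin> filt_mod i" if "i < 0" for i using assms filt_mod_neg[OF that] by simp
  have ex: "\<exists>n. ?P n" using filt_mod_eq_UNIV_iff[of ri] ri_nonneg by (metis UNIV_I nat_0_le order_refl)
  have eq: "ord_F I (I +>\<^bsub>\<P>\<^esub> f) = int (LEAST n. ?P n)"
    unfolding ord_F_def coset_mem_filt_R_iff
  proof (rule Least_equality)
    show "f \<in> filt_mod (int (LEAST n. ?P n))" using LeastI_ex[OF ex] .
    fix j assume j: "f \<in> filt_mod j"
    then have "j = int (nat j)" using neg[of j] by (cases "j < 0") auto
    then show "int (LEAST n. ?P n) \<le> j" using Least_le[of ?P "nat j"] j by (metis of_nat_le_iff)
  qed
  show ?thesis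
  proof
    assume "ord_F I (I +>\<^bsub>\<P>\<^esub> f) \<le> i"
    then show "f \<in> filt_mod i" using filt_mod_mono[of "int (LEAST n. ?P n)" i] LeastI_ex[OF ex] eq by auto
  next
    assume i: "f \<in> filt_mod i"
    then have "i = int (nat i)" using neg[of i] by (cases "i < 0") auto
    then show "ord_F I (I +>\<^bsub>\<P>\<^esub> f) \<le> i" using Least_le[of ?P "nat i"] i eq by (metis of_nat_le_iff)
  qed
qed

text \<open>The orders of the non-zero classes in J lie between 0 and \<open>ri\<close>, so the
  maximum exists and is \<open>ri\<close> exactly when it is attained, i.e. when some element of J
  escapes F_{r-1}.\<close>

lemma reg_index_ideal_eq_iff:
  assumes J: "I \<subset> J"
  shows "reg_index_ideal I J = ri \<longleftrightarrow> \<not> J \<subseteq> filt_mod (ri - 1)"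
proof -
  let ?S = "img_quot I J - {\<zero>\<^bsub>\<P> Quot I\<^esub>}"
  have zero: "I +>\<^bsub>\<P>\<^esub> f = \<zero>\<^bsub>\<P> Quot I\<^esub> \<longleftrightarrow> f \<in> I" for f
    using surjective_ring_hom_coset(2)[OF ideal_I]
    unfolding surjective_ring_hom.ker_def[OF surjective_ring_hom_coset(1)[OF ideal_I]] by blast
  have S: "?S = (\<lambda>f. I +>\<^bsub>\<P>\<^esub> f) ` (J - I)" 
    unfolding img_quot_def using zero by blast
  have le: "ord_F I (I +>\<^bsub>\<P>\<^esub> f) \<le> ri" if "f \<notin> I" for f
    unfolding ord_F_coset[OF that] using filt_mod_eq_UNIV_iff[of ri] by auto
  have ge: "0 \<le> ord_F I (I +>\<^bsub>\<P>\<^esub> f)" if "f \<notin> I" for f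
    using ord_F_coset[OF that, of "- 1"] filt_mod_neg[of "- 1"] that by auto
  have sub: "ord_F I ` ?S \<subseteq> {0..ri}" unfolding S using le ge by auto
  then have fin: "finite (ord_F I ` ?S)" by (rule finite_subset) simp
  have ne: "ord_F I ` ?S \<noteq> {}" unfolding S using J by auto
  have "reg_index_ideal I J = ri \<longleftrightarrow> ri \<in> ord_F I ` ?S"
    unfolding reg_index_ideal_def
  proof
    assume "Max (ord_F I ` ?S) = ri"
    then show "ri \<in> ord_F I ` ?S" using Max_in[OF fin ne] by simp
  next
    assume "ri \<in> ord_F I ` ?S"
    then show "Max (ord_F I ` ?S) = ri" using Max_eqI[OF fin, of ri] subsetD[OF sub] by simp
  qed
  also have "\<dots> \<longleftrightarrow> (\<exists>f\<in>J - I. ord_F I (I +>\<^bsub>\<P>\<^esub> f) = ri)"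
    unfolding S image_image image_iff by (simp only: eq_commute)
  also have "\<dots> \<longleftrightarrow> (\<exists>f\<in>J - I. \<not> ord_F I (I +>\<^bsub>\<P>\<^esub> f) \<le> ri - 1)"
  proof (intro bex_cong refl)
    fix f assume "f \<in> J - I"
    then show "ord_F I (I +>\<^bsub>\<P>\<^esub> f) = ri \<longleftrightarrow> \<not> ord_F I (I +>\<^bsub>\<P>\<^esub> f) \<le> ri - 1" using le[of f] by auto
  qed
  also have "\<dots> \<longleftrightarrow> (\<exists>f\<in>J - I. f \<notin> filt_mod (ri - 1))"
  proof (intro bex_cong refl)
    fix f assume "f \<in> J - I"
    then have "f \<notin> I" by simp
    from ord_F_coset[OF this, of "ri - 1"]
    show "\<not> ord_F I (I +>\<^bsub>\<P>\<^esub> f) \<le> ri - 1 \<longleftrightarrow> f \<notin> filt_mod (ri - 1)" by (simp only:)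
  qed
  also have "\<dots> \<longleftrightarrow> \<not> J \<subseteq> filt_mod (ri - 1)" using I_subset_filt_mod by auto
  finally show ?thesis .
qed

section \<open>Minimal divisors and the Cayley-Bacharach property\<close>

lemma fin_codim_ideal:
  assumes "is_ideal J" "I \<subseteq> J" shows "mvp.fin_codim J"
proof -
  obtain S where S: "finite S" "mvp.span (S \<union> I) = UNIV"
    using fin_codim_I by (auto simp: mvp.fin_codim_def)
  have "mvp.span (S \<union> I) \<subseteq> mvp.span (S \<union> J)" using assms by (intro mvp.span_mono) auto
  then show ?thesis using S is_ideal_imp_subspace[OF assms(1)] unfolding mvp.fin_codim_def by auto
qed

lemma rel_dim_self: "mvp.subspace J \<Longrightarrow> mvp.rel_dim J J = 0"
  using mvp.rel_dim_unique[of J "{}" J] by (auto simp: mvp.rel_indep_def intro: mvp.span_base)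

text \<open>Multiplication by g induces an isomorphism from P/(I : g) onto (I + (g))/I; it carries a
  basis B to the multiples of g by B.\<close>

lemma rel_dim_principal:
  assumes M: "M = {h. h * g \<in> I}" and J: "J = {y. \<exists>s. y - s * g \<in> I}"
  shows "mvp.rel_dim I J = mvp.rel_dim M UNIV"
proof -
  have iM: "is_ideal M" unfolding M by (rule is_ideal_colon[OF ideal_I])
  have "I \<subseteq> M" unfolding M using is_ideal_mult_right[OF ideal_I] by blast
  then obtain B where B: "finite B" "UNIV \<subseteq> mvp.span (B \<union> M)" "mvp.rel_indep M B" "card B = mvp.rel_dim M UNIV"
    using mvp.rel_basis_exists[OF fin_codim_ideal[OF iM] mvp.subspace_UNIV subset_UNIV] by blast
  have inj: "inj_on (\<lambda>b. b * g) B"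
  proof -
    obtain p where p: "mvp.proj_mod M p" using mvp.proj_mod_exists[OF is_ideal_imp_subspace[OF iM]] by blast
    interpret p: Vector_Spaces.linear "\<lambda>c f. const_poly c * f" "\<lambda>c f. const_poly c * f" p
      using p unfolding mvp.proj_mod_def by blast
    have "b = b'" if "b \<in> B" "b' \<in> B" "b * g = b' * g" for b b'
    proof -
      have "b - b' \<in> M" using that is_ideal_0[OF ideal_I] by (simp add: M left_diff_distrib)
      then have "p (b - b') = 0" using p by (simp add: mvp.proj_mod_def)
      then have "p b = p b'" by (simp add: p.diff)
      then show ?thesis using mvp.rel_indep_proj_mod(1)[OF p B(1,3)] that by (simp add: inj_on_def)
    qed
    then show ?thesis by (auto intro: inj_onI)
  qed
  have "mvp.rel_dim I J = card ((\<lambda>b. b * g) ` B)"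
  proof (rule mvp.rel_dim_unique)
    show "mvp.subspace I" by (rule is_ideal_imp_subspace[OF ideal_I])
    show "finite ((\<lambda>b. b * g) ` B)" using B by simp
    have "b * g - b * g \<in> I" for b using is_ideal_0[OF ideal_I] by simp
    then show "(\<lambda>b. b * g) ` B \<subseteq> J" unfolding J by blast
    let ?W = "mvp.span ((\<lambda>b. b * g) ` B \<union> I)"
    have "mvp.subspace {s. s * g \<in> ?W}"
      unfolding mvp.subspace_def
      by (auto simp: distrib_right mult.assoc mvp.span_zero intro: mvp.span_add mvp.span_scale)
    moreover have "B \<union> M \<subseteq> {s. s * g \<in> ?W}" by (auto simp: M intro: mvp.span_base)
    ultimately have sg: "s * g \<in> ?W" for s using B(2) mvp.span_minimal[of "B \<union> M"] by blast
    show "J \<subseteq> ?W"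
    proof
      fix y assume "y \<in> J"
      then obtain s where "y - s * g \<in> I" unfolding J by blast
      then have "(y - s * g) + s * g \<in> ?W" using sg by (intro mvp.span_add) (auto intro: mvp.span_base)
      then show "y \<in> ?W" by simp
    qed
    show "mvp.rel_indep I ((\<lambda>b. b * g) ` B)"
      unfolding mvp.rel_indep_def
    proof (intro allI impI)
      fix c assume "(\<Sum>x\<in>(\<lambda>b. b * g) ` B. const_poly (c x) * x) \<in> I"
      then have "(\<Sum>b\<in>B. const_poly (c (b * g)) * b) * g \<in> I"
        by (simp add: sum.reindex[OF inj] sum_distrib_right mult.assoc)
      then have "(\<Sum>b\<in>B. const_poly (c (b * g)) * b) \<in> M" by (simp add: M)
      then have "\<forall>b\<in>B. c (b * g) = 0"
        using B(3) unfolding mvp.rel_indep_def by (elim allE[of _ "\<lambda>b. c (b * g)"]) blast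
      then show "\<forall>x\<in>(\<lambda>b. b * g) ` B. c x = 0" by simp
    qed
  qed
  then show ?thesis using B(4) by (simp add: card_image[OF inj])
qed

text \<open>The minimal divisors are the minimal ideals properly containing \<open>I\<close>.\<close>

lemma minimal_Q_divisor_imp:
  assumes Q: "Q \<in> primary_components I" and J: "minimal_Q_divisor I Q J"
  shows "is_ideal J" "I \<subset> J"
proof -
  obtain M where M: "M \<in> max_ideals" "Q = component M" using Q primary_components_eq by blast
  obtain Q' where Q': "is_ideal Q'" "Q \<subset> Q'" "J = Q' \<inter> \<Inter>(primary_components I - {Q})"
    using J by (auto simp: minimal_Q_divisor_def Q_divisor_def ideal_type_algebra_iff)
  have "is_ideal S" if "S \<in> primary_components I" for S
    using that component_facts(1) primary_components_eq by auto
  then have "is_ideal (\<Inter>(insert Q' (primary_components I - {Q})))" using Q'(1) by (intro is_ideal_Inter) blast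
  then show iJ: "is_ideal J" using Q'(3) by simp
  have sub: "I \<subseteq> J"
    using Q' Q Inter_components primary_components_eq by blast
  have "J \<noteq> I"
  proof
    \<comment> \<open>The prescribed dimension of J/I is that of P/M, which is not zero.\<close>
    assume eq: "J = I"
    note fM = max_ideal_facts[OF M(1)]
    have "mvp.rel_dim I J = mvp.rel_dim M UNIV"
      using J unfolding minimal_Q_divisor_def M component_facts(5)[OF M(1)] carrier_Quot_eq[OF fM(1)]
      by (simp add: dim_K_img_quot[OF ideal_I fin_codim_I is_ideal_imp_subspace[OF iJ] sub]
          dim_K_img_quot[OF fM(1) fin_codim_ideal[OF fM(1,4)]])
    moreover have "mvp.rel_dim I J = 0" using rel_dim_self is_ideal_imp_subspace[OF iJ] eq by simp
    ultimately have "M = UNIV"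
      using mvp.rel_dim_eq_imp_eq[OF fin_codim_ideal[OF fM(1,4)] is_ideal_imp_subspace[OF fM(1)]
        subset_refl mvp.subspace_UNIV subset_UNIV] by simp
    then show False using fM(3) by blast
  qed
  then show "I \<subset> J" using sub by blast
qed

text \<open>Every non-zero principal ideal of R contains a minimal divisor, so a condition on
  minimal divisors controls all non-zero ideals.\<close>

lemma minimal_Q_divisor_exists:
  assumes f: "f \<notin> I"
  shows "\<exists>g Q. Q \<in> primary_components I \<and> minimal_Q_divisor I Q {y. \<exists>s. y - s * (f * g) \<in> I}"
proof -
  define J where "J g = {y. \<exists>s. y - s * (f * g) \<in> I}" for g
  have iJ: "is_ideal (J g)" for g unfolding J_def by (rule is_ideal_plus_multiples[OF ideal_I])
  have IJ: "I \<subseteq> J g" for g unfolding J_def by (auto intro!: exI[of _ 0])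
  \<comment> \<open>Choose a multiple of f outside I that generates an ideal of least dimension.
    Then I + (f g) is minimal above I, which makes I : (f g) a maximal ideal.\<close>
  obtain g where g: "f * g \<notin> I" "\<And>g'. f * g' \<notin> I \<Longrightarrow> mvp.rel_dim I (J g) \<le> mvp.rel_dim I (J g')"
  proof -
    have "f * 1 \<notin> I" using f by simp
    from ex_has_least_nat[of "\<lambda>g. f * g \<notin> I", OF this, of "\<lambda>g. mvp.rel_dim I (J g)"]
    show ?thesis using that by (elim exE conjE) simp
  qed
  define M where "M = {h. h * (f * g) \<in> I}"
  have iM: "is_ideal M" unfolding M_def by (rule is_ideal_colon[OF ideal_I])
  have "is_max_ideal M"
    unfolding is_max_ideal_def
  proof (intro conjI allI impI)
    show "is_ideal M" by fact
    show "1 \<notin> M" using g(1) by (simp add: M_def)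
    fix a assume "a \<notin> M"
    then have a: "f * (g * a) \<notin> I" by (simp add: M_def ac_simps)
    have "J (g * a) \<subseteq> J g"
    proof
      fix y assume "y \<in> J (g * a)"
      then obtain s where "y - s * (f * (g * a)) \<in> I" by (auto simp: J_def)
      then have "y - (s * a) * (f * g) \<in> I" by (simp add: ac_simps)
      then show "y \<in> J g" unfolding J_def by blast
    qed
    then have "J (g * a) = J g"
      using g(2)[OF a] mvp.rel_dim_eq_imp_eq[OF fin_codim_I is_ideal_imp_subspace[OF iJ] IJ is_ideal_imp_subspace[OF iJ]]
      by blast
    moreover have "f * g \<in> J g" unfolding J_def using is_ideal_0[OF ideal_I] by (auto intro!: exI[of _ 1])
    ultimately obtain s where "f * g - s * (f * (g * a)) \<in> I" unfolding J_def by blast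
    then have "1 - s * a \<in> M" by (simp add: M_def algebra_simps)
    then show "\<exists>y. 1 - y * a \<in> M" by blast
  qed
  moreover have "I \<subseteq> M" using is_ideal_mult_right[OF ideal_I] by (auto simp: M_def)
  ultimately have M: "M \<in> max_ideals" by (simp add: max_ideals_def)
  let ?Q = "component M"
  let ?Q' = "{y. \<exists>s. y - s * (f * g) \<in> ?Q}"
  let ?O = "\<Inter>(primary_components I - {?Q})"
  have Q: "?Q \<in> primary_components I" using M primary_components_eq by blast
  have iQ: "is_ideal ?Q" by (rule component_facts(1)[OF M])
  have "f * g \<notin> ?Q" by (auto simp: component_def M_def)
  moreover have "f * g \<in> ?Q'" using is_ideal_0[OF iQ] by (auto intro!: exI[of _ 1])
  moreover have "?Q \<subseteq> ?Q'" by (auto intro!: exI[of _ 0])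
  ultimately have QQ': "?Q \<subset> ?Q'" by blast
  \<comment> \<open>An element of M outside M' multiplies f g into I, so f g already lies in the
    component at M'.\<close>
  have O: "f * g \<in> ?O"
  proof
    fix S assume "S \<in> primary_components I - {?Q}"
    then obtain M' where M': "M' \<in> max_ideals" "S = component M'" "M' \<noteq> M"
      using primary_components_eq by auto
    then obtain m where "m \<in> M" "m \<notin> M'" using max_ideals_not_subset[OF M M'(1)] by blast
    then show "f * g \<in> S" using M' by (auto simp: component_def M_def)
  qed
  have iO: "is_ideal ?O"
    by (rule is_ideal_Inter) (use component_facts(1) primary_components_eq in auto)
  have QO: "?Q \<inter> ?O = I" using Inter_components primary_components_eq Q by blast
  \<comment> \<open>The modular law: as f g lies in \<open>?O\<close>, intersecting
    \<open>?Q\<close> + (f g) with \<open>?O\<close> gives (\<open>?Q\<close> \<inter>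
    \<open>?O\<close>) + (f g), and \<open>?Q\<close> \<inter> \<open>?O\<close> is I.\<close>
  have Jeq: "J g = ?Q' \<inter> ?O"
  proof
    show "J g \<subseteq> ?Q' \<inter> ?O"
    proof
      fix y assume "y \<in> J g"
      then obtain s where s: "y - s * (f * g) \<in> I" by (auto simp: J_def)
      then have "y - s * (f * g) \<in> ?Q" "y - s * (f * g) \<in> ?O" using QO by blast+
      then show "y \<in> ?Q' \<inter> ?O" using is_ideal_add[OF iO _ is_ideal_mult_left[OF iO O, of s], of "y - s * (f * g)"] by auto
    qed
    show "?Q' \<inter> ?O \<subseteq> J g"
    proof
      fix y assume y: "y \<in> ?Q' \<inter> ?O"
      then obtain s where s: "y - s * (f * g) \<in> ?Q" by blast
      have "y - s * (f * g) \<in> ?O" using y by (intro is_ideal_diff[OF iO] is_ideal_mult_left[OF iO O]) blast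
      then have "y - s * (f * g) \<in> I" using s QO by blast
      then show "y \<in> J g" unfolding J_def by blast
    qed
  qed
  have "Q_divisor I ?Q (J g)"
    unfolding Q_divisor_def ideal_type_algebra_iff
    using is_ideal_plus_multiples[OF iQ, of "f * g"] QQ' Jeq by blast
  moreover have "dim_K I (img_quot I (J g)) = dim_K (ideal_radical \<P> ?Q) (carrier (\<P> Quot ideal_radical \<P> ?Q))"
    unfolding component_facts(5)[OF M] carrier_Quot_eq[OF iM]
      dim_K_img_quot[OF ideal_I fin_codim_I is_ideal_imp_subspace[OF iJ] IJ]
      dim_K_img_quot[OF iM fin_codim_ideal[OF iM max_ideal_facts(4)[OF M]] mvp.subspace_UNIV subset_UNIV]
    by (rule rel_dim_principal) (auto simp: M_def J_def)
  ultimately have "minimal_Q_divisor I ?Q (J g)" by (simp add: minimal_Q_divisor_def)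
  then show ?thesis using Q unfolding J_def by blast
qed

text \<open>Forwards, a minimal divisor inside I + (f) contains an element outside F_{r-1}, which is
  a multiple of f modulo I. Backwards, a minimal divisor contains some f outside I together with all
  its multiples.\<close>

lemma cayley_bacharach_iff:
  "cayley_bacharach I \<longleftrightarrow> (\<forall>f. f \<notin> I \<longrightarrow> (\<exists>g. f * g \<notin> filt_mod (ri - 1)))"
proof
  assume cb: "cayley_bacharach I"
  show "\<forall>f. f \<notin> I \<longrightarrow> (\<exists>g. f * g \<notin> filt_mod (ri - 1))"
  proof (intro allI impI)
    fix f assume "f \<notin> I"
    then obtain g Q where gQ: "Q \<in> primary_components I"
      "minimal_Q_divisor I Q {y. \<exists>s. y - s * (f * g) \<in> I}" (is "minimal_Q_divisor I Q ?J")
      using minimal_Q_divisor_exists by blast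
    then have "reg_index_ideal I ?J = ri"
      using cb by (simp add: cayley_bacharach_def reg_index_eq)
    then obtain y s where y: "y \<notin> filt_mod (ri - 1)" "y - s * (f * g) \<in> I"
      using reg_index_ideal_eq_iff[OF minimal_Q_divisor_imp(2)[OF gQ]] by blast
    then have "s * (f * g) \<notin> filt_mod (ri - 1)"
      using I_subset_filt_mod[of "ri - 1"] filt_mod_cong by blast
    then have "f * (g * s) \<notin> filt_mod (ri - 1)" by (simp add: ac_simps)
    then show "\<exists>g. f * g \<notin> filt_mod (ri - 1)" by blast
  qed
next
  assume h: "\<forall>f. f \<notin> I \<longrightarrow> (\<exists>g. f * g \<notin> filt_mod (ri - 1))"
  show "cayley_bacharach I"
    unfolding cayley_bacharach_def reg_index_eq
  proof (intro ballI allI impI)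
    fix Q J assume "Q \<in> primary_components I" "minimal_Q_divisor I Q J"
    note J = minimal_Q_divisor_imp[OF this]
    then obtain f where f: "f \<in> J" "f \<notin> I" by blast
    then obtain g where "f * g \<notin> filt_mod (ri - 1)" using h by blast
    moreover have "f * g \<in> J" using is_ideal_mult_right[OF J(1) f(1)] .
    ultimately show "reg_index_ideal I J = ri" using reg_index_ideal_eq_iff[OF J(2)] by blast
  qed
qed

end

section \<open>The associated graded ring\<close>

lemma hcomp_1: "hcomp i 1 = (if i = 0 then 1 else 0)"
  by (auto intro!: poly_mapping_eqI simp: lookup_hcomp lookup_one when_def)

context zero_dim_algebra
begin

abbreviation "R \<equiv> \<P> Quot I"
abbreviation "gr \<equiv> gr_component R (filt_R I)"

text \<open>The coset of F_{i-1} R at the class of f, described by polynomial representatives; it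
  lies in \<open>gr i\<close> for f in \<open>filt_mod i\<close>.\<close>

definition gr_class :: "int \<Rightarrow> ('n, 'k) mvpoly \<Rightarrow> ('n, 'k) mvpoly set set" where
  "gr_class i f = (\<lambda>x. I +>\<^bsub>\<P>\<^esub> x) ` {x. x - f \<in> filt_mod (i - 1)}"

lemma coset_mem_gr_class_iff: "I +>\<^bsub>\<P>\<^esub> x \<in> gr_class i f \<longleftrightarrow> x - f \<in> filt_mod (i - 1)"
proof
  assume "I +>\<^bsub>\<P>\<^esub> x \<in> gr_class i f"
  then obtain y where y: "x - y \<in> I" "y - f \<in> filt_mod (i - 1)"
    by (auto simp: gr_class_def coset_eq_iff)
  then have "(x - y) + (y - f) \<in> filt_mod (i - 1)" using I_subset_filt_mod by (intro filt_mod_add) blast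
  then show "x - f \<in> filt_mod (i - 1)" by simp
qed (auto simp: gr_class_def)

lemma gr_class_eq_iff: "gr_class i f = gr_class i g \<longleftrightarrow> f - g \<in> filt_mod (i - 1)"
proof
  assume "gr_class i f = gr_class i g"
  moreover have "I +>\<^bsub>\<P>\<^esub> f \<in> gr_class i f" 
    using mvp.subspace_0[OF filt_mod_subspace] by (simp add: coset_mem_gr_class_iff)
  ultimately show "f - g \<in> filt_mod (i - 1)" using coset_mem_gr_class_iff[of f i g] by simp
next
  assume "f - g \<in> filt_mod (i - 1)"
  then have "x - f \<in> filt_mod (i - 1) \<longleftrightarrow> x - g \<in> filt_mod (i - 1)" for x
    using filt_mod_cong[of "x - g" "x - f" "i - 1"] by simp
  then show "gr_class i f = gr_class i g" by (simp add: gr_class_def)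
qed

lemma coset_hom: "surjective_ring_hom (\<lambda>x. I +>\<^bsub>\<P>\<^esub> x) R"
  by (rule surjective_ring_hom_coset(1)[OF ideal_I])

lemma gr_class_alt: "gr_class i f = (\<lambda>x. I +>\<^bsub>\<P>\<^esub> (x + f)) ` filt_mod (i - 1)"
proof -
  have "{x. x - f \<in> filt_mod (i - 1)} = (\<lambda>x. x + f) ` filt_mod (i - 1)"
    by (auto simp: image_iff intro!: bexI[of _ "x - f" for x])
  then show ?thesis by (simp add: gr_class_def image_image)
qed

lemma filt_R_eq_image: "filt_R I i = (\<lambda>x. I +>\<^bsub>\<P>\<^esub> x) ` filt_mod i"
  by (simp add: filt_R_eq img_quot_def)

lemma filt_R_coset: "filt_R I (i - 1) +>\<^bsub>R\<^esub> (I +>\<^bsub>\<P>\<^esub> f) = gr_class i f"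
proof -
  interpret h: surjective_ring_hom "\<lambda>x. I +>\<^bsub>\<P>\<^esub> x" R by (rule coset_hom)
  show ?thesis
    unfolding gr_class_alt filt_R_eq_image a_r_coset_def'[of R] by (auto simp: h.hom_add)
qed

lemma carrier_gr: "carrier (gr i) = gr_class i ` filt_mod i"
proof -
  interpret h: surjective_ring_hom "\<lambda>x. I +>\<^bsub>\<P>\<^esub> x" R by (rule coset_hom)
  have "r_coset ((add_monoid R)\<lparr>carrier := filt_R I i\<rparr>) (filt_R I (i - 1)) (I +>\<^bsub>\<P>\<^esub> f) = gr_class i f" for f
    unfolding gr_class_alt filt_R_eq_image by (auto simp: r_coset_def h.hom_add)
  then show ?thesis
    by (auto simp: gr_component_def carrier_FactGroup filt_R_eq_image[of i] image_image)
qed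

lemma one_gr: "\<one>\<^bsub>gr i\<^esub> = gr_class i 0"
  unfolding gr_class_alt by (simp add: gr_component_def filt_R_eq_image)

lemma mult_gr: "gr_class i f \<otimes>\<^bsub>gr i\<^esub> gr_class i g = gr_class i (f + g)"
proof -
  interpret h: surjective_ring_hom "\<lambda>x. I +>\<^bsub>\<P>\<^esub> x" R by (rule coset_hom)
  have "gr_class i f \<otimes>\<^bsub>gr i\<^esub> gr_class i g = (\<Union>a\<in>gr_class i f. \<Union>b\<in>gr_class i g. {a \<oplus>\<^bsub>R\<^esub> b})"
    by (simp add: gr_component_def set_mult_def)
  also have "\<dots> = gr_class i (f + g)"
  proof
    have "(I +>\<^bsub>\<P>\<^esub> x) \<oplus>\<^bsub>R\<^esub> (I +>\<^bsub>\<P>\<^esub> y) \<in> gr_class i (f + g)"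
      if "x - f \<in> filt_mod (i - 1)" "y - g \<in> filt_mod (i - 1)" for x y
      unfolding h.hom_add[symmetric] coset_mem_gr_class_iff
      using filt_mod_add[OF that] by (simp add: algebra_simps)
    then show "(\<Union>a\<in>gr_class i f. \<Union>b\<in>gr_class i g. {a \<oplus>\<^bsub>R\<^esub> b}) \<subseteq> gr_class i (f + g)"
      by (auto simp: gr_class_def[of i f] gr_class_def[of i g])
    show "gr_class i (f + g) \<subseteq> (\<Union>a\<in>gr_class i f. \<Union>b\<in>gr_class i g. {a \<oplus>\<^bsub>R\<^esub> b})"
    proof
      fix z assume "z \<in> gr_class i (f + g)"
      then obtain x where x: "x - (f + g) \<in> filt_mod (i - 1)" "z = I +>\<^bsub>\<P>\<^esub> x" by (auto simp: gr_class_def)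
      have "z = (I +>\<^bsub>\<P>\<^esub> f) \<oplus>\<^bsub>R\<^esub> (I +>\<^bsub>\<P>\<^esub> (x - f))" using h.hom_add[of f "x - f"] x(2) by simp
      moreover have "I +>\<^bsub>\<P>\<^esub> f \<in> gr_class i f" "I +>\<^bsub>\<P>\<^esub> (x - f) \<in> gr_class i g"
        using x(1) mvp.subspace_0[OF filt_mod_subspace] by (simp_all add: coset_mem_gr_class_iff diff_diff_add)
      ultimately show "z \<in> (\<Union>a\<in>gr_class i f. \<Union>b\<in>gr_class i g. {a \<oplus>\<^bsub>R\<^esub> b})" by blast
    qed
  qed
  finally show ?thesis .
qed

lemma comm_group_gr: "comm_group (gr i)"
proof (rule comm_groupI)
  fix a assume "a \<in> carrier (gr i)"
  then obtain f where f: "f \<in> filt_mod i" "a = gr_class i f" by (auto simp: carrier_gr)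
  then have "gr_class i (- f) \<otimes>\<^bsub>gr i\<^esub> a = \<one>\<^bsub>gr i\<^esub>" "gr_class i (- f) \<in> carrier (gr i)"
    using mvp.subspace_neg[OF filt_mod_subspace f(1)] by (auto simp: mult_gr one_gr carrier_gr)
  then show "\<exists>b\<in>carrier (gr i). b \<otimes>\<^bsub>gr i\<^esub> a = \<one>\<^bsub>gr i\<^esub>" by blast
qed (auto simp: carrier_gr one_gr mult_gr ac_simps intro: filt_mod_add mvp.subspace_0[OF filt_mod_subspace])

lemma finprod_gr:
  assumes "finite S" "\<And>i. i \<in> S \<Longrightarrow> u i \<in> filt_mod k"
  shows "finprod (gr k) (\<lambda>i. gr_class k (u i)) S = gr_class k (\<Sum>i\<in>S. u i)"
  using assms
proof (induction S rule: finite_induct)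
  case empty
  interpret comm_group "gr k" by (rule comm_group_gr)
  show ?case by (simp add: one_gr)
next
  case (insert x S)
  interpret comm_group "gr k" by (rule comm_group_gr)
  have "finprod (gr k) (\<lambda>i. gr_class k (u i)) (insert x S) =
      gr_class k (u x) \<otimes>\<^bsub>gr k\<^esub> finprod (gr k) (\<lambda>i. gr_class k (u i)) S"
    using insert by (intro finprod_insert) (auto simp: carrier_gr)
  then show ?case using insert by (simp add: mult_gr)
qed

text \<open>Independence of representatives is x y - f g = x (y - g) + (x - f) g, where both terms
  drop one degree.\<close>

lemma rcoset_mult_gr_class:
  assumes f: "f \<in> filt_mod i" and g: "g \<in> filt_mod j"
  shows "rcoset_mult R (filt_R I (i + j - 1)) (gr_class i f) (gr_class j g) = gr_class (i + j) (f * g)"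
proof -
  interpret h: surjective_ring_hom "\<lambda>x. I +>\<^bsub>\<P>\<^esub> x" R by (rule coset_hom)
  have *: "filt_R I (i + j - 1) +>\<^bsub>R\<^esub> ((I +>\<^bsub>\<P>\<^esub> x) \<otimes>\<^bsub>R\<^esub> (I +>\<^bsub>\<P>\<^esub> y)) = gr_class (i + j) (f * g)"
    if x: "x - f \<in> filt_mod (i - 1)" and y: "y - g \<in> filt_mod (j - 1)" for x y
  proof -
    have "x - f \<in> filt_mod i" using x filt_mod_mono[of "i - 1" i] by auto
    then have "x \<in> filt_mod i" using f filt_mod_cong by blast
    then have "x * (y - g) \<in> filt_mod (i + j - 1)" using filt_mod_mult[OF _ y, of x i] by (simp add: add_diff_eq)
    moreover have "(x - f) * g \<in> filt_mod (i + j - 1)" using filt_mod_mult[OF x g] by (simp add: algebra_simps)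
    ultimately have "x * (y - g) + (x - f) * g \<in> filt_mod (i + j - 1)" by (rule filt_mod_add)
    then have "gr_class (i + j) (x * y) = gr_class (i + j) (f * g)" by (simp add: gr_class_eq_iff algebra_simps)
    then show ?thesis using filt_R_coset[of "i + j" "x * y"] by (simp add: h.hom_mult)
  qed
  have ne: "gr_class i f \<noteq> {}" "gr_class j g \<noteq> {}"
    using coset_mem_gr_class_iff[of f i f] coset_mem_gr_class_iff[of g j g] mvp.subspace_0[OF filt_mod_subspace] by auto
  have "rcoset_mult R (filt_R I (i + j - 1)) (gr_class i f) (gr_class j g) =
      (\<Union>a\<in>gr_class i f. \<Union>b\<in>gr_class j g. gr_class (i + j) (f * g))"
    unfolding rcoset_mult_def by (intro SUP_cong refl) (auto simp: gr_class_def[of i f] gr_class_def[of j g] *)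
  then show ?thesis using ne by simp
qed

text \<open>The surjection from P behind the isomorphism of gr(R) with P/DF(I). Taking all
  homogeneous components, and not only the leading one, makes it a ring homomorphism.\<close>

definition to_gr :: "('n, 'k) mvpoly \<Rightarrow> int \<Rightarrow> ('n, 'k) mvpoly set set" where
  "to_gr f = (\<lambda>i. gr_class i (hcomp i f))"

lemma hcomp_in_filt_mod: "hcomp i f \<in> filt_mod i"
  using hcomp_in_filt_P filt_P_subset_filt_mod by blast

lemma carrier_gr_ring: "carrier (gr_ring R (filt_R I)) = range to_gr"
proof -
  have "group (gr i)" for i using comm_group_gr by (simp add: comm_group_def)
  then have carr: "carrier (gr_ring R (filt_R I)) =
      {x. (\<forall>i. x i \<in> gr_class i ` filt_mod i) \<and> finite {i. x i \<noteq> gr_class i 0}}"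
    by (simp add: gr_ring_def carrier_sum_group one_gr carrier_gr PiE_UNIV_domain Pi_def)
  show ?thesis
    unfolding carr
  proof (intro subset_antisym subsetI)
    fix x assume "x \<in> range to_gr"
    then obtain f where f: "x = to_gr f" by blast
    have "{i. x i \<noteq> gr_class i 0} \<subseteq> {i. hcomp i f \<noteq> 0}" by (auto simp: f to_gr_def)
    then show "x \<in> {x. (\<forall>i. x i \<in> gr_class i ` filt_mod i) \<and> finite {i. x i \<noteq> gr_class i 0}}"
      using finite_subset finite_hcomp f hcomp_in_filt_mod by (fastforce simp: to_gr_def)
  next
    fix x assume x: "x \<in> {x. (\<forall>i. x i \<in> gr_class i ` filt_mod i) \<and> finite {i. x i \<noteq> gr_class i 0}}"
    define T where "T = {i. x i \<noteq> gr_class i 0}"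
    have T: "finite T" using x by (simp add: T_def)
    have "\<exists>f. x i = gr_class i f \<and> f \<in> filt_P i \<and> (i \<notin> T \<longrightarrow> f = 0)" for i
    proof (cases "i \<in> T")
      case True
      obtain f where f: "f \<in> filt_mod i" "x i = gr_class i f" using x by auto
      then obtain f' where "f' \<in> filt_P i" "f - f' \<in> I" by (auto simp: filt_mod_def)
      then show ?thesis using f True I_subset_filt_mod[of "i - 1"] by (auto simp: gr_class_eq_iff)
    next
      case False
      then show ?thesis by (auto simp: T_def filt_P_def)
    qed
    then obtain u where u: "\<And>i. x i = gr_class i (u i)" "\<And>i. u i \<in> filt_P i" "\<And>i. i \<notin> T \<Longrightarrow> u i = 0" by metis
    have "hcomp j (\<Sum>i\<in>T. hcomp i (u i)) = hcomp j (u j)" for j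
    proof -
      have "hcomp j (\<Sum>i\<in>T. hcomp i (u i)) = (\<Sum>i\<in>T. if i = j then hcomp j (u j) else 0)"
        unfolding hcomp_sum by (intro sum.cong) auto
      then show ?thesis using T u(3)[of j] by auto
    qed
    \<comment> \<open>Lower terms of a representative in \<open>filt_P j\<close> do not affect its
      class, so homogeneous representatives suffice and can be added up to one polynomial.\<close>
    moreover have "gr_class j (hcomp j (u j)) = gr_class j (u j)" for j
      using diff_hcomp_in_filt_P[OF u(2), of j] filt_P_subset_filt_mod[of "j - 1"] gr_class_eq_iff[of j "u j" "hcomp j (u j)"] by auto
    ultimately have "x = to_gr (\<Sum>i\<in>T. hcomp i (u i))" by (simp add: to_gr_def u(1) fun_eq_iff)
    then show "x \<in> range to_gr" by blast
  qed
qed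

lemma to_gr_mult: "to_gr (f * g) = to_gr f \<otimes>\<^bsub>gr_ring R (filt_R I)\<^esub> to_gr g"
proof
  fix k
  let ?S = "{i. to_gr f i \<noteq> \<one>\<^bsub>gr i\<^esub> \<and> to_gr g (k - i) \<noteq> \<one>\<^bsub>gr (k - i)\<^esub>}"
  \<comment> \<open>The product in \<open>gr_ring\<close> sums over \<open>?S\<close>, where both
    classes are non-zero; the polynomial product runs over the possibly larger \<open>?T\<close>.
    The extra terms fall into F_{k-1}.\<close>
  let ?T = "{i. hcomp i f \<noteq> 0}"
  have sub: "?S \<subseteq> ?T" by (auto simp: to_gr_def one_gr)
  have fin: "finite ?S" using sub finite_hcomp by (rule finite_subset)
  have prod: "rcoset_mult R (filt_R I (k - 1)) (to_gr f i) (to_gr g (k - i)) =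
      gr_class k (hcomp i f * hcomp (k - i) g)" for i
    using rcoset_mult_gr_class[OF hcomp_in_filt_mod[of i f] hcomp_in_filt_mod[of "k - i" g]] by (simp add: to_gr_def)
  have mem: "hcomp i f * hcomp (k - i) g \<in> filt_mod k" for i
    using filt_mod_mult[OF hcomp_in_filt_mod[of i f] hcomp_in_filt_mod[of "k - i" g]] by simp
  have "(to_gr f \<otimes>\<^bsub>gr_ring R (filt_R I)\<^esub> to_gr g) k =
      finprod (gr k) (\<lambda>i. gr_class k (hcomp i f * hcomp (k - i) g)) ?S"
    by (simp add: gr_ring_def prod)
  also have "\<dots> = gr_class k (\<Sum>i\<in>?S. hcomp i f * hcomp (k - i) g)"
    by (rule finprod_gr[OF fin mem])
  also have "\<dots> = gr_class k (\<Sum>i\<in>?T. hcomp i f * hcomp (k - i) g)"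
  proof -
    have "hcomp i f * hcomp (k - i) g \<in> filt_mod (k - 1)" if "i \<in> ?T - ?S" for i
    proof -
      have "hcomp i f \<in> filt_mod (i - 1) \<or> hcomp (k - i) g \<in> filt_mod (k - i - 1)"
        using that by (auto simp: to_gr_def one_gr gr_class_eq_iff)
      then show ?thesis
      proof
        assume "hcomp i f \<in> filt_mod (i - 1)"
        from filt_mod_mult[OF this hcomp_in_filt_mod[of "k - i" g]] show ?thesis by simp
      next
        assume "hcomp (k - i) g \<in> filt_mod (k - i - 1)"
        from filt_mod_mult[OF hcomp_in_filt_mod[of i f] this] show ?thesis by simp
      qed
    qed
    then have "(\<Sum>i\<in>?T - ?S. hcomp i f * hcomp (k - i) g) \<in> filt_mod (k - 1)"
      by (intro mvp.subspace_sum[OF filt_mod_subspace])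
    then have "gr_class k (\<Sum>i\<in>?T. hcomp i f * hcomp (k - i) g) = gr_class k (\<Sum>i\<in>?S. hcomp i f * hcomp (k - i) g)"
      unfolding gr_class_eq_iff sum_diff[OF finite_hcomp sub] .
    then show ?thesis by (rule sym)
  qed
  also have "\<dots> = to_gr (f * g) k"
    unfolding to_gr_def by (subst hcomp_mult[OF finite_hcomp, of f]) auto
  finally show "to_gr (f * g) k = (to_gr f \<otimes>\<^bsub>gr_ring R (filt_R I)\<^esub> to_gr g) k" ..
qed

lemma surjective_ring_hom_to_gr: "surjective_ring_hom to_gr (gr_ring R (filt_R I))"
proof
  show "to_gr (f + g) = to_gr f \<oplus>\<^bsub>gr_ring R (filt_R I)\<^esub> to_gr g" for f g
    by (simp add: gr_ring_def to_gr_def mult_gr restrict_UNIV)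
  show "to_gr 0 = \<zero>\<^bsub>gr_ring R (filt_R I)\<^esub>"
    by (simp add: gr_ring_def to_gr_def one_gr restrict_UNIV)
  show "to_gr 1 = \<one>\<^bsub>gr_ring R (filt_R I)\<^esub>"
  proof -
    have "\<one>\<^bsub>R\<^esub> = I +>\<^bsub>\<P>\<^esub> 1" using surjective_ring_hom.hom_one[OF coset_hom] by simp
    then show ?thesis
      using filt_R_coset[of 0 1] by (intro ext) (simp add: gr_ring_def to_gr_def hcomp_1 one_gr)
  qed
qed (rule carrier_gr_ring, rule to_gr_mult)

text \<open>This is DF(I): a homogeneous polynomial of degree i lies in F_{i-1} P + I iff it is 0 or
  the degree form of an element of I.\<close>

definition lead_ideal :: "('n, 'k) mvpoly set" where
  "lead_ideal = {f. \<forall>i. hcomp i f \<in> filt_mod (i - 1)}"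

lemma ker_to_gr: "surjective_ring_hom.ker to_gr (gr_ring R (filt_R I)) = lead_ideal"
proof -
  have "to_gr f = to_gr 0 \<longleftrightarrow> f \<in> lead_ideal" for f
    by (simp add: to_gr_def fun_eq_iff lead_ideal_def gr_class_eq_iff)
  then show ?thesis
    unfolding surjective_ring_hom.ker_def[OF surjective_ring_hom_to_gr]
      surjective_ring_hom.hom_zero[OF surjective_ring_hom_to_gr, symmetric] by simp
qed

end

section \<open>Strict Gorenstein rings and perfect pairings\<close>

definition irrelevant_ideal :: "('n::finite, 'k::field) mvpoly set" where
  "irrelevant_ideal = {f. Poly_Mapping.lookup f 0 = 0}"

lemma hcomp_0_eq: "hcomp 0 f = const_poly (Poly_Mapping.lookup f 0)"
  by (auto intro!: poly_mapping_eqI simp: lookup_hcomp const_poly_def lookup_single when_def)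

lemma const_poly_eq_0_iff: "const_poly c = 0 \<longleftrightarrow> c = 0"
  by (metis const_poly_def const_poly_simps(1) lookup_single_eq lookup_zero)

text \<open>Lowest degrees add: in each product of components one of the two factors lies below its
  bound.\<close>

lemma hcomp_mult_eq_0:
  assumes "\<And>i. i < a \<Longrightarrow> hcomp i f = 0" "\<And>i. i < b \<Longrightarrow> hcomp i g = 0" "k < a + b"
  shows "hcomp k (f * g) = 0"
proof -
  have "hcomp i f * hcomp (k - i) g = 0" for i
    using assms(1)[of i] assms(2)[of "k - i"] assms(3) by (cases "i < a") auto
  moreover have "hcomp k (f * g) = (\<Sum>i\<in>{i. hcomp i f \<noteq> 0}. hcomp i f * hcomp (k - i) g)"
    by (rule hcomp_mult[OF finite_hcomp]) simp
  ultimately show ?thesis by simp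
qed

lemma mem_irrelevant_ideal_iff: "f \<in> irrelevant_ideal \<longleftrightarrow> (\<forall>i<1. hcomp i f = 0)"
proof -
  have "f \<in> irrelevant_ideal \<longleftrightarrow> hcomp 0 f = 0"
    by (simp add: irrelevant_ideal_def hcomp_0_eq const_poly_eq_0_iff)
  moreover have "hcomp i f = 0" if "i < 1" "i \<noteq> 0" for i using that by (intro hcomp_neg) auto
  ultimately show ?thesis by force
qed

lemma is_max_ideal_irrelevant: "is_max_ideal (irrelevant_ideal :: ('n::finite, 'k::field) mvpoly set)"
  unfolding is_max_ideal_def
proof (intro conjI allI impI)
  let ?M = "irrelevant_ideal :: ('n, 'k) mvpoly set"
  show "is_ideal ?M"
    unfolding is_ideal_def
  proof (intro conjI ballI allI)
    show "c * a \<in> ?M" if "a \<in> ?M" for a c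
      using that hcomp_mult_eq_0[of 0 c 1 a] hcomp_neg unfolding mem_irrelevant_ideal_iff by auto
  qed (auto simp: irrelevant_ideal_def lookup_add)
  show "1 \<notin> ?M" by (simp add: irrelevant_ideal_def lookup_one)
  fix a :: "('n, 'k) mvpoly" assume "a \<notin> ?M"
  then have "1 - const_poly (inverse (Poly_Mapping.lookup a 0)) * a \<in> ?M"
    by (simp add: irrelevant_ideal_def lookup_minus lookup_one)
  then show "\<exists>y. 1 - y * a \<in> ?M" by blast
qed

lemma irrelevant_ideal_power:
  assumes "f \<in> irrelevant_ideal" "i < int n"
  shows "hcomp i (f ^ n) = 0"
  using assms(2)
proof (induction n arbitrary: i)
  case 0
  then show ?case by (simp add: hcomp_neg)
next
  case (Suc n)
  have "hcomp i (f * f ^ n) = 0"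
    using Suc.prems by (intro hcomp_mult_eq_0[of 1 f "int n"] Suc.IH)
      (use assms(1) in \<open>auto simp: mem_irrelevant_ideal_iff\<close>)
  then show ?case by simp
qed

context zero_dim_algebra
begin

abbreviation "M0 \<equiv> (irrelevant_ideal :: ('n, 'k) mvpoly set)"

lemma is_ideal_lead: "is_ideal lead_ideal"
  using surjective_ring_hom.is_ideal_ker[OF surjective_ring_hom_to_gr] ker_to_gr by simp

lemma const_in_I: "const_poly c \<in> I \<Longrightarrow> c = 0"
proof (rule ccontr)
  assume "const_poly c \<in> I" "c \<noteq> 0"
  then have "const_poly (inverse c) * const_poly c \<in> I" by (intro is_ideal_mult_left[OF ideal_I])
  moreover have "const_poly (inverse c) * const_poly c = 1"
    using \<open>c \<noteq> 0\<close> by (simp add: const_poly_simps(2) flip: const_poly_simps(4))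
  ultimately show False using one_notin_I by metis
qed

lemma lead_subset_M0: "lead_ideal \<subseteq> M0"
proof
  fix f assume "f \<in> lead_ideal"
  then have "hcomp 0 f \<in> filt_mod (0 - 1)" unfolding lead_ideal_def by blast
  then have "const_poly (Poly_Mapping.lookup f 0) \<in> I" by (simp add: filt_mod_neg hcomp_0_eq)
  then show "f \<in> M0" using const_in_I by (simp add: irrelevant_ideal_def)
qed

lemma prime_over_lead:
  assumes p: "is_prime_ideal p" "lead_ideal \<subseteq> p"
  shows "p = M0"
proof (rule is_max_ideal_unique[OF is_max_ideal_irrelevant])
  show "is_ideal p" "1 \<notin> p" using p by (auto simp: is_prime_ideal_def)
  show "M0 \<subseteq> p"
  proof
    fix f assume f: "f \<in> M0"
    \<comment> \<open>The exponent r + 1 is chosen so that the power has no components up to degree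
      r, while from degree r + 1 on F_{i-1} is everything. Hence \<open>M0\<close> is nilpotent
      modulo \<open>lead_ideal\<close>.\<close>
    have "hcomp i (f ^ Suc (nat ri)) \<in> filt_mod (i - 1)" for i
    proof (cases "i < int (Suc (nat ri))")
      case True
      then show ?thesis using irrelevant_ideal_power[OF f True] mvp.subspace_0[OF filt_mod_subspace] by simp
    next
      case False
      then have "ri \<le> i - 1" by linarith
      then show ?thesis using filt_mod_eq_UNIV_iff by blast
    qed
    then have "f ^ Suc (nat ri) \<in> p" using p(2) by (auto simp: lead_ideal_def)
    then show "f \<in> p" by (rule is_prime_ideal_power[OF p(1)])
  qed
qed

lemma strict_gorenstein_iff:
  "strict_gorenstein I \<longleftrightarrow>
    (\<exists>s. s \<notin> lead_ideal \<and> (\<forall>m\<in>M0. s * m \<in> lead_ideal) \<and>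
      (\<forall>t. (\<forall>m\<in>M0. t * m \<in> lead_ideal) \<longrightarrow> (\<exists>x. t - x * s \<in> lead_ideal)))"
  unfolding strict_gorenstein_def
  using surjective_ring_hom.gorenstein_local_ring_iff[OF surjective_ring_hom_to_gr is_max_ideal_irrelevant]
    lead_subset_M0 prime_over_lead by (simp only: ker_to_gr)

text \<open>Both sides of the equivalence amount to the perfectness of the pairings
  \<open>G\<^sub>i \<times> G\<^sub>r\<^sub>-\<^sub>i \<rightarrow> G\<^sub>r\<close> of the graded pieces of the associated graded ring, with \<open>G\<^sub>r\<close> of dimension one.\<close>

definition top_one_dim :: bool where
  "top_one_dim \<longleftrightarrow> (\<exists>h. h \<notin> filt_mod (ri - 1) \<and> (\<forall>f. \<exists>c. f - const_poly c * h \<in> filt_mod (ri - 1)))"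

text \<open>One-sided non-degeneracy suffices as i runs through all degrees and multiplication
  commutes. Representatives need not be homogeneous, because lower terms change f g only within
  F_{r-1}.\<close>

definition graded_pairing_nondegenerate :: bool where
  "graded_pairing_nondegenerate \<longleftrightarrow>
    (\<forall>i. \<forall>f\<in>filt_P i. f \<notin> filt_mod (i - 1) \<longrightarrow> (\<exists>g\<in>filt_P (ri - i). f * g \<notin> filt_mod (ri - 1)))"

lemma homogeneous_mem_lead_iff:
  assumes "hcomp i f = f"
  shows "f \<in> lead_ideal \<longleftrightarrow> f \<in> filt_mod (i - 1)"
proof -
  have "hcomp j f = (if j = i then f else 0)" for j
    using assms hcomp_simps(5)[of j i f] by auto
  then show ?thesis
    using mvp.subspace_0[OF filt_mod_subspace] by (auto simp: lead_ideal_def)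
qed

text \<open>F_r R is all of R, so f has a representative of degree at most r, whose component of
  degree r is taken.\<close>

lemma top_representative: "\<exists>f'. hcomp ri f' = f' \<and> f - f' \<in> filt_mod (ri - 1)"
proof -
  have "f \<in> filt_mod ri" using filt_mod_eq_UNIV_iff[of ri] by auto
  then obtain f1 where f1: "f1 \<in> filt_P ri" "f - f1 \<in> I" by (auto simp: filt_mod_def)
  have "(f - f1) + (f1 - hcomp ri f1) \<in> filt_mod (ri - 1)"
    using diff_hcomp_in_filt_P[OF f1(1)] filt_P_subset_filt_mod[of "ri - 1"] I_subset_filt_mod[of "ri - 1"] f1(2)
    by (intro filt_mod_add) blast+
  then show ?thesis by (intro exI[of _ "hcomp ri f1"]) simp
qed

text \<open>A product of h with an element of \<open>M0\<close> has components in degrees above r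
  only, where G vanishes.\<close>

lemma top_in_socle:
  assumes h: "hcomp ri h = h" and m: "m \<in> M0"
  shows "h * m \<in> lead_ideal"
  unfolding lead_ideal_def
proof (intro CollectI allI)
  fix j
  show "hcomp j (h * m) \<in> filt_mod (j - 1)"
  proof (cases "ri \<le> j - 1")
    case True
    then show ?thesis using filt_mod_eq_UNIV_iff by blast
  next
    case False
    then have "hcomp j (h * m) = 0"
      using m unfolding hcomp_mult_homogeneous[OF h] mem_irrelevant_ideal_iff by auto
    then show ?thesis using mvp.subspace_0[OF filt_mod_subspace] by simp
  qed
qed

lemma strict_gorenstein_if_pairing:
  assumes top: top_one_dim and pair: graded_pairing_nondegenerate
  shows "strict_gorenstein I"
proof -
  obtain h0 where h0: "h0 \<notin> filt_mod (ri - 1)" "\<And>f. \<exists>c. f - const_poly c * h0 \<in> filt_mod (ri - 1)"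
    using top unfolding top_one_dim_def by blast
  obtain h where h: "hcomp ri h = h" "h0 - h \<in> filt_mod (ri - 1)" using top_representative by blast
  have h1: "h \<notin> filt_mod (ri - 1)" using h h0(1) filt_mod_cong by blast
  have h2: "\<exists>c. f - const_poly c * h \<in> filt_mod (ri - 1)" for f
  proof -
    obtain c where "f - const_poly c * h0 \<in> filt_mod (ri - 1)" using h0(2) by blast
    then have "(f - const_poly c * h0) + const_poly c * (h0 - h) \<in> filt_mod (ri - 1)"
      using filt_mod_scale[OF h(2), of c] by (intro filt_mod_add)
    then show ?thesis by (auto simp: algebra_simps)
  qed
  have "\<exists>x. t - x * h \<in> lead_ideal" if t: "\<forall>m\<in>M0. t * m \<in> lead_ideal" for t
  proof -
    obtain c where c: "hcomp ri t - const_poly c * h \<in> filt_mod (ri - 1)" using h2 by blast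
    have "hcomp j (t - const_poly c * h) \<in> filt_mod (j - 1)" for j
    proof (cases "j < ri")
      case True
      have "hcomp j t \<in> filt_mod (j - 1)"
      proof (rule ccontr)
        assume "hcomp j t \<notin> filt_mod (j - 1)"
        then obtain g where g: "g \<in> filt_P (ri - j)" "hcomp j t * g \<notin> filt_mod (ri - 1)"
          using pair hcomp_in_filt_P unfolding graded_pairing_nondegenerate_def by blast
        \<comment> \<open>Only the leading part of g matters for the pairing; its degree is positive
          as j < r, so it lies in \<open>M0\<close> and must kill t in G.\<close>
        let ?g = "hcomp (ri - j) g"
        have "?g \<in> M0" using True by (auto simp: mem_irrelevant_ideal_iff)
        then have "t * ?g \<in> lead_ideal" using t by blast
        then have "hcomp ri (?g * t) \<in> filt_mod (ri - 1)" by (subst mult.commute) (simp add: lead_ideal_def)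
        then have 1: "hcomp j t * ?g \<in> filt_mod (ri - 1)"
          by (subst (asm) hcomp_mult_homogeneous[of "ri - j"]) (simp_all add: mult.commute)
        have "hcomp j t * (g - ?g) \<in> filt_mod (ri - 1)"
          using filt_P_mult[OF hcomp_in_filt_P[of j t] diff_hcomp_in_filt_P[OF g(1)]]
            filt_P_subset_filt_mod[of "ri - 1"] by auto
        then have "hcomp j t * (g - ?g) + hcomp j t * ?g \<in> filt_mod (ri - 1)" using 1 by (rule filt_mod_add)
        then show False using g(2) by (simp add: algebra_simps)
      qed
      moreover have "hcomp j h = 0" using hcomp_simps(5)[of j ri h] h(1) True by auto
      ultimately show ?thesis by simp
    next
      case False
      \<comment> \<open>In degree r this is the choice of c; above r the filtration is
        everything.\<close>
      then show ?thesis using c h(1) filt_mod_eq_UNIV_iff[of "j - 1"] by (cases "j = ri") auto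
    qed
    then have "t - const_poly c * h \<in> lead_ideal" unfolding lead_ideal_def by blast
    then show ?thesis by blast
  qed
  then show ?thesis
    unfolding strict_gorenstein_iff
    using top_in_socle[OF h(1)] homogeneous_mem_lead_iff[OF h(1)] h1 by blast
qed

lemma pairing_if_strict_gorenstein:
  assumes "strict_gorenstein I"
  shows top_one_dim graded_pairing_nondegenerate
proof -
  let ?D = lead_ideal
  obtain s where s: "s \<notin> ?D" "\<And>m. m \<in> M0 \<Longrightarrow> s * m \<in> ?D"
    "\<And>t. (\<forall>m\<in>M0. t * m \<in> ?D) \<Longrightarrow> \<exists>x. t - x * s \<in> ?D"
    using assms unfolding strict_gorenstein_iff by blast
  \<comment> \<open>The multiplier x may be replaced by its constant term, because \<open>M0\<close>
    kills s in G.\<close>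
  have soc0: "\<exists>c. t - const_poly c * s \<in> ?D" if t: "\<forall>m\<in>M0. t * m \<in> ?D" for t
  proof -
    obtain x where x: "t - x * s \<in> ?D" using s(3) t by blast
    let ?c = "const_poly (Poly_Mapping.lookup x 0)"
    have "x - ?c \<in> M0" by (simp add: irrelevant_ideal_def lookup_minus const_poly_def)
    then have "(t - x * s) + s * (x - ?c) \<in> ?D" using is_ideal_add[OF is_ideal_lead x] s(2) by blast
    then have "t - ?c * s \<in> ?D" by (simp add: algebra_simps)
    then show ?thesis by blast
  qed
  have "filt_mod (ri - 1) \<noteq> UNIV" using filt_mod_eq_UNIV_iff by simp
  then obtain h0 where "h0 \<notin> filt_mod (ri - 1)" by blast
  moreover obtain h where h: "hcomp ri h = h" "h0 - h \<in> filt_mod (ri - 1)" using top_representative by blast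
  ultimately have h1: "h \<notin> filt_mod (ri - 1)" using filt_mod_cong by blast
  then have hD: "h \<notin> ?D" using homogeneous_mem_lead_iff[OF h(1)] by simp
  \<comment> \<open>The socle generator s need not be homogeneous. It is exchanged for h, which is
    non-zero of degree r and hence a non-zero scalar multiple of s in G.\<close>
  obtain c where c: "h - const_poly c * s \<in> ?D" using soc0 top_in_socle[OF h(1)] by blast
  have c0: "c \<noteq> 0" using c hD by (auto simp: const_poly_simps)
  have soc: "\<exists>e. t - const_poly e * h \<in> ?D" if t: "\<forall>m\<in>M0. t * m \<in> ?D" for t
  proof -
    obtain c' where c': "t - const_poly c' * s \<in> ?D" using soc0[OF t] by blast
    have "(t - const_poly c' * s) - const_poly (c' / c) * (h - const_poly c * s) \<in> ?D"
      by (rule is_ideal_diff[OF is_ideal_lead c' is_ideal_mult_left[OF is_ideal_lead c]])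
    moreover have "const_poly (c' / c) * (const_poly c * s) = const_poly c' * s"
      using c0 by (simp add: mult.assoc[symmetric] const_poly_simps(4)[symmetric])
    ultimately show ?thesis by (auto simp: right_diff_distrib)
  qed
  show top_one_dim
    unfolding top_one_dim_def
  proof (rule exI[of _ h], intro conjI allI)
    show "h \<notin> filt_mod (ri - 1)" by fact
    fix f
    obtain f' where f': "hcomp ri f' = f'" "f - f' \<in> filt_mod (ri - 1)" using top_representative by blast
    obtain e where e: "f' - const_poly e * h \<in> ?D" using soc top_in_socle[OF f'(1)] by blast
    have "hcomp ri (f' - const_poly e * h) = f' - const_poly e * h" by (simp add: f'(1) h(1))
    then have "f' - const_poly e * h \<in> filt_mod (ri - 1)" using e homogeneous_mem_lead_iff by blast
    with f'(2) have "(f - f') + (f' - const_poly e * h) \<in> filt_mod (ri - 1)" by (rule filt_mod_add)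
    then show "\<exists>c. f - const_poly c * h \<in> filt_mod (ri - 1)" by auto
  qed
  show graded_pairing_nondegenerate
    unfolding graded_pairing_nondegenerate_def
  proof (intro allI ballI impI)
    fix i f assume f: "f \<in> filt_P i" "f \<notin> filt_mod (i - 1)"
    define f0 where "f0 = hcomp i f"
    have f0h: "hcomp i f0 = f0" by (simp add: f0_def)
    have ff0: "f - f0 \<in> filt_P (i - 1)" using diff_hcomp_in_filt_P[OF f(1)] by (simp add: f0_def)
    then have f0: "f0 \<notin> filt_mod (i - 1)" using f(2) filt_mod_cong filt_P_subset_filt_mod by blast
    \<comment> \<open>Degrees of homogeneous multipliers that do not kill f0 in G; they are bounded
      since G vanishes above degree r.\<close>
    let ?P = "\<lambda>j::nat. \<exists>g. hcomp (int j) g = g \<and> f0 * g \<notin> ?D"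
    have hom: "hcomp (i + int j) (f0 * g) = f0 * g" if "hcomp (int j) g = g" for j g
      using hcomp_mult_homogeneous[OF f0h, of "i + int j" g] that by simp
    have P0: "?P 0" using f0 homogeneous_mem_lead_iff[OF f0h] by (intro exI[of _ 1]) (simp add: hcomp_1)
    have bound: "i + int j \<le> ri" if P: "?P j" for j
    proof -
      obtain g where "hcomp (int j) g = g" "f0 * g \<notin> ?D" using P by blast
      then have "f0 * g \<notin> filt_mod (i + int j - 1)" using hom homogeneous_mem_lead_iff by blast
      then have "\<not> ri \<le> i + int j - 1" using filt_mod_eq_UNIV_iff by blast
      then show ?thesis by simp
    qed
    have "0 \<le> i"
    proof (rule ccontr)
      assume "\<not> 0 \<le> i"
      then show False using f0 hcomp_neg[of i f] mvp.subspace_0[OF filt_mod_subspace] by (simp add: f0_def)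
    qed
    have "\<forall>j. ?P j \<longrightarrow> j < Suc (nat ri)"
    proof (intro allI impI)
      fix j assume "?P j"
      from bound[OF this] \<open>0 \<le> i\<close> show "j < Suc (nat ri)" by linarith
    qed
    from ex_has_greatest_nat[of ?P 0 "\<lambda>j. j", OF P0 this]
    obtain j where "?P j \<and> (\<forall>k. ?P k \<longrightarrow> k \<le> j)" by (rule exE)
    then have j: "?P j" "\<And>k. ?P k \<Longrightarrow> k \<le> j" by (rule conjunct1, elim conjE allE impE)
    then obtain g where g: "hcomp (int j) g = g" "f0 * g \<notin> ?D" by blast
    \<comment> \<open>Every component of m has positive degree and would give a multiplier of degree
      above the maximal j.\<close>
    have "f0 * g * m \<in> ?D" if m: "m \<in> M0" for m
    proof -
      have "f0 * g * hcomp k m \<in> ?D" for k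
      proof (cases "k < 1")
        case True
        then show ?thesis using m is_ideal_0[OF is_ideal_lead] by (auto simp: mem_irrelevant_ideal_iff)
      next
        case False
        then have k: "int j + k = int (j + nat k)" by simp
        have "hcomp (int j + k) (g * hcomp k m) = g * hcomp k m"
          using hcomp_mult_homogeneous[OF g(1), of "int j + k" "hcomp k m"] by simp
        moreover have "\<not> ?P (j + nat k)" using j(2)[of "j + nat k"] False by auto
        ultimately show ?thesis unfolding k by (auto simp: mult.assoc)
      qed
      then have "(\<Sum>k\<in>{k. hcomp k m \<noteq> 0}. f0 * g * hcomp k m) \<in> ?D"
        by (intro is_ideal_sum[OF is_ideal_lead])
      moreover have "(\<Sum>k\<in>{k. hcomp k m \<noteq> 0}. hcomp k m) = m"
        by (rule sum_hcomp[OF finite_hcomp]) simp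
      ultimately show ?thesis by (simp add: sum_distrib_left[symmetric])
    qed
    then obtain e where e: "f0 * g - const_poly e * h \<in> ?D" using soc[of "f0 * g"] by blast
    have fg: "f0 * g \<notin> filt_mod (i + int j - 1)" using g hom homogeneous_mem_lead_iff by blast
    \<comment> \<open>The product f0 g is homogeneous and non-zero in G, yet a multiple of h; this
      is possible only in degree r.\<close>
    have eq: "i + int j = ri"
    proof (rule ccontr)
      assume ne: "i + int j \<noteq> ri"
      have "hcomp (i + int j) h = 0" using hcomp_simps(5)[of "i + int j" ri h] h(1) ne by auto
      then have "hcomp (i + int j) (f0 * g - const_poly e * h) = f0 * g" using hom[OF g(1)] by simp
      moreover have "hcomp (i + int j) (f0 * g - const_poly e * h) \<in> filt_mod (i + int j - 1)"
        using e unfolding lead_ideal_def by blast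
      ultimately show False using fg by (simp only:)
    qed
    have gP: "g \<in> filt_P (ri - i)" using hcomp_in_filt_P[of "int j" g] g(1) eq[symmetric] by simp
    have "(f - f0) * g \<in> filt_mod (ri - 1)"
      using filt_P_mult[OF ff0 gP] filt_P_subset_filt_mod[of "ri - 1"] by auto
    then have "f * g - f0 * g \<in> filt_mod (ri - 1)" by (simp add: left_diff_distrib)
    then have "f * g \<notin> filt_mod (ri - 1)" using fg eq filt_mod_cong by auto
    then show "\<exists>g\<in>filt_P (ri - i). f * g \<notin> filt_mod (ri - 1)" using gP by blast
  qed
qed

end

section \<open>Symmetric Hilbert functions and perfect pairings\<close>

lemma const_poly_diff: "const_poly (a - b) = const_poly a - const_poly b"
  by (simp add: const_poly_def single_diff)

context zero_dim_algebra
begin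

text \<open>The form \<phi> reads off the coefficient of h modulo F_{r-1}; uniqueness of this
  coefficient gives linearity and the kernel.\<close>

lemma top_functional:
  assumes top_one_dim
  obtains \<phi> where "Vector_Spaces.linear (\<lambda>c f. const_poly c * f) (*) \<phi>"
    "\<And>f. \<phi> f = 0 \<longleftrightarrow> f \<in> filt_mod (ri - 1)"
proof -
  let ?W = "filt_mod (ri - 1)"
  obtain h where h: "h \<notin> ?W" "\<And>f. \<exists>c. f - const_poly c * h \<in> ?W"
    using assms unfolding top_one_dim_def by blast
  obtain \<phi> where \<phi>: "\<And>f. f - const_poly (\<phi> f) * h \<in> ?W" using h(2) by metis
  have uniq: "c = \<phi> f" if "f - const_poly c * h \<in> ?W" for f c
  proof (rule ccontr)
    assume ne: "c \<noteq> \<phi> f"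
    have "(f - const_poly (\<phi> f) * h) - (f - const_poly c * h) \<in> ?W"
      by (rule filt_mod_diff[OF \<phi> that])
    then have "const_poly (c - \<phi> f) * h \<in> ?W"
      by (simp add: const_poly_diff algebra_simps)
    then have "const_poly (inverse (c - \<phi> f)) * (const_poly (c - \<phi> f) * h) \<in> ?W"
      by (rule filt_mod_scale)
    then have "const_poly (inverse (c - \<phi> f) * (c - \<phi> f)) * h \<in> ?W"
      by (simp only: const_poly_simps(4) mult.assoc)
    then show False using h(1) ne by (simp add: const_poly_simps(2))
  qed
  show ?thesis
  proof
    have vs: "vector_space ((*) :: 'k \<Rightarrow> 'k \<Rightarrow> 'k)"
      by unfold_locales (simp_all add: algebra_simps)
    have "\<phi> f + \<phi> g = \<phi> (f + g)" for f g
      using filt_mod_add[OF \<phi>[of f] \<phi>[of g]] by (intro uniq) (simp add: const_poly_simps algebra_simps)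
    moreover have "c * \<phi> f = \<phi> (const_poly c * f)" for c f
      using filt_mod_scale[OF \<phi>[of f], of c] by (intro uniq) (simp add: const_poly_simps algebra_simps)
    ultimately show "Vector_Spaces.linear (\<lambda>c f. const_poly c * f) (*) \<phi>"
      using vs mvp.vector_space_axioms by (simp add: Vector_Spaces.linear_iff)
    show "\<phi> f = 0 \<longleftrightarrow> f \<in> ?W" for f
      using \<phi>[of f] uniq[of f 0] by (auto simp: const_poly_simps)
  qed
qed

section \<open>The bilinear form \<phi>(x y)\<close>

context
  fixes \<phi> :: "('n, 'k) mvpoly \<Rightarrow> 'k"
  assumes linear_\<phi>: "Vector_Spaces.linear (\<lambda>c f. const_poly c * f) (*) \<phi>"
    and \<phi>_eq_0_iff: "\<And>f. \<phi> f = 0 \<longleftrightarrow> f \<in> filt_mod (ri - 1)"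
begin

interpretation \<phi>: Vector_Spaces.linear "\<lambda>c f. const_poly c * f" "(*)" \<phi>
  by (rule linear_\<phi>)

lemma linear_\<phi>_left: "Vector_Spaces.linear (\<lambda>c f. const_poly c * f) (*) (\<lambda>x. \<phi> (x * y))"
  and linear_\<phi>_right: "Vector_Spaces.linear (\<lambda>c f. const_poly c * f) (*) (\<lambda>y. \<phi> (x * y))"
proof -
  have scale: "\<phi> (const_poly c * z * y) = c * \<phi> (z * y)" "\<phi> (x * (const_poly c * z)) = c * \<phi> (x * z)" for c z
    using \<phi>.scale[of c "z * y"] \<phi>.scale[of c "x * z"] by (simp_all only: ac_simps)
  show "Vector_Spaces.linear (\<lambda>c f. const_poly c * f) (*) (\<lambda>x. \<phi> (x * y))"
    and "Vector_Spaces.linear (\<lambda>c f. const_poly c * f) (*) (\<lambda>y. \<phi> (x * y))"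
    unfolding Vector_Spaces.linear_iff
    by (intro conjI allI mvp.vector_space_axioms \<phi>.vs2.vector_space_axioms scale,
        simp add: distrib_right distrib_left \<phi>.add)+
qed

lemma \<phi>_I: "x \<in> I \<Longrightarrow> \<phi> (x * y) = 0"
  using is_ideal_mult_right[OF ideal_I] I_subset_filt_mod by (auto simp: \<phi>_eq_0_iff)

lemma rel_dim_\<phi>_pairing:
  assumes "mvp.subspace A" "I \<subseteq> A" "mvp.subspace B" "A \<subseteq> B"
    "mvp.subspace C" "I \<subseteq> C" "mvp.subspace D" "C \<subseteq> D"
    "\<And>x y. x \<in> B \<Longrightarrow> y \<in> C \<Longrightarrow> \<phi> (x * y) = 0"
    "\<And>x. x \<in> B \<Longrightarrow> (\<And>y. y \<in> D \<Longrightarrow> \<phi> (x * y) = 0) \<Longrightarrow> x \<in> A"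
  shows "mvp.rel_dim I B + mvp.rel_dim I C \<le> mvp.rel_dim I A + mvp.rel_dim I D"
  by (rule mvp.rel_dim_pairing[OF fin_codim_I assms(1-8) linear_\<phi>_left linear_\<phi>_right \<phi>_I assms(9,10)])

lemma subspace_left_orthogonal: "mvp.subspace {x. \<forall>y\<in>S. \<phi> (x * y) = 0}"
  unfolding mvp.subspace_def by (simp add: distrib_right \<phi>.add mult.assoc \<phi>.scale \<phi>.zero)

text \<open>Two applications of the pairing inequality give \<open>U \<subseteq> U\<^sup>\<bottom>\<^sup>\<bottom>\<close> with equality.\<close>

lemma separating_multiplier:
  assumes nondeg: "\<And>f. f \<notin> I \<Longrightarrow> \<exists>g. \<phi> (f * g) \<noteq> 0"
    and U: "mvp.subspace U" "I \<subseteq> U" and t: "t \<notin> U"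
  shows "\<exists>g. (\<forall>u\<in>U. \<phi> (g * u) = 0) \<and> \<phi> (g * t) \<noteq> 0"
proof (rule ccontr)
  assume none: "\<not> ?thesis"
  let ?V = "{g. \<forall>u\<in>U. \<phi> (g * u) = 0}"
  let ?U' = "mvp.span (insert t U)"
  have sI: "mvp.subspace I" by (rule is_ideal_imp_subspace[OF ideal_I])
  have sV: "mvp.subspace ?V" by (rule subspace_left_orthogonal)
  have IV: "I \<subseteq> ?V" using \<phi>_I by auto
  have UU': "U \<subseteq> ?U'" by (auto intro: mvp.span_base)
  \<comment> \<open>The first inequality bounds the codimension of \<open>?V\<close> by dim U, the
    second bounds dim \<open>?U'\<close> by the codimension of \<open>?V\<close>. For the latter,
    \<open>none\<close> is what makes \<open>?V\<close> orthogonal to t as well.\<close>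
  have "mvp.rel_dim I UNIV + mvp.rel_dim I I \<le> mvp.rel_dim I ?V + mvp.rel_dim I U"
  proof (intro rel_dim_\<phi>_pairing sV IV mvp.subspace_UNIV sI U subset_UNIV order_refl)
    show "\<phi> (x * y) = 0" if "y \<in> I" for x y using \<phi>_I[OF that, of x] by (simp add: mult.commute)
  qed auto
  moreover have "mvp.rel_dim I ?U' + mvp.rel_dim I ?V \<le> mvp.rel_dim I I + mvp.rel_dim I UNIV"
  proof (intro rel_dim_\<phi>_pairing sV IV mvp.subspace_UNIV sI mvp.subspace_span subset_UNIV order_refl)
    show "I \<subseteq> ?U'" using U UU' by blast
    show "\<phi> (x * y) = 0" if "x \<in> ?U'" "y \<in> ?V" for x y
    proof -
      interpret b: Vector_Spaces.linear "\<lambda>c f. const_poly c * f" "(*)" "\<lambda>x. \<phi> (x * y)"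
        by (rule linear_\<phi>_left)
      show ?thesis
      proof (rule b.eq_0_on_span[OF _ that(1)])
        fix u assume "u \<in> insert t U"
        then have "\<phi> (y * u) = 0" using that(2) none by blast
        then show "\<phi> (u * y) = 0" by (simp add: mult.commute)
      qed
    qed
    show "x \<in> I" if "\<And>y. y \<in> UNIV \<Longrightarrow> \<phi> (x * y) = 0" for x using nondeg[of x] that by auto
  qed
  ultimately have "mvp.rel_dim I ?U' \<le> mvp.rel_dim I U" by linarith
  then have "U = ?U'"
    by (rule mvp.rel_dim_eq_imp_eq[OF fin_codim_I U mvp.subspace_span UU'])
  then show False using t mvp.span_base[of t "insert t U"] by blast
qed

lemma locally_gorenstein_if_nondegenerate:
  assumes nondeg: "\<And>f. f \<notin> I \<Longrightarrow> \<exists>g. \<phi> (f * g) \<noteq> 0"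
  shows "locally_gorenstein I"
  unfolding locally_gorenstein_def
proof
  fix Q assume "Q \<in> primary_components I"
  then obtain M where M: "M \<in> max_ideals" and Q: "Q = component M" using primary_components_eq by blast
  note fM = max_ideal_facts[OF M] and fQ = component_facts[OF M, folded Q]
  interpret h: surjective_ring_hom "\<lambda>x. I +>\<^bsub>\<P>\<^esub> x" R by (rule coset_hom)
  have kerh: "h.ker \<subseteq> Q" using surjective_ring_hom_coset(2)[OF ideal_I] fQ(2) by simp
  note q = h.surjective_ring_hom_quotient[OF fQ(1) kerh, folded img_quot_def]
  have uniq: "p = M" if p: "is_prime_ideal p" "Q \<subseteq> p" for p
  proof -
    have "M \<subseteq> p"
      using fQ(5) p(2) is_prime_ideal_power[OF p(1)] by (auto simp: ideal_radical_type_algebra)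
    then show ?thesis using is_max_ideal_unique[OF fM(5)] p(1) by (auto simp: is_prime_ideal_def)
  qed
  \<comment> \<open>Separating 1 from M gives a functional that vanishes on M and is represented as
    \<phi>(s _); non-degeneracy turns \<phi>(s M) = 0 into s M \<subseteq> I.\<close>
  obtain s where s: "\<forall>m\<in>M. \<phi> (s * m) = 0" "\<phi> (s * 1) \<noteq> 0"
    using separating_multiplier[OF nondeg is_ideal_imp_subspace[OF fM(1)] fM(4,3)] by blast
  have sM: "s * m \<in> I" if "m \<in> M" for m
  proof (rule ccontr)
    assume "s * m \<notin> I"
    then obtain g where "\<phi> (s * m * g) \<noteq> 0" using nondeg by blast
    then show False using s(1) is_ideal_mult_right[OF fM(1) that, of g] by (auto simp: mult.assoc)
  qed
  have sI: "s \<notin> I" using s(2) I_subset_filt_mod by (auto simp: \<phi>_eq_0_iff)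
  have annM: "{h. h * s \<in> I} = M"
    by (rule is_max_ideal_unique[OF fM(5) is_ideal_colon[OF ideal_I]]) (use sI sM in \<open>auto simp: mult.commute\<close>)
  \<comment> \<open>Otherwise some g is orthogonal to I + (s) but not to t. Then g s lies in I, so g
    lies in M, and t g would lie in I.\<close>
  have gen: "\<exists>x. t - x * s \<in> I" if t: "\<forall>m\<in>M. t * m \<in> I" for t
  proof (rule ccontr)
    assume none: "\<not> ?thesis"
    let ?U = "{y. \<exists>x. y - x * s \<in> I}"
    have "I \<subseteq> ?U" by (auto intro!: exI[of _ 0])
    moreover have "t \<notin> ?U" using none by blast
    ultimately obtain g where g: "\<forall>u\<in>?U. \<phi> (g * u) = 0" "\<phi> (g * t) \<noteq> 0"
      using separating_multiplier[OF nondeg is_ideal_imp_subspace[OF is_ideal_plus_multiples[OF ideal_I, of s]]] by blast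
    have "g * s \<in> I"
    proof (rule ccontr)
      assume "g * s \<notin> I"
      then obtain k where k: "\<phi> (g * s * k) \<noteq> 0" using nondeg by blast
      have "k * s - k * s \<in> I" using is_ideal_0[OF ideal_I] by simp
      then have "k * s \<in> ?U" by blast
      then have "\<phi> (g * (k * s)) = 0" using g(1) by blast
      then show False using k by (simp add: ac_simps)
    qed
    then have "g \<in> M" using annM by blast
    then have "t * g \<in> I" using t by blast
    then show False using g(2) I_subset_filt_mod by (auto simp: \<phi>_eq_0_iff mult.commute)
  qed
  \<comment> \<open>To pass from R to its local ring at M: if t M lies in Q, then e t kills M modulo
    I and is a multiple of s; dividing by e modulo M recovers t modulo Q.\<close>
  obtain e where e: "e \<notin> M" "\<forall>M'\<in>max_ideals - {M}. e \<in> component M'" using component_others[OF M] by blast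
  obtain y where y: "1 - y * e \<in> M" using e(1) fM(5) by (auto simp: is_max_ideal_def)
  have "\<exists>x. t - x * s \<in> Q" if t: "\<forall>m\<in>M. t * m \<in> Q" for t
  proof -
    have "(e * t) * m \<in> I" if m: "m \<in> M" for m
    proof -
      have "(e * t) * m \<in> component M'" if "M' \<in> max_ideals" for M'
      proof (cases "M' = M")
        case True
        have "t * m \<in> Q" using t m by blast
        then have "e * (t * m) \<in> Q" by (rule is_ideal_mult_left[OF fQ(1)])
        then show ?thesis by (simp add: True Q mult.assoc)
      next
        case False
        then have "e * (t * m) \<in> component M'"
          using e(2) that by (intro is_ideal_mult_right[OF component_facts(1)[OF that]]) blast
        then show ?thesis by (simp add: mult.assoc)
      qed
      then show ?thesis using Inter_components by blast
    qed
    then obtain x where "e * t - x * s \<in> I" using gen by blast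
    then have 1: "y * (e * t - x * s) \<in> Q" using fQ(2) by (intro is_ideal_mult_left[OF fQ(1)]) blast
    have "t * (1 - y * e) + y * (e * t - x * s) \<in> Q"
      using is_ideal_add[OF fQ(1) _ 1] t y by blast
    then have "t - (y * x) * s \<in> Q" by (simp add: algebra_simps)
    then show ?thesis by blast
  qed
  moreover have "s \<notin> Q"
  proof
    assume "s \<in> Q"
    then obtain k where "k \<notin> M" "k * s \<in> I" by (auto simp: Q component_def)
    then show False using annM by blast
  qed
  moreover have "\<forall>m\<in>M. s * m \<in> Q" using sM fQ(2) by blast
  ultimately show "gorenstein_local_ring (R Quot img_quot I Q)"
    using surjective_ring_hom.gorenstein_local_ring_iff[OF q(1) fM(5)] fQ(3) uniq unfolding q(2) by blast
qed

end

section \<open>Perfect graded pairings against non-degeneracy and symmetry\<close>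

lemma pairing_filt_mod:
  assumes graded_pairing_nondegenerate "f \<in> filt_mod i" "f \<notin> filt_mod (i - 1)"
  shows "\<exists>g\<in>filt_P (ri - i). f * g \<notin> filt_mod (ri - 1)"
proof -
  obtain f' where f': "f' \<in> filt_P i" "f - f' \<in> I" using assms(2) by (auto simp: filt_mod_def)
  have "f' \<notin> filt_mod (i - 1)" using f'(2) assms(3) filt_mod_cong I_subset_filt_mod by blast
  then obtain g where g: "g \<in> filt_P (ri - i)" "f' * g \<notin> filt_mod (ri - 1)"
    using assms(1) f'(1) unfolding graded_pairing_nondegenerate_def by blast
  have "(f - f') * g \<in> I" by (rule is_ideal_mult_right[OF ideal_I f'(2)])
  then have "f * g - f' * g \<in> filt_mod (ri - 1)" using I_subset_filt_mod by (auto simp: left_diff_distrib)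
  then show ?thesis using g filt_mod_cong by blast
qed

text \<open>Apply the pairing in the degree that is the order of f, the least i with f in
  \<open>filt_mod i\<close>.\<close>

lemma pairing_imp_nondegenerate:
  assumes graded_pairing_nondegenerate "f \<notin> I"
  shows "\<exists>g. f * g \<notin> filt_mod (ri - 1)"
proof -
  let ?P = "\<lambda>n. f \<in> filt_mod (int n)"
  have "?P (nat ri)" using filt_mod_eq_UNIV_iff[of ri] ri_nonneg by simp
  then have L: "?P (LEAST n. ?P n)" by (rule LeastI)
  have "f \<notin> filt_mod (int (LEAST n. ?P n) - 1)"
  proof (cases "LEAST n. ?P n")
    case 0
    \<comment> \<open>For order 0 the preceding step of the filtration has index -1 and is I
      itself.\<close>
    then show ?thesis using assms(2) by (simp add: filt_mod_neg)
  next
    case (Suc n)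
    then show ?thesis using not_less_Least[of n ?P] by simp
  qed
  then show ?thesis using pairing_filt_mod[OF assms(1) L] by blast
qed

text \<open>The pairing embeds G_i into the dual of G_{r-i}, so its dimension is at most that of
  G_{r-i}; replacing i by r - i gives equality.\<close>

lemma symmetric_if_pairing:
  assumes top: top_one_dim and pair: graded_pairing_nondegenerate
  shows "symmetric_HFa I"
proof -
  obtain \<phi> where \<phi>: "Vector_Spaces.linear (\<lambda>c f. const_poly c * f) (*) \<phi>"
    "\<And>f. \<phi> f = 0 \<longleftrightarrow> f \<in> filt_mod (ri - 1)" using top_functional[OF top] by blast
  have "HFa I i + HFa I (ri - i - 1) \<le> HFa I (i - 1) + HFa I (ri - i)" for i
    unfolding HFa_eq
  proof (rule rel_dim_\<phi>_pairing[OF \<phi>])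
    show "\<phi> (x * y) = 0" if "x \<in> filt_mod i" "y \<in> filt_mod (ri - i - 1)" for x y
      using filt_mod_mult[OF that] by (simp add: \<phi>(2))
    show "x \<in> filt_mod (i - 1)" if x: "x \<in> filt_mod i" "\<And>y. y \<in> filt_mod (ri - i) \<Longrightarrow> \<phi> (x * y) = 0" for x
    proof (rule ccontr)
      assume "x \<notin> filt_mod (i - 1)"
      then obtain g where "g \<in> filt_P (ri - i)" "x * g \<notin> filt_mod (ri - 1)"
        using pairing_filt_mod[OF pair x(1)] by blast
      then show False using x(2) filt_P_subset_filt_mod \<phi>(2) by blast
    qed
  qed (auto intro: filt_mod_subspace I_subset_filt_mod[THEN subsetD] filt_mod_mono[THEN subsetD, rotated])
  then have "Delta_HFa I i \<le> Delta_HFa I (ri - i)" for i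
    by (simp add: Delta_HFa_def) (smt (verit) of_nat_add of_nat_le_iff)
  from this[of "ri - i" for i] this show ?thesis
    by (auto simp: symmetric_HFa_def reg_index_eq intro!: antisym)
qed

lemma HFa_neg: "i < 0 \<Longrightarrow> HFa I i = 0"
  using rel_dim_self[OF is_ideal_imp_subspace[OF ideal_I]] by (simp add: HFa_eq filt_mod_neg)

lemma HFa_0: "HFa I 0 = 1"
proof -
  have "mvp.rel_dim I (filt_mod 0) = card {1 :: ('n, 'k) mvpoly}"
  proof (rule mvp.rel_dim_unique[OF is_ideal_imp_subspace[OF ideal_I]])
    have "1 \<in> filt_P 0" using hcomp_in_filt_P[of 0 1] by (simp add: hcomp_1)
    then show "{1} \<subseteq> filt_mod 0" using filt_P_subset_filt_mod by auto
    show "filt_mod 0 \<subseteq> mvp.span ({1} \<union> I)"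
    proof
      fix f assume "f \<in> filt_mod 0"
      then obtain f' where f': "f' \<in> filt_P 0" "f - f' \<in> I" by (auto simp: filt_mod_def)
      have "f' = const_poly (Poly_Mapping.lookup f' 0) * 1"
        using diff_hcomp_in_filt_P[OF f'(1)] by (simp add: filt_P_neg hcomp_0_eq)
      moreover have "const_poly (Poly_Mapping.lookup f' 0) * 1 \<in> mvp.span ({1} \<union> I)"
        by (rule mvp.span_scale[OF mvp.span_base]) simp
      ultimately have "f' \<in> mvp.span ({1} \<union> I)" by metis
      moreover have "f - f' \<in> mvp.span ({1} \<union> I)" using f'(2) by (auto intro: mvp.span_base)
      ultimately have "f' + (f - f') \<in> mvp.span ({1} \<union> I)" by (rule mvp.span_add)
      then show "f \<in> mvp.span ({1} \<union> I)" by simp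
    qed
    show "mvp.rel_indep I {1}" using const_in_I by (auto simp: mvp.rel_indep_def)
  qed simp
  then show ?thesis by (simp add: HFa_eq)
qed

text \<open>The summed form of symmetry: F_{r-1-i} R has the dimension expected of the orthogonal of
  F_i R.\<close>

lemma symmetric_HFa_sum:
  assumes "symmetric_HFa I"
  shows "HFa I i + HFa I (ri - 1 - i) = mvp.rel_dim I UNIV"
proof -
  have top: "HFa I ri = mvp.rel_dim I UNIV" using HFa_eq_dim_iff[of ri] by (simp add: dim_K_carrier)
  have step: "HFa I i + HFa I (ri - 1 - i) = HFa I (i - 1) + HFa I (ri - 1 - (i - 1))" for i
  proof -
    have "Delta_HFa I (ri - i) = Delta_HFa I i" using assms by (simp add: symmetric_HFa_def reg_index_eq)
    moreover have "ri - i - 1 = ri - 1 - i" "ri - 1 - (i - 1) = ri - i" by simp_all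
    ultimately have "int (HFa I i + HFa I (ri - 1 - i)) = int (HFa I (i - 1) + HFa I (ri - 1 - (i - 1)))"
      unfolding Delta_HFa_def by simp
    then show ?thesis by linarith
  qed
  show ?thesis
  \<comment> \<open>At -1 the first term is 0 and the second is HF(r), the full dimension;
    \<open>step\<close> moves the index in both directions.\<close>
  proof (induction i rule: int_induct[where k = "- 1"])
    case base
    then show ?case using top by (simp add: HFa_neg)
  next
    case (step1 i)
    then show ?case using step[of "i + 1"] by simp
  next
    case (step2 i)
    then show ?case using step[of i] by simp
  qed
qed

text \<open>At i = 0 the summed symmetry shows that F_{r-1} R has codimension dim F_0 R = 1.\<close>

lemma top_one_dim_if_symmetric:
  assumes "symmetric_HFa I"
  shows top_one_dim
proof -
  let ?W = "filt_mod (ri - 1)"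
  have "mvp.rel_dim I UNIV = mvp.rel_dim I ?W + 1"
    using symmetric_HFa_sum[OF assms, of 0] HFa_0 by (simp add: HFa_eq)
  then obtain E where E: "UNIV \<subseteq> mvp.span (E \<union> ?W)" "card E = 1"
    using mvp.rel_dim_supplement[OF fin_codim_I filt_mod_subspace I_subset_filt_mod mvp.subspace_UNIV subset_UNIV, of "ri - 1"]
    by auto
  then obtain h where h: "E = {h}" using card_1_singletonE by blast
  have span: "mvp.span ?W = ?W" using filt_mod_subspace by (simp add: mvp.span_eq_iff)
  have "\<exists>c. f - const_poly c * h \<in> ?W" for f
    using E(1) mvp.span_breakdown_eq[of f h ?W] unfolding h span by auto
  moreover have "h \<notin> ?W"
  proof
    assume "h \<in> ?W"
    then have "mvp.span (E \<union> ?W) = ?W" using span by (simp add: h insert_absorb)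
    then show False using E(1) filt_mod_eq_UNIV_iff[of "ri - 1"] by auto
  qed
  ultimately show ?thesis unfolding top_one_dim_def by blast
qed

text \<open>Non-degeneracy bounds the dimension of the orthogonal of F_{r-i} R by the codimension of
  F_{r-i} R, which by symmetry is dim F_{i-1} R. So the orthogonal is exactly F_{i-1} R, and f
  outside it pairs non-trivially.\<close>

lemma pairing_if_symmetric:
  assumes sym: "symmetric_HFa I" and nondeg: "\<And>f. f \<notin> I \<Longrightarrow> \<exists>g. f * g \<notin> filt_mod (ri - 1)"
  shows graded_pairing_nondegenerate
  unfolding graded_pairing_nondegenerate_def
proof (intro allI ballI impI)
  fix i f assume f: "f \<in> filt_P i" "f \<notin> filt_mod (i - 1)"
  obtain \<phi> where \<phi>: "Vector_Spaces.linear (\<lambda>c f. const_poly c * f) (*) \<phi>"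
    "\<And>f. \<phi> f = 0 \<longleftrightarrow> f \<in> filt_mod (ri - 1)"
    using top_functional[OF top_one_dim_if_symmetric[OF sym]] by blast
  let ?C = "filt_mod (ri - i)"
  let ?B = "{x. \<forall>y\<in>?C. \<phi> (x * y) = 0}"
  have sB: "mvp.subspace ?B" by (rule subspace_left_orthogonal[OF \<phi>])
  have sub: "filt_mod (i - 1) \<subseteq> ?B"
    using filt_mod_mult[of _ "i - 1" _ "ri - i"] by (auto simp: \<phi>(2))
  have "mvp.rel_dim I ?B + mvp.rel_dim I ?C \<le> mvp.rel_dim I I + mvp.rel_dim I UNIV"
  proof (rule rel_dim_\<phi>_pairing[OF \<phi>])
    show "I \<subseteq> ?B" using sub I_subset_filt_mod by blast
    show "x \<in> I" if "\<And>y. y \<in> UNIV \<Longrightarrow> \<phi> (x * y) = 0" for x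
      using that nondeg[of x] \<phi>(2) by blast
  qed (use sB in \<open>auto intro: filt_mod_subspace is_ideal_imp_subspace ideal_I I_subset_filt_mod[THEN subsetD] mvp.subspace_UNIV\<close>)
  moreover have "mvp.rel_dim I (filt_mod (i - 1)) + mvp.rel_dim I ?C = mvp.rel_dim I UNIV"
    using symmetric_HFa_sum[OF sym, of "i - 1"] by (simp add: HFa_eq)
  ultimately have "mvp.rel_dim I ?B \<le> mvp.rel_dim I (filt_mod (i - 1))"
    using rel_dim_self[OF is_ideal_imp_subspace[OF ideal_I]] by simp
  then have "filt_mod (i - 1) = ?B"
    by (rule mvp.rel_dim_eq_imp_eq[OF fin_codim_I filt_mod_subspace I_subset_filt_mod sB sub])
  then obtain y where y: "y \<in> ?C" "f * y \<notin> filt_mod (ri - 1)" using f(2) \<phi>(2) by blast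
  obtain g where g: "g \<in> filt_P (ri - i)" "y - g \<in> I" using y(1) by (auto simp: filt_mod_def)
  have "f * (y - g) \<in> I" by (rule is_ideal_mult_left[OF ideal_I g(2)])
  then have "f * y - f * g \<in> filt_mod (ri - 1)" using I_subset_filt_mod by (auto simp: right_diff_distrib)
  then have "f * g \<notin> filt_mod (ri - 1)" using y(2) filt_mod_cong by blast
  then show "\<exists>g\<in>filt_P (ri - i). f * g \<notin> filt_mod (ri - 1)" using g(1) by blast
qed

lemma strict_gorenstein_iff_pairing:
  "strict_gorenstein I \<longleftrightarrow> top_one_dim \<and> graded_pairing_nondegenerate"
  using strict_gorenstein_if_pairing pairing_if_strict_gorenstein by blast

lemma cayley_bacharach_symmetric_iff_pairing:
  "cayley_bacharach I \<and> symmetric_HFa I \<longleftrightarrow> top_one_dim \<and> graded_pairing_nondegenerate"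
  unfolding cayley_bacharach_iff
  using symmetric_if_pairing pairing_imp_nondegenerate top_one_dim_if_symmetric pairing_if_symmetric
  by blast

lemma strict_imp_locally_gorenstein:
  assumes "strict_gorenstein I" shows "locally_gorenstein I"
proof -
  have top: top_one_dim and pair: graded_pairing_nondegenerate
    using assms strict_gorenstein_iff_pairing by auto
  obtain \<phi> where \<phi>: "Vector_Spaces.linear (\<lambda>c f. const_poly c * f) (*) \<phi>"
    "\<And>f. \<phi> f = 0 \<longleftrightarrow> f \<in> filt_mod (ri - 1)" using top_functional[OF top] by blast
  show ?thesis
    by (rule locally_gorenstein_if_nondegenerate[OF \<phi>]) (use pairing_imp_nondegenerate[OF pair] \<phi>(2) in blast)
qed

end

theorem theorem6p8:
  fixes I :: "('n::finite, 'k::field) mvpoly set"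
  assumes "zero_dim_ideal I"
  shows "(strict_gorenstein I \<longleftrightarrow> cayley_bacharach I \<and> symmetric_HFa I) \<and>
         (strict_gorenstein I \<longrightarrow> locally_gorenstein I)"
proof -
  note I = zero_dim_ideal_iff[OF assms]
  interpret zero_dim_algebra I
    using I is_ideal_eq_UNIV[OF I(1)] by unfold_locales auto
  show ?thesis
    using strict_gorenstein_iff_pairing cayley_bacharach_symmetric_iff_pairing strict_imp_locally_gorenstein
    by blast
qed

end
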